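(* Let $k$ be a commutative ring, $S=k[x_1,\ldots,x_n]$, $d\ge1$ an integer, and $\Delta\subset\mathbb{N}^n$ a standard set of size $d$. The canonical inclusion $\mathcal{H}{\rm ilb}^\Delta_{S/k}\to\mathcal{H}{\rm ilb}^d_{S/k}$ is an open embedding of functors.
   Context: All rings are commutative with $1$; $x^\alpha=x_1^{\alpha_1}\cdots x_n^{\alpha_n}$ for $\alpha\in\mathbb{N}^n$, and $B[x]=B[x_1,\ldots,x_n]$. A standard set is a subset $\Delta\subset\mathbb{N}^n$ with $(\mathbb{N}^n-\Delta)+\mathbb{N}^n\subset\mathbb{N}^n-\Delta$. The Hilbert functor of points $\mathcal{H}{\rm ilb}^{d}_{S/k}:(k\text{-Alg})\to({\rm Sets})$ sends $B$ to the set of surjective $B$-algebra homomorphisms $\phi:B[x]\to Q$ with $Q$ a locally free $B$-module of rank $d$ (for each prime $\mathfrak{p}\subset B$ there is $f\in B-\mathfrak{p}$ with $Q_f$ free of rank $d$ over $B_f$), where $\phi\sim\phi'$ iff $\ker\phi=\ker\phi'$; functoriality is by base change. The subfunctor $\mathcal{H}{\rm ilb}^{\Delta}_{S/k}$ consists of those $\phi$ for which the composition $\bigoplus_{\beta\in\Delta}Bx^\beta\hookrightarrow B[x]\xrightarrow{\phi}Q$ is surjective (hence an isomorphism). An inclusion of functors $\mathcal{G}\subset\mathcal{F}$ on $k$-algebras is an open embedding if for every $k$-algebra $B$ and every morphism $h_{{\rm Spec}\,B}\to\mathcal{F}$ (equivalently, every element of $\mathcal{F}(B)$), the projection $\mathcal{G}\times_{\mathcal{F}}h_{{\rm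 Spec}\,B}\to h_{{\rm Spec}\,B}$ is isomorphic to the inclusion $h_U\to h_{{\rm Spec}\,B}$ for an open subscheme $U\subset{\rm Spec}\,B$, where $h_X={\rm Mor}_k(-,X)$. *)

theory Defs
  imports "HOL-Algebra.QuotRing" "HOL-Algebra.Module" "HOL-Algebra.IntRing"
begin

section \<open>Monoid algebras and polynomial rings\<close>

definition monoid_algebra ::
    "('r, 'x) ring_scheme \<Rightarrow> ('m, 'y) monoid_scheme \<Rightarrow> ('r, 'm \<Rightarrow> 'r) module" where
  "monoid_algebra R M =
    \<lparr>carrier = {p. (\<forall>m. p m \<in> carrier R) \<and> (\<forall>m. m \<notin> carrier M \<longrightarrow> p m = \<zero>\<^bsub>R\<^esub>) \<and>
                   finite {m. p m \<noteq> \<zero>\<^bsub>R\<^esub>}},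
     monoid.mult = (\<lambda>p q m. finsum R (\<lambda>(a, b). p a \<otimes>\<^bsub>R\<^esub> q b)
               {(a, b). a \<in> carrier M \<and> b \<in> carrier M \<and> p a \<noteq> \<zero>\<^bsub>R\<^esub> \<and> q b \<noteq> \<zero>\<^bsub>R\<^esub> \<and>
                        a \<otimes>\<^bsub>M\<^esub> b = m}),
     one = (\<lambda>m. if m = \<one>\<^bsub>M\<^esub> then \<one>\<^bsub>R\<^esub> else \<zero>\<^bsub>R\<^esub>),
     zero = (\<lambda>m. \<zero>\<^bsub>R\<^esub>),
     add = (\<lambda>p q m. p m \<oplus>\<^bsub>R\<^esub> q m),
     smult = (\<lambda>r p m. r \<otimes>\<^bsub>R\<^esub> p m)\<rparr>"

definition monomial :: "('r, 'x) ring_scheme \<Rightarrow> 'm \<Rightarrow> 'm \<Rightarrow> 'r" where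
  "monomial R m = (\<lambda>m'. if m' = m then \<one>\<^bsub>R\<^esub> else \<zero>\<^bsub>R\<^esub>)"

text \<open>An element of \<open>\<nat>\<^sup>n\<close> is a function on all of \<open>nat\<close> that vanishes outside \<open>{1..n}\<close>.\<close>

definition exponents :: "nat \<Rightarrow> (nat \<Rightarrow> nat) monoid" where
  "exponents n = \<lparr>carrier = {\<alpha>. \<forall>i. i \<notin> {1..n} \<longrightarrow> \<alpha> i = 0},
                  monoid.mult = (\<lambda>\<alpha> \<beta> i. \<alpha> i + \<beta> i), one = (\<lambda>i. 0)\<rparr>"

definition mpoly_ring :: "nat \<Rightarrow> ('b, 'x) ring_scheme \<Rightarrow> ('b, (nat \<Rightarrow> nat) \<Rightarrow> 'b) module" where
  "mpoly_ring n B = monoid_algebra B (exponents n)"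

definition standard_set :: "nat \<Rightarrow> (nat \<Rightarrow> nat) set \<Rightarrow> bool" where
  "standard_set n \<Delta> \<longleftrightarrow> \<Delta> \<subseteq> carrier (exponents n) \<and>
    (\<forall>\<alpha> \<in> carrier (exponents n) - \<Delta>. \<forall>\<beta> \<in> carrier (exponents n).
       \<alpha> \<otimes>\<^bsub>exponents n\<^esub> \<beta> \<in> carrier (exponents n) - \<Delta>)"


section \<open>Algebra homomorphisms and tensor products\<close>

definition alg_hom ::
    "('r, 'x) ring_scheme \<Rightarrow> ('r, 'a, 'y) module_scheme \<Rightarrow> ('r, 'c, 'z) module_scheme
      \<Rightarrow> ('a \<Rightarrow> 'c) set" where
  "alg_hom R M N = {h \<in> ring_hom M N.
     \<forall>r \<in> carrier R. \<forall>m \<in> carrier M. h (r \<odot>\<^bsub>M\<^esub> m) = r \<odot>\<^bsub>N\<^esub> h m}"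

text \<open>For a ring homomorphism \<open>f\<close> from \<open>B\<close> to \<open>A\<close> and a \<open>B\<close>-algebra \<open>Q\<close>, the ring
  \<open>A \<otimes>\<^sub>B Q\<close> is the free abelian group on \<open>A \<times> Q\<close> modulo bilinearity and \<open>B\<close>-balancedness.
  The free abelian group with the product \<open>(a, q) (a', q') = (a a', q q')\<close> is the integral monoid
  algebra of the multiplicative monoid \<open>A \<times> Q\<close>. The subgroup generated by the relations is
  already an ideal, so dividing by the generated ideal changes nothing.\<close>

definition tensor_relations ::
    "('b \<Rightarrow> 'a) \<Rightarrow> ('b, 'x) ring_scheme \<Rightarrow> ('a, 'y) ring_scheme \<Rightarrow> ('b, 'q, 'z) module_scheme
      \<Rightarrow> ('a \<times> 'q \<Rightarrow> int) set" where
  "tensor_relations f B A Q =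
    (let Z = monoid_algebra \<Z> (A \<times>\<times> Q); e = (\<lambda>a q. monomial \<Z> (a, q)) in
      {e (a \<oplus>\<^bsub>A\<^esub> a') q \<ominus>\<^bsub>Z\<^esub> (e a q \<oplus>\<^bsub>Z\<^esub> e a' q) | a a' q.
         a \<in> carrier A \<and> a' \<in> carrier A \<and> q \<in> carrier Q} \<union>
      {e a (q \<oplus>\<^bsub>Q\<^esub> q') \<ominus>\<^bsub>Z\<^esub> (e a q \<oplus>\<^bsub>Z\<^esub> e a q') | a q q'.
         a \<in> carrier A \<and> q \<in> carrier Q \<and> q' \<in> carrier Q} \<union>
      {e (f b \<otimes>\<^bsub>A\<^esub> a) q \<ominus>\<^bsub>Z\<^esub> e a (b \<odot>\<^bsub>Q\<^esub> q) | a b q.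
         a \<in> carrier A \<and> b \<in> carrier B \<and> q \<in> carrier Q})"

definition tensor_ideal ::
    "('b \<Rightarrow> 'a) \<Rightarrow> ('b, 'x) ring_scheme \<Rightarrow> ('a, 'y) ring_scheme \<Rightarrow> ('b, 'q, 'z) module_scheme
      \<Rightarrow> ('a \<times> 'q \<Rightarrow> int) set" where
  "tensor_ideal f B A Q =
    Idl\<^bsub>monoid_algebra \<Z> (A \<times>\<times> Q)\<^esub> (tensor_relations f B A Q)"

definition tensor_ring ::
    "('b \<Rightarrow> 'a) \<Rightarrow> ('b, 'x) ring_scheme \<Rightarrow> ('a, 'y) ring_scheme \<Rightarrow> ('b, 'q, 'z) module_scheme
      \<Rightarrow> ('a \<times> 'q \<Rightarrow> int) set ring" where
  "tensor_ring f B A Q = monoid_algebra \<Z> (A \<times>\<times> Q) Quot (tensor_ideal f B A Q)"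

definition pure_tensor ::
    "('b \<Rightarrow> 'a) \<Rightarrow> ('b, 'x) ring_scheme \<Rightarrow> ('a, 'y) ring_scheme \<Rightarrow> ('b, 'q, 'z) module_scheme
      \<Rightarrow> 'a \<Rightarrow> 'q \<Rightarrow> ('a \<times> 'q \<Rightarrow> int) set" where
  "pure_tensor f B A Q a q =
    tensor_ideal f B A Q +>\<^bsub>monoid_algebra \<Z> (A \<times>\<times> Q)\<^esub> monomial \<Z> (a, q)"

text \<open>The map \<open>id\<^sub>A \<otimes> \<phi>\<close> on \<open>A \<otimes>\<^sub>B B[x]\<close>, where the latter is identified with \<open>A[x]\<close> by sending
  \<open>a \<otimes> x\<^sup>\<alpha>\<close> to \<open>a x\<^sup>\<alpha>\<close>.\<close>

definition base_change_map ::
    "('b \<Rightarrow> 'a) \<Rightarrow> ('b, 'x) ring_scheme \<Rightarrow> ('a, 'y) ring_scheme \<Rightarrow> ('b, 'q, 'z) module_scheme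
      \<Rightarrow> (((nat \<Rightarrow> nat) \<Rightarrow> 'b) \<Rightarrow> 'q) \<Rightarrow> ((nat \<Rightarrow> nat) \<Rightarrow> 'a) \<Rightarrow> ('a \<times> 'q \<Rightarrow> int) set" where
  "base_change_map f B A Q \<phi> p =
    finsum (tensor_ring f B A Q)
      (\<lambda>\<alpha>. pure_tensor f B A Q (p \<alpha>) (\<phi> (monomial B \<alpha>))) {\<alpha>. p \<alpha> \<noteq> \<zero>\<^bsub>A\<^esub>}"


section \<open>Localization at one element and locally free modules\<close>

text \<open>The fraction \<open>m / f\<^sup>i\<close> as an equivalence class of pairs.\<close>

definition fraction ::
    "('b, 'x) ring_scheme \<Rightarrow> 'b \<Rightarrow> ('b, 'q, 'z) module_scheme \<Rightarrow> 'q \<Rightarrow> nat \<Rightarrow> ('q \<times> nat) set" where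
  "fraction B f M m i = {(m', j). m' \<in> carrier M \<and>
     (\<exists>l. (f [^]\<^bsub>B\<^esub> (l + j)) \<odot>\<^bsub>M\<^esub> m = (f [^]\<^bsub>B\<^esub> (l + i)) \<odot>\<^bsub>M\<^esub> m')}"

definition localization ::
    "('b, 'x) ring_scheme \<Rightarrow> 'b \<Rightarrow> ('b, 'q, 'z) module_scheme
      \<Rightarrow> (('b \<times> nat) set, ('q \<times> nat) set) module" where
  "localization B f M =
    \<lparr>carrier = {fraction B f M m i | m i. m \<in> carrier M},
     monoid.mult = (\<lambda>X Y. \<Union>(m, i)\<in>X. \<Union>(m', j)\<in>Y. fraction B f M (m \<otimes>\<^bsub>M\<^esub> m') (i + j)),
     one = fraction B f M \<one>\<^bsub>M\<^esub> 0,
     zero = fraction B f M \<zero>\<^bsub>M\<^esub> 0,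
     add = (\<lambda>X Y. \<Union>(m, i)\<in>X. \<Union>(m', j)\<in>Y.
       fraction B f M (((f [^]\<^bsub>B\<^esub> j) \<odot>\<^bsub>M\<^esub> m) \<oplus>\<^bsub>M\<^esub> ((f [^]\<^bsub>B\<^esub> i) \<odot>\<^bsub>M\<^esub> m')) (i + j)),
     smult = (\<lambda>X Y. \<Union>(b, i)\<in>X. \<Union>(m, j)\<in>Y. fraction B f M (b \<odot>\<^bsub>M\<^esub> m) (i + j))\<rparr>"

definition self_algebra :: "('b, 'x) ring_scheme \<Rightarrow> ('b, 'b) module" where
  "self_algebra B = \<lparr>carrier = carrier B, monoid.mult = monoid.mult B, one = one B, zero = zero B,
                     add = add B, smult = monoid.mult B\<rparr>"

definition free_of_rank :: "('r, 'x) ring_scheme \<Rightarrow> ('r, 'q, 'z) module_scheme \<Rightarrow> nat \<Rightarrow> bool" where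
  "free_of_rank R M d \<longleftrightarrow>
    (\<exists>e \<in> {..<d} \<rightarrow> carrier M. \<forall>m \<in> carrier M. \<exists>!c. c \<in> {..<d} \<rightarrow>\<^sub>E carrier R \<and>
       m = finsum M (\<lambda>i. c i \<odot>\<^bsub>M\<^esub> e i) {..<d})"

definition locally_free_of_rank ::
    "('b, 'x) ring_scheme \<Rightarrow> ('b, 'q, 'z) module_scheme \<Rightarrow> nat \<Rightarrow> bool" where
  "locally_free_of_rank B Q d \<longleftrightarrow>
    (\<forall>P. primeideal P B \<longrightarrow> (\<exists>f \<in> carrier B - P.
       free_of_rank (localization B f (self_algebra B)) (localization B f Q) d))"


section \<open>Set-valued functors on k-algebras\<close>

text \<open>The category of \<open>k\<close>-algebras consists of the algebras whose carrier is a subset of the type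
  \<open>'b\<close>, which plays the role of the universe and is arbitrary. Homomorphisms are required to be
  extensional, so that equality of homomorphisms is equality of functions.\<close>

record ('k, 'b, 's) alg_functor =
  fobj :: "('k, 'b) module \<Rightarrow> 's set"
  fmap :: "('k, 'b) module \<Rightarrow> ('k, 'b) module \<Rightarrow> ('b \<Rightarrow> 'b) \<Rightarrow> 's \<Rightarrow> 's"

definition hom_set ::
    "('k, 'x) ring_scheme \<Rightarrow> ('k, 'b) module \<Rightarrow> ('k, 'b) module \<Rightarrow> ('b \<Rightarrow> 'b) set" where
  "hom_set k B A = alg_hom k B A \<inter> extensional (carrier B)"

definition is_functor :: "('k, 'x) ring_scheme \<Rightarrow> ('k, 'b, 's) alg_functor \<Rightarrow> bool" where
  "is_functor k F \<longleftrightarrow>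
    (\<forall>B A f. algebra k B \<longrightarrow> algebra k A \<longrightarrow> f \<in> hom_set k B A \<longrightarrow>
       fmap F B A f \<in> fobj F B \<rightarrow> fobj F A) \<and>
    (\<forall>B s. algebra k B \<longrightarrow> s \<in> fobj F B \<longrightarrow> fmap F B B (\<lambda>b\<in>carrier B. b) s = s) \<and>
    (\<forall>B A C f g s. algebra k B \<longrightarrow> algebra k A \<longrightarrow> algebra k C \<longrightarrow>
       f \<in> hom_set k B A \<longrightarrow> g \<in> hom_set k A C \<longrightarrow> s \<in> fobj F B \<longrightarrow>
       fmap F B C (compose (carrier B) g f) s = fmap F A C g (fmap F B A f s))"

definition nat_trans ::
    "('k, 'x) ring_scheme \<Rightarrow> ('k, 'b, 's) alg_functor \<Rightarrow> ('k, 'b, 't) alg_functor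
      \<Rightarrow> (('k, 'b) module \<Rightarrow> 's \<Rightarrow> 't) \<Rightarrow> bool" where
  "nat_trans k F G \<tau> \<longleftrightarrow>
    (\<forall>B. algebra k B \<longrightarrow> \<tau> B \<in> fobj F B \<rightarrow> fobj G B) \<and>
    (\<forall>B A f s. algebra k B \<longrightarrow> algebra k A \<longrightarrow> f \<in> hom_set k B A \<longrightarrow> s \<in> fobj F B \<longrightarrow>
       \<tau> A (fmap F B A f s) = fmap G B A f (\<tau> B s))"

definition nat_iso ::
    "('k, 'x) ring_scheme \<Rightarrow> ('k, 'b, 's) alg_functor \<Rightarrow> ('k, 'b, 't) alg_functor
      \<Rightarrow> (('k, 'b) module \<Rightarrow> 's \<Rightarrow> 't) \<Rightarrow> bool" where
  "nat_iso k F G \<tau> \<longleftrightarrow> nat_trans k F G \<tau> \<and>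
    (\<forall>B. algebra k B \<longrightarrow> bij_betw (\<tau> B) (fobj F B) (fobj G B))"

definition subfunctor ::
    "('k, 'x) ring_scheme \<Rightarrow> ('k, 'b, 's) alg_functor \<Rightarrow> ('k, 'b, 's) alg_functor \<Rightarrow> bool" where
  "subfunctor k G F \<longleftrightarrow> is_functor k G \<and> is_functor k F \<and>
    (\<forall>B. algebra k B \<longrightarrow> fobj G B \<subseteq> fobj F B) \<and> nat_trans k G F (\<lambda>B s. s)"

text \<open>The fibre product of \<open>\<sigma> : G \<longlongrightarrow> F\<close> and \<open>\<tau> : H \<longlongrightarrow> F\<close>.\<close>

definition fibre_product ::
    "('k, 'b, 's) alg_functor \<Rightarrow> (('k, 'b) module \<Rightarrow> 's \<Rightarrow> 'u)
      \<Rightarrow> ('k, 'b, 't) alg_functor \<Rightarrow> (('k, 'b) module \<Rightarrow> 't \<Rightarrow> 'u)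
      \<Rightarrow> ('k, 'b, 's \<times> 't) alg_functor" where
  "fibre_product G \<sigma> H \<tau> =
    \<lparr>fobj = (\<lambda>A. {(s, t). s \<in> fobj G A \<and> t \<in> fobj H A \<and> \<sigma> A s = \<tau> A t}),
     fmap = (\<lambda>A C g (s, t). (fmap G A C g s, fmap H A C g t))\<rparr>"


section \<open>Open embeddings\<close>

definition spec :: "('b, 'x) ring_scheme \<Rightarrow> 'b set set" where
  "spec B = {P. primeideal P B}"

definition spec_open :: "('b, 'x) ring_scheme \<Rightarrow> 'b set set \<Rightarrow> bool" where
  "spec_open B U \<longleftrightarrow> (\<exists>E \<subseteq> carrier B. U = {P \<in> spec B. \<not> E \<subseteq> P})"

definition spec_map ::
    "('b, 'x) ring_scheme \<Rightarrow> ('b \<Rightarrow> 'a) \<Rightarrow> 'a set \<Rightarrow> 'b set" where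
  "spec_map B f P = {b \<in> carrier B. f b \<in> P}"

text \<open>The functor of points of the open subscheme \<open>U\<close> of \<open>Spec B\<close> on affine \<open>k\<close>-schemes: a
  \<open>k\<close>-morphism from \<open>Spec A\<close> to \<open>U\<close> is a \<open>k\<close>-morphism from \<open>Spec A\<close> to \<open>Spec B\<close>, that is, a
  \<open>k\<close>-algebra homomorphism from \<open>B\<close> to \<open>A\<close>, whose underlying map of spaces takes values in \<open>U\<close>.\<close>

definition h_open ::
    "('k, 'x) ring_scheme \<Rightarrow> ('k, 'b) module \<Rightarrow> 'b set set \<Rightarrow> ('k, 'b, 'b \<Rightarrow> 'b) alg_functor" where
  "h_open k B U =
    \<lparr>fobj = (\<lambda>A. {f \<in> hom_set k B A. spec_map B f ` spec A \<subseteq> U}),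
     fmap = (\<lambda>A C g f. compose (carrier B) g f)\<rparr>"

definition h_spec ::
    "('k, 'x) ring_scheme \<Rightarrow> ('k, 'b) module \<Rightarrow> ('k, 'b, 'b \<Rightarrow> 'b) alg_functor" where
  "h_spec k B =
    \<lparr>fobj = (\<lambda>A. hom_set k B A), fmap = (\<lambda>A C g f. compose (carrier B) g f)\<rparr>"

text \<open>The last conjunct says that \<open>\<eta>\<close> is an isomorphism over \<open>h_spec k B\<close>: the inclusion of
  \<open>h_open k B U\<close> after \<open>\<eta>\<close> is the projection of the fibre product.\<close>

definition open_embedding ::
    "('k, 'x) ring_scheme \<Rightarrow> ('k, 'b, 's) alg_functor \<Rightarrow> ('k, 'b, 's) alg_functor \<Rightarrow> bool" where
  "open_embedding k G F \<longleftrightarrow> subfunctor k G F \<and>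
    (\<forall>B \<tau>. algebra k B \<longrightarrow> nat_trans k (h_spec k B) F \<tau> \<longrightarrow>
      (\<exists>U. spec_open B U \<and>
        (\<exists>\<eta>. nat_iso k (fibre_product G (\<lambda>A s. s) (h_spec k B) \<tau>) (h_open k B U) \<eta> \<and>
          (\<forall>A. algebra k A \<longrightarrow>
            (\<forall>z \<in> fobj (fibre_product G (\<lambda>A s. s) (h_spec k B) \<tau>) A. \<eta> A z = snd z)))))"


section \<open>The Hilbert functors\<close>

definition hilb_surjection ::
    "nat \<Rightarrow> nat \<Rightarrow> ('b, 'x) ring_scheme \<Rightarrow> ('b, 'q) module \<Rightarrow> (((nat \<Rightarrow> nat) \<Rightarrow> 'b) \<Rightarrow> 'q) \<Rightarrow> bool" where
  "hilb_surjection n d B Q \<phi> \<longleftrightarrow> algebra B Q \<and> \<phi> \<in> alg_hom B (mpoly_ring n B) Q \<and>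
     \<phi> ` carrier (mpoly_ring n B) = carrier Q \<and> locally_free_of_rank B Q d"

text \<open>The submodule of \<open>B[x]\<close> with basis the monomials \<open>x\<^sup>\<beta>\<close>, \<open>\<beta> \<in> \<Delta>\<close>.\<close>

definition monomial_span ::
    "nat \<Rightarrow> (nat \<Rightarrow> nat) set \<Rightarrow> ('b, 'x) ring_scheme \<Rightarrow> ((nat \<Rightarrow> nat) \<Rightarrow> 'b) set" where
  "monomial_span n \<Delta> B = {p \<in> carrier (mpoly_ring n B). \<forall>\<beta>. \<beta> \<notin> \<Delta> \<longrightarrow> p \<beta> = \<zero>\<^bsub>B\<^esub>}"

text \<open>The class of \<open>\<phi> : B[x] \<longlongrightarrow> Q\<close> is represented by the kernel of \<open>\<phi>\<close>, since two surjections are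
  identified iff their kernels coincide. The type chosen for \<open>Q\<close> contains \<open>B[x]/I\<close> for every
  ideal \<open>I\<close>, so every class has a representative with \<open>Q\<close> of this type.\<close>

definition hilb_map ::
    "nat \<Rightarrow> nat \<Rightarrow> ('k, 'b) module \<Rightarrow> ('k, 'b) module \<Rightarrow> ('b \<Rightarrow> 'b)
      \<Rightarrow> ((nat \<Rightarrow> nat) \<Rightarrow> 'b) set \<Rightarrow> ((nat \<Rightarrow> nat) \<Rightarrow> 'b) set" where
  "hilb_map n d B A f I =
    (THE J. \<exists>(Q :: ('b, ((nat \<Rightarrow> nat) \<Rightarrow> 'b) set) module) \<phi>.
       hilb_surjection n d B Q \<phi> \<and> a_kernel (mpoly_ring n B) Q \<phi> = I \<and>
       J = a_kernel (mpoly_ring n A) (tensor_ring f B A Q) (base_change_map f B A Q \<phi>))"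

definition Hilb ::
    "nat \<Rightarrow> nat \<Rightarrow> ('k, 'b, ((nat \<Rightarrow> nat) \<Rightarrow> 'b) set) alg_functor" where
  "Hilb n d =
    \<lparr>fobj = (\<lambda>B. {a_kernel (mpoly_ring n B) Q \<phi> |
       (Q :: ('b, ((nat \<Rightarrow> nat) \<Rightarrow> 'b) set) module) \<phi>. hilb_surjection n d B Q \<phi>}),
     fmap = hilb_map n d\<rparr>"

definition Hilb_Delta ::
    "nat \<Rightarrow> nat \<Rightarrow> (nat \<Rightarrow> nat) set \<Rightarrow> ('k, 'b, ((nat \<Rightarrow> nat) \<Rightarrow> 'b) set) alg_functor" where
  "Hilb_Delta n d \<Delta> =
    \<lparr>fobj = (\<lambda>B. {a_kernel (mpoly_ring n B) Q \<phi> |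
       (Q :: ('b, ((nat \<Rightarrow> nat) \<Rightarrow> 'b) set) module) \<phi>. hilb_surjection n d B Q \<phi> \<and>
         \<phi> ` monomial_span n \<Delta> B = carrier Q}),
     fmap = hilb_map n d\<rparr>"

end

(*
  A point of the Hilbert functor over B is an ideal I of B[x] with B[x]/I locally free of rank d,
  and base change along f : B -> A sends I to the extended ideal I A[x], because A (x) B[x]/I is
  A[x] modulo I A[x].  The required open set of Spec B is the complement of the support of the
  cokernel of the map from the span of the monomials x^beta, beta in Delta, to Q = B[x]/I.

  If f maps Spec A into this open set, then the elements a of A such that a x^alpha lies in the
  span of Delta modulo I A[x] form an ideal contained in no prime ideal, so the span of Delta is
  everything.  Conversely let P be the preimage of a prime P' of A.  If P lies outside the open
  set, then, as Q is finitely generated near P, there are a proper submodule N of Q containing the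
  span of Delta and an element m such that Q = N + B m near P and b m in N implies b in P.  The
  coefficient of m is then a nonzero linear map from Q to the fraction field of B/P that kills N;
  its base change to A/P' is still nonzero and shows that Delta does not span A (x) Q.
*)

theory Submission
  imports Defs "HOL-Algebra.Ring_Divisibility"
begin

section \<open>Finite sums\<close>

text \<open>The recurring obstacle is denominators. Freeness near a prime yields, for each monomial
  \<open>m\<close>, a relation for \<open>g ^ n m\<close> times \<open>m\<close>, and the exponents
  \<open>n m\<close> need not be bounded over the infinitely many monomials. So a coordinate
  function on the localization of Q at \<open>g\<close> is represented not by one linear map but by
  a family indexed by \<open>K\<close>: the \<open>K\<close>-th member is \<open>g ^ K\<close> times
  the coordinate, and is meaningful for polynomials on whose support \<open>n\<close> is at most
  \<open>K\<close>. Statements about coordinates are then required only for all large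
  \<open>K\<close>. This device serves twice: it shows that base change preserves local freeness,
  without which the Hilbert functor would not be a functor, and it replaces the map to the fraction
  field of B/P. It commutes with base change on the nose, so nothing has to be localized again over
  A. Writing all conditions as congruences modulo an ideal of B[x] also makes them visibly
  independent of the representative Q, as is needed because points are kernels.\<close>

lemma (in abelian_monoid) finsum_swap:
  assumes "finite S" "finite T" "\<And>a b. a \<in> S \<Longrightarrow> b \<in> T \<Longrightarrow> f a b \<in> carrier G"
  shows "(\<Oplus>a\<in>S. \<Oplus>b\<in>T. f a b) = (\<Oplus>b\<in>T. \<Oplus>a\<in>S. f a b)"
  using assms(1,3)
proof (induction S rule: finite_induct)
  case empty
  then show ?case by simp
next
  case (insert x S)
  have "(\<Oplus>a\<in>insert x S. \<Oplus>b\<in>T. f a b) = (\<Oplus>b\<in>T. f x b) \<oplus> (\<Oplus>a\<in>S. \<Oplus>b\<in>T. f a b)"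
    using insert by (subst finsum_insert) (auto intro!: finsum_closed)
  also have "\<dots> = (\<Oplus>b\<in>T. f x b) \<oplus> (\<Oplus>b\<in>T. \<Oplus>a\<in>S. f a b)"
    using insert by auto
  also have "\<dots> = (\<Oplus>b\<in>T. f x b \<oplus> (\<Oplus>a\<in>S. f a b))"
    using insert by (subst finsum_addf) (auto intro!: finsum_closed)
  also have "\<dots> = (\<Oplus>b\<in>T. \<Oplus>a\<in>insert x S. f a b)"
    using insert by (intro finsum_cong' refl) (auto intro!: finsum_closed)
  finally show ?case .
qed

lemma (in abelian_monoid) finsum_Times:
  assumes "finite S" "finite T" "\<And>a b. a \<in> S \<Longrightarrow> b \<in> T \<Longrightarrow> f (a, b) \<in> carrier G"
  shows "finsum G f (S \<times> T) = (\<Oplus>a\<in>S. \<Oplus>b\<in>T. f (a, b))"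
  using assms(1,3)
proof (induction S rule: finite_induct)
  case empty
  then show ?case by simp
next
  case (insert x S)
  have "finsum G f (insert x S \<times> T) = finsum G f (Pair x ` T \<union> S \<times> T)"
    by (rule arg_cong[where f = "finsum G f"]) auto
  also have "\<dots> = finsum G f (Pair x ` T) \<oplus> finsum G f (S \<times> T)"
    using insert assms(2) by (intro finsum_Un_disjoint) auto
  also have "finsum G f (Pair x ` T) = (\<Oplus>b\<in>T. f (x, b))"
    using insert by (intro finsum_reindex) (auto simp: inj_on_def)
  finally show ?case
    using insert by (subst finsum_insert) (auto intro!: finsum_closed)
qed

lemma (in abelian_monoid) finsum_superset:
  assumes "finite T" "S \<subseteq> T" "\<And>a. a \<in> S \<Longrightarrow> f a \<in> carrier G" "\<And>a. a \<in> T - S \<Longrightarrow> f a = \<zero>"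
  shows "finsum G f S = finsum G f T"
  using assms by (intro add.finprod_mono_neutral_cong_left) (auto simp: Pi_iff, metis Diff_iff zero_closed)

lemma (in abelian_monoid) finsum_delta:
  assumes "finite S" "x \<in> S" "f x \<in> carrier G"
  shows "(\<Oplus>y\<in>S. if x = y then f y else \<zero>) = f x"
proof -
  have "(\<Oplus>y\<in>S. if x = y then f y else \<zero>) = (\<Oplus>y\<in>{x}. if x = y then f y else \<zero>)"
    using assms by (intro finsum_superset[symmetric]) auto
  also have "\<dots> = f x"
    using assms by (subst finsum_insert) auto
  finally show ?thesis .
qed

text \<open>Stated for a bare additive map, because most of its uses are not ring homomorphisms:
  reading off one coefficient, putting numerators over a fixed denominator, pure tensors with one
  entry fixed.\<close>

lemma finsum_hom:
  assumes "abelian_monoid G" "abelian_monoid H"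
    and closed: "\<And>x. x \<in> carrier G \<Longrightarrow> h x \<in> carrier H"
    and zero: "h \<zero>\<^bsub>G\<^esub> = \<zero>\<^bsub>H\<^esub>"
    and add: "\<And>x y. x \<in> carrier G \<Longrightarrow> y \<in> carrier G \<Longrightarrow> h (x \<oplus>\<^bsub>G\<^esub> y) = h x \<oplus>\<^bsub>H\<^esub> h y"
    and f: "f \<in> S \<rightarrow> carrier G"
  shows "h (finsum G f S) = finsum H (\<lambda>a. h (f a)) S"
proof -
  interpret G: abelian_monoid G by fact
  interpret H: abelian_monoid H by fact
  show ?thesis
  proof (cases "finite S")
    case True
    then show ?thesis using f
    proof (induction S rule: finite_induct)
      case empty
      then show ?case by (simp add: zero)
    next
      case (insert x S)
      then have "f x \<in> carrier G" "f \<in> S \<rightarrow> carrier G" by auto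
      moreover have "(\<lambda>a. h (f a)) \<in> insert x S \<rightarrow> carrier H"
        using insert closed by blast
      ultimately show ?case
        using insert by (simp add: closed add Pi_iff)
    qed
  qed (simp add: zero G.finsum_infinite H.finsum_infinite)
qed


abbreviation lincomb ::
    "('r, 's, 'z) module_scheme \<Rightarrow> 'i set \<Rightarrow> ('i \<Rightarrow> 'r) \<Rightarrow> ('i \<Rightarrow> 's) \<Rightarrow> 's" where
  "lincomb M J c e \<equiv> finsum M (\<lambda>i. c i \<odot>\<^bsub>M\<^esub> e i) J"


section \<open>Monoid algebras\<close>

abbreviation supp :: "('r, 'x) ring_scheme \<Rightarrow> ('m \<Rightarrow> 'r) \<Rightarrow> 'm set" where
  "supp R p \<equiv> {m. p m \<noteq> \<zero>\<^bsub>R\<^esub>}"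

lemma monoid_algebra_simps:
  "p \<in> carrier (monoid_algebra R M) \<longleftrightarrow>
     (\<forall>m. p m \<in> carrier R) \<and> (\<forall>m. m \<notin> carrier M \<longrightarrow> p m = \<zero>\<^bsub>R\<^esub>) \<and> finite (supp R p)"
  "\<one>\<^bsub>monoid_algebra R M\<^esub> = monomial R \<one>\<^bsub>M\<^esub>"
  "\<zero>\<^bsub>monoid_algebra R M\<^esub> = (\<lambda>m. \<zero>\<^bsub>R\<^esub>)"
  "p \<oplus>\<^bsub>monoid_algebra R M\<^esub> q = (\<lambda>m. p m \<oplus>\<^bsub>R\<^esub> q m)"
  "r \<odot>\<^bsub>monoid_algebra R M\<^esub> p = (\<lambda>m. r \<otimes>\<^bsub>R\<^esub> p m)"
  by (auto simp: monoid_algebra_def monomial_def)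

lemma monoid_algebra_mult:
  "p \<otimes>\<^bsub>monoid_algebra R M\<^esub> q = (\<lambda>m. finsum R (\<lambda>(a, b). p a \<otimes>\<^bsub>R\<^esub> q b)
     {(a, b). a \<in> carrier M \<and> b \<in> carrier M \<and> p a \<noteq> \<zero>\<^bsub>R\<^esub> \<and> q b \<noteq> \<zero>\<^bsub>R\<^esub> \<and> a \<otimes>\<^bsub>M\<^esub> b = m})"
  by (simp add: monoid_algebra_def)

text \<open>It has two uses. With the identity as \<open>c\<close> it evaluates a polynomial against
  an arbitrary coefficient function \<open>h\<close>; with the integers as \<open>R\<close> it
  builds a ring homomorphism out of the ring whose quotient is the tensor product.\<close>

definition linear_extension ::
    "('r, 'x) ring_scheme \<Rightarrow> ('s, 'z) ring_scheme \<Rightarrow> ('r \<Rightarrow> 's) \<Rightarrow> ('m \<Rightarrow> 's) \<Rightarrow> ('m \<Rightarrow> 'r) \<Rightarrow> 's" where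
  "linear_extension R S c h p = finsum S (\<lambda>m. c (p m) \<otimes>\<^bsub>S\<^esub> h m) (supp R p)"

locale monoid_algebra_over = R?: cring R + M?: comm_monoid M for R (structure) and M (structure)
begin

abbreviation "RM \<equiv> monoid_algebra R M"

lemma in_carrierD:
  assumes "p \<in> carrier RM"
  shows "p m \<in> carrier R" "supp R p \<subseteq> carrier M" "finite (supp R p)"
  using assms by (auto simp: monoid_algebra_simps)

lemma monomial_closed [simp]: "m \<in> carrier M \<Longrightarrow> monomial R m \<in> carrier RM"
  by (auto simp: monoid_algebra_simps monomial_def)

text \<open>The product is defined by a sum over pairs with product \<open>m\<close>, an index set
  that varies with \<open>m\<close>. Here the index set is a fixed rectangle and the condition
  becomes an indicator, so that sums can be exchanged.\<close>

lemma mult_apply: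
  assumes p: "p \<in> carrier RM" and q: "q \<in> carrier RM"
    and S: "finite S" "S \<subseteq> carrier M" "supp R p \<subseteq> S"
    and T: "finite T" "T \<subseteq> carrier M" "supp R q \<subseteq> T"
  shows "(p \<otimes>\<^bsub>RM\<^esub> q) m = (\<Oplus>a\<in>S. \<Oplus>b\<in>T. if a \<otimes>\<^bsub>M\<^esub> b = m then p a \<otimes> q b else \<zero>)"
proof -
  note [simp] = in_carrierD(1)[OF p] in_carrierD(1)[OF q]
  let ?g = "\<lambda>(a, b). if a \<otimes>\<^bsub>M\<^esub> b = m then p a \<otimes> q b else \<zero>"
  let ?D = "{(a, b). a \<in> carrier M \<and> b \<in> carrier M \<and> p a \<noteq> \<zero> \<and> q b \<noteq> \<zero> \<and> a \<otimes>\<^bsub>M\<^esub> b = m}"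
  have "(p \<otimes>\<^bsub>RM\<^esub> q) m = finsum R ?g ?D"
    unfolding monoid_algebra_mult by (intro R.finsum_cong') auto
  also have "\<dots> = finsum R ?g (S \<times> T)"
    using S T by (intro R.finsum_superset) (auto split: if_splits)
  also have "\<dots> = (\<Oplus>a\<in>S. \<Oplus>b\<in>T. ?g (a, b))"
    using S T by (intro R.finsum_Times) auto
  finally show ?thesis by simp
qed

lemma mult_closed:
  assumes p: "p \<in> carrier RM" and q: "q \<in> carrier RM"
  shows "p \<otimes>\<^bsub>RM\<^esub> q \<in> carrier RM"
proof -
  note p' = in_carrierD[OF p] and q' = in_carrierD[OF q]
  note A = mult_apply[OF p q p'(3,2) order_refl q'(3,2) order_refl]
  have 1: "(p \<otimes>\<^bsub>RM\<^esub> q) m \<in> carrier R" for m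
    unfolding A using p'(1) q'(1) by (intro R.finsum_closed) (auto intro!: R.finsum_closed)
  have 2: "(p \<otimes>\<^bsub>RM\<^esub> q) m = \<zero>" if "m \<notin> (\<lambda>(a, b). a \<otimes>\<^bsub>M\<^esub> b) ` (supp R p \<times> supp R q)" for m
  proof -
    have "(p \<otimes>\<^bsub>RM\<^esub> q) m = (\<Oplus>a\<in>supp R p. \<Oplus>b\<in>supp R q. \<zero>)"
      unfolding A using that by (intro R.finsum_cong' refl) auto
    then show ?thesis by simp
  qed
  have "supp R (p \<otimes>\<^bsub>RM\<^esub> q) \<subseteq> (\<lambda>(a, b). a \<otimes>\<^bsub>M\<^esub> b) ` (supp R p \<times> supp R q)"
    using 2 by blast
  then have "finite (supp R (p \<otimes>\<^bsub>RM\<^esub> q))"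
    using p'(3) q'(3) by (meson finite_SigmaI finite_imageI finite_subset)
  moreover have "(p \<otimes>\<^bsub>RM\<^esub> q) m = \<zero>" if "m \<notin> carrier M" for m
    using that p'(2) q'(2) by (intro 2) auto
  ultimately show ?thesis
    using 1 by (auto simp: monoid_algebra_simps)
qed

lemma add_closed:
  assumes p: "p \<in> carrier RM" and q: "q \<in> carrier RM"
  shows "p \<oplus>\<^bsub>RM\<^esub> q \<in> carrier RM"
proof -
  have "supp R (p \<oplus>\<^bsub>RM\<^esub> q) \<subseteq> supp R p \<union> supp R q"
    using p by (auto simp: monoid_algebra_simps)
  then have "finite (supp R (p \<oplus>\<^bsub>RM\<^esub> q))"
    using in_carrierD(3)[OF p] in_carrierD(3)[OF q] by (meson finite_Un finite_subset)
  then show ?thesis using p q by (auto simp: monoid_algebra_simps)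
qed

lemma smult_closed:
  assumes "r \<in> carrier R" and p: "p \<in> carrier RM"
  shows "r \<odot>\<^bsub>RM\<^esub> p \<in> carrier RM"
proof -
  have "supp R (r \<odot>\<^bsub>RM\<^esub> p) \<subseteq> supp R p"
    using assms by (auto simp: monoid_algebra_simps)
  then have "finite (supp R (r \<odot>\<^bsub>RM\<^esub> p))"
    using in_carrierD(3)[OF p] by (meson finite_subset)
  then show ?thesis using assms by (auto simp: monoid_algebra_simps)
qed

lemma abelian_group: "abelian_group RM"
proof (rule abelian_groupI)
  fix p assume p: "p \<in> carrier RM"
  have "(\<lambda>m. \<ominus> p m) \<in> carrier RM"
  proof -
    have "supp R (\<lambda>m. \<ominus> p m) \<subseteq> supp R p"
      by auto
    then have "finite (supp R (\<lambda>m. \<ominus> p m))"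
      using in_carrierD(3)[OF p] by (meson finite_subset)
    then show ?thesis using p by (auto simp: monoid_algebra_simps)
  qed
  moreover have "(\<lambda>m. \<ominus> p m) \<oplus>\<^bsub>RM\<^esub> p = \<zero>\<^bsub>RM\<^esub>"
    using in_carrierD(1)[OF p] by (auto simp: monoid_algebra_simps R.l_neg)
  ultimately show "\<exists>q\<in>carrier RM. q \<oplus>\<^bsub>RM\<^esub> p = \<zero>\<^bsub>RM\<^esub>" by blast
qed (auto intro!: add_closed, auto simp: monoid_algebra_simps R.a_ac)

section \<open>Linear maps prescribed on the monomials\<close>

context
  fixes S :: "('s, 'z) ring_scheme" and c h
  assumes S: "cring S" and c: "c \<in> ring_hom R S" and h: "h \<in> carrier M \<rightarrow> carrier S"
begin

interpretation S: cring S by (rule S)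
interpretation c: ring_hom_cring R S c by unfold_locales (rule c)

lemma linear_extension_superset:
  assumes p: "p \<in> carrier RM" and F: "finite F" "F \<subseteq> carrier M" "supp R p \<subseteq> F"
  shows "linear_extension R S c h p = finsum S (\<lambda>m. c (p m) \<otimes>\<^bsub>S\<^esub> h m) F"
proof -
  have "h m \<in> carrier S" if "m \<in> F" for m using that F h by blast
  then show ?thesis
    unfolding linear_extension_def using F in_carrierD(1)[OF p]
    by (intro S.finsum_superset) auto
qed

lemma linear_extension_closed [simp]:
  assumes p: "p \<in> carrier RM"
  shows "linear_extension R S c h p \<in> carrier S"
proof -
  have "h m \<in> carrier S" if "m \<in> supp R p" for m using that in_carrierD[OF p] h by blast
  then show ?thesis
    unfolding linear_extension_def using in_carrierD[OF p]
    by (intro S.finsum_closed) auto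
qed

lemma linear_extension_add:
  assumes p: "p \<in> carrier RM" and q: "q \<in> carrier RM"
  shows "linear_extension R S c h (p \<oplus>\<^bsub>RM\<^esub> q) =
    linear_extension R S c h p \<oplus>\<^bsub>S\<^esub> linear_extension R S c h q"
proof -
  let ?F = "supp R p \<union> supp R q"
  note p' = in_carrierD[OF p] and q' = in_carrierD[OF q]
  have F: "finite ?F" "?F \<subseteq> carrier M" using p' q' by auto
  have s: "supp R (p \<oplus>\<^bsub>RM\<^esub> q) \<subseteq> ?F"
    using p by (auto simp: monoid_algebra_simps)
  have h': "h m \<in> carrier S" if "m \<in> ?F" for m using that F h by blast
  have "linear_extension R S c h (p \<oplus>\<^bsub>RM\<^esub> q) =
      finsum S (\<lambda>m. c (p m) \<otimes>\<^bsub>S\<^esub> h m \<oplus>\<^bsub>S\<^esub> c (q m) \<otimes>\<^bsub>S\<^esub> h m) ?F"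
    unfolding linear_extension_superset[OF add_closed[OF p q] F s]
    using h' p' q' by (intro S.finsum_cong' refl) (auto simp: monoid_algebra_simps S.l_distr)
  also have "\<dots> = finsum S (\<lambda>m. c (p m) \<otimes>\<^bsub>S\<^esub> h m) ?F \<oplus>\<^bsub>S\<^esub> finsum S (\<lambda>m. c (q m) \<otimes>\<^bsub>S\<^esub> h m) ?F"
    using h' p' q' by (intro S.finsum_addf) auto
  finally show ?thesis
    using linear_extension_superset[OF p F] linear_extension_superset[OF q F] by simp
qed

lemma linear_extension_smult:
  assumes p: "p \<in> carrier RM" and r: "r \<in> carrier R"
  shows "linear_extension R S c h (r \<odot>\<^bsub>RM\<^esub> p) = c r \<otimes>\<^bsub>S\<^esub> linear_extension R S c h p"
proof -
  note p' = in_carrierD[OF p]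
  have s: "supp R (r \<odot>\<^bsub>RM\<^esub> p) \<subseteq> supp R p"
    using r by (auto simp: monoid_algebra_simps)
  have h': "h m \<in> carrier S" if "m \<in> supp R p" for m using that p' h by blast
  show ?thesis
    unfolding linear_extension_superset[OF smult_closed[OF r p] p'(3,2) s]
    unfolding linear_extension_def using h' p' r
    by (subst S.finsum_rdistr)
      (auto intro!: S.finsum_cong' simp: monoid_algebra_simps(5) S.m_assoc)
qed

lemma linear_extension_monomial:
  assumes m: "m \<in> carrier M"
  shows "linear_extension R S c h (monomial R m) = h m"
proof -
  have "linear_extension R S c h (monomial R m) =
      finsum S (\<lambda>m'. c (monomial R m m') \<otimes>\<^bsub>S\<^esub> h m') {m}"
    using m by (intro linear_extension_superset monomial_closed) (auto simp: monomial_def)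
  also have "\<dots> = h m"
    using funcset_mem[OF h m] by (subst S.finsum_insert) (auto simp: monomial_def)
  finally show ?thesis .
qed

end

text \<open>An exchange of summations, valid for any function \<open>h\<close> on the monoid:
  grouping pairs by their product and then evaluating \<open>h\<close> is the same as summing
  \<open>h\<close> over all pairs. The ring laws are deduced from it by computing both sides against
  every \<open>h\<close>.\<close>

lemma linear_extension_mult:
  fixes S :: "('s, 'z) ring_scheme"
  assumes S: "cring S" and c: "c \<in> ring_hom R S" and h: "h \<in> carrier M \<rightarrow> carrier S"
    and p: "p \<in> carrier RM" and q: "q \<in> carrier RM"
  shows "linear_extension R S c h (p \<otimes>\<^bsub>RM\<^esub> q) =
    linear_extension R S c (\<lambda>a. linear_extension R S c (\<lambda>b. h (a \<otimes>\<^bsub>M\<^esub> b)) q) p"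
proof -
  interpret S: cring S by (rule S)
  interpret c: ring_hom_cring R S c by unfold_locales (rule c)
  note p' = in_carrierD[OF p] and q' = in_carrierD[OF q]
  let ?A = "supp R p" and ?B = "supp R q"
  let ?X = "(\<lambda>(a, b). a \<otimes>\<^bsub>M\<^esub> b) ` (?A \<times> ?B)"
  have X: "finite ?X" "?X \<subseteq> carrier M" using p'(2,3) q'(2,3) by (auto intro: M.m_closed)
  note pq = mult_apply[OF p q p'(3,2) order_refl q'(3,2) order_refl]
  have sX: "supp R (p \<otimes>\<^bsub>RM\<^esub> q) \<subseteq> ?X"
  proof -
    have "(p \<otimes>\<^bsub>RM\<^esub> q) m = \<zero>" if "m \<notin> ?X" for m
    proof -
      have "(p \<otimes>\<^bsub>RM\<^esub> q) m = (\<Oplus>a\<in>?A. \<Oplus>b\<in>?B. \<zero>)"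
        unfolding pq using that by (intro R.finsum_cong' refl) auto
      then show ?thesis by simp
    qed
    then show ?thesis by blast
  qed
  have hX: "h x \<in> carrier S" if "x \<in> ?X" for x using that X h by blast
  \<comment> \<open>The product index \<open>x\<close> becomes a free variable guarded by an
    indicator; moved innermost, the sum over \<open>x\<close> has one surviving term, at the product
    of \<open>a\<close> and \<open>b\<close>.\<close>
  define t where "t a b x = (if a \<otimes>\<^bsub>M\<^esub> b = x then c (p a) \<otimes>\<^bsub>S\<^esub> c (q b) \<otimes>\<^bsub>S\<^esub> h x else \<zero>\<^bsub>S\<^esub>)" for a b x
  have t: "t a b x \<in> carrier S" if "x \<in> ?X" for a b x
    unfolding t_def using hX[OF that] p'(1) q'(1) by auto
  have "linear_extension R S c h (p \<otimes>\<^bsub>RM\<^esub> q) = finsum S (\<lambda>x. c ((p \<otimes>\<^bsub>RM\<^esub> q) x) \<otimes>\<^bsub>S\<^esub> h x) ?X"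
    by (rule linear_extension_superset[OF S c h mult_closed[OF p q] X sX])
  also have "\<dots> = finsum S (\<lambda>x. finsum S (\<lambda>a. finsum S (\<lambda>b. t a b x) ?B) ?A) ?X"
  proof (rule S.finsum_cong'[OF refl])
    show "(\<lambda>x. finsum S (\<lambda>a. finsum S (\<lambda>b. t a b x) ?B) ?A) \<in> ?X \<rightarrow> carrier S"
      using t by (auto intro!: S.finsum_closed)
    fix x assume x: "x \<in> ?X"
    have "c ((p \<otimes>\<^bsub>RM\<^esub> q) x) =
        finsum S (\<lambda>a. finsum S (\<lambda>b. if a \<otimes>\<^bsub>M\<^esub> b = x then c (p a) \<otimes>\<^bsub>S\<^esub> c (q b) else \<zero>\<^bsub>S\<^esub>) ?B) ?A"
      unfolding pq using p'(1) q'(1)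
      by (subst c.hom_finsum) (auto intro!: R.finsum_closed S.finsum_cong' S.finsum_closed
          simp: c.hom_finsum[unfolded comp_def] comp_def if_distrib[of c] cong: if_cong)
    also have "\<dots> \<otimes>\<^bsub>S\<^esub> h x = finsum S (\<lambda>a. finsum S (\<lambda>b. (if a \<otimes>\<^bsub>M\<^esub> b = x then c (p a) \<otimes>\<^bsub>S\<^esub> c (q b) else \<zero>\<^bsub>S\<^esub>) \<otimes>\<^bsub>S\<^esub> h x) ?B) ?A"
      using p' q' hX[OF x]
      by (subst S.finsum_ldistr) (auto intro!: S.finsum_cong' S.finsum_closed S.m_closed S.finsum_ldistr)
    also have "\<dots> = finsum S (\<lambda>a. finsum S (\<lambda>b. t a b x) ?B) ?A"
      using t[OF x] hX[OF x] p'(1) q'(1)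
      by (intro S.finsum_cong' refl) (auto intro!: S.finsum_closed simp: t_def)
    finally show "c ((p \<otimes>\<^bsub>RM\<^esub> q) x) \<otimes>\<^bsub>S\<^esub> h x = finsum S (\<lambda>a. finsum S (\<lambda>b. t a b x) ?B) ?A" .
  qed
  also have "\<dots> = finsum S (\<lambda>a. finsum S (\<lambda>x. finsum S (\<lambda>b. t a b x) ?B) ?X) ?A"
    using X p' t by (intro S.finsum_swap) (auto intro!: S.finsum_closed)
  also have "\<dots> = finsum S (\<lambda>a. finsum S (\<lambda>b. finsum S (\<lambda>x. t a b x) ?X) ?B) ?A"
    using X p' q' t by (intro S.finsum_cong' refl S.finsum_swap) (auto intro!: S.finsum_closed)
  also have "\<dots> = finsum S (\<lambda>a. finsum S (\<lambda>b. c (p a) \<otimes>\<^bsub>S\<^esub> (c (q b) \<otimes>\<^bsub>S\<^esub> h (a \<otimes>\<^bsub>M\<^esub> b))) ?B) ?A"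
  proof -
    have "finsum S (\<lambda>x. t a b x) ?X = c (p a) \<otimes>\<^bsub>S\<^esub> (c (q b) \<otimes>\<^bsub>S\<^esub> h (a \<otimes>\<^bsub>M\<^esub> b))" if "a \<in> ?A" "b \<in> ?B" for a b
    proof -
      have ab: "a \<otimes>\<^bsub>M\<^esub> b \<in> ?X" using that by auto
      show ?thesis
        unfolding t_def using X(1) ab hX[OF ab] p'(1) q'(1)
        by (subst S.finsum_delta[where f = "\<lambda>x. c (p a) \<otimes>\<^bsub>S\<^esub> c (q b) \<otimes>\<^bsub>S\<^esub> h x"]) (auto simp: S.m_assoc)
    qed
    moreover have "h (a \<otimes>\<^bsub>M\<^esub> b) \<in> carrier S" if "a \<in> ?A" "b \<in> ?B" for a b
      using that by (intro hX) auto
    ultimately show ?thesis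
      using p'(1) q'(1) by (intro S.finsum_cong' refl) (auto intro!: S.finsum_closed)
  qed
  also have "\<dots> = finsum S (\<lambda>a. c (p a) \<otimes>\<^bsub>S\<^esub> finsum S (\<lambda>b. c (q b) \<otimes>\<^bsub>S\<^esub> h (a \<otimes>\<^bsub>M\<^esub> b)) ?B) ?A"
  proof -
    have "h (a \<otimes>\<^bsub>M\<^esub> b) \<in> carrier S" if "a \<in> ?A" "b \<in> ?B" for a b
      using that by (intro hX) auto
    then show ?thesis using p'(1) q'
      by (intro S.finsum_cong' refl S.finsum_rdistr[symmetric]) (auto intro!: S.finsum_closed)
  qed
  finally show ?thesis unfolding linear_extension_def .
qed

text \<open>Needed so that evaluations against all \<open>h\<close> separate elements: the indicator
  of \<open>m\<close> recovers the coefficient at \<open>m\<close>.\<close>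

lemma apply_eq_linear_extension:
  assumes p: "p \<in> carrier RM"
  shows "p m = linear_extension R R (\<lambda>r. r) (\<lambda>x. if x = m then \<one> else \<zero>) p"
proof (cases "m \<in> supp R p")
  case True
  have "linear_extension R R (\<lambda>r. r) (\<lambda>x. if x = m then \<one> else \<zero>) p = (\<Oplus>x\<in>supp R p. if m = x then p x else \<zero>)"
    unfolding linear_extension_def using in_carrierD(1)[OF p] by (intro R.finsum_cong') auto
  then show ?thesis using True in_carrierD[OF p] R.finsum_delta[of "supp R p" m p] by auto
next
  case False
  then have "linear_extension R R (\<lambda>r. r) (\<lambda>x. if x = m then \<one> else \<zero>) p = (\<Oplus>x\<in>supp R p. \<zero>)"
    unfolding linear_extension_def using in_carrierD(1)[OF p] by (intro R.finsum_cong') auto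
  then show ?thesis using False by simp
qed

lemma linear_extension_cong:
  assumes "cring S" and c: "c \<in> ring_hom R S" and h: "h \<in> carrier M \<rightarrow> carrier S"
    and p: "p \<in> carrier RM" and "\<And>m. m \<in> carrier M \<Longrightarrow> h' m = h m"
  shows "linear_extension R S c h' p = linear_extension R S c h p"
proof -
  interpret S: cring S by fact
  have "h m \<in> carrier S" if "m \<in> supp R p" for m using that in_carrierD[OF p] h by blast
  moreover have "h' m = h m" if "m \<in> supp R p" for m using that in_carrierD[OF p] assms(5) by blast
  ultimately show ?thesis
    unfolding linear_extension_def using in_carrierD(1)[OF p] ring_hom_closed[OF c]
    by (intro S.finsum_cong' refl) auto
qed

section \<open>The ring laws, tested against all coefficient functions\<close>

definition pairing :: "('c \<Rightarrow> 'a) \<Rightarrow> ('c \<Rightarrow> 'a) \<Rightarrow> 'a" where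
  "pairing = linear_extension R R (\<lambda>r. r)"

lemmas id_hom = id_ring_hom[of R, unfolded id_def]
lemmas pairing_closed = linear_extension_closed[OF R.cring_axioms id_hom, folded pairing_def]
lemmas pairing_add = linear_extension_add[OF R.cring_axioms id_hom, folded pairing_def]
lemmas pairing_smult = linear_extension_smult[OF R.cring_axioms id_hom, folded pairing_def]
lemmas pairing_mult = linear_extension_mult[OF R.cring_axioms id_hom, folded pairing_def]
lemmas pairing_monomial = linear_extension_monomial[OF R.cring_axioms id_hom, folded pairing_def]
lemmas pairing_superset = linear_extension_superset[OF R.cring_axioms id_hom, folded pairing_def]
lemmas pairing_cong = linear_extension_cong[OF R.cring_axioms id_hom, folded pairing_def]

lemma pairing_eqI:
  assumes p: "p \<in> carrier RM" and q: "q \<in> carrier RM"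
    and eq: "\<And>h. h \<in> carrier M \<rightarrow> carrier R \<Longrightarrow> pairing h p = pairing h q"
  shows "p = q"
proof
  fix m
  have "(\<lambda>x. if x = m then \<one> else \<zero>) \<in> carrier M \<rightarrow> carrier R" by auto
  from eq[OF this] show "p m = q m"
    unfolding pairing_def by (simp only: apply_eq_linear_extension[OF p, symmetric] apply_eq_linear_extension[OF q, symmetric])
qed

text \<open>Commutativity is an exchange of the two sums in a coefficient. The other laws of the
  product are checked after pairing with an arbitrary \<open>h\<close>: products become nested
  pairings, so that only the monoid laws inside \<open>h\<close> and additivity are left.\<close>

lemma cring_RM: "cring RM"
proof (rule cringI)
  show "abelian_group RM" by (rule abelian_group)
  show "comm_monoid RM"
  proof (rule comm_monoidI)
    fix p q assume p: "p \<in> carrier RM" and q: "q \<in> carrier RM"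
    show "p \<otimes>\<^bsub>RM\<^esub> q \<in> carrier RM" by (rule mult_closed[OF p q])
    show "p \<otimes>\<^bsub>RM\<^esub> q = q \<otimes>\<^bsub>RM\<^esub> p"
    proof
      fix m
      note p' = in_carrierD[OF p] and q' = in_carrierD[OF q]
      have "(p \<otimes>\<^bsub>RM\<^esub> q) m = (\<Oplus>b\<in>supp R q. \<Oplus>a\<in>supp R p. if a \<otimes>\<^bsub>M\<^esub> b = m then p a \<otimes> q b else \<zero>)"
        unfolding mult_apply[OF p q p'(3,2) order_refl q'(3,2) order_refl]
        using p' q' by (intro R.finsum_swap) auto
      also have "\<dots> = (q \<otimes>\<^bsub>RM\<^esub> p) m"
        unfolding mult_apply[OF q p q'(3,2) order_refl p'(3,2) order_refl]
        using p' q' by (intro R.finsum_cong' refl) (auto intro!: R.finsum_closed simp: R.m_comm M.m_comm subset_iff)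
      finally show "(p \<otimes>\<^bsub>RM\<^esub> q) m = (q \<otimes>\<^bsub>RM\<^esub> p) m" .
    qed
    fix r assume r: "r \<in> carrier RM"
    show "(p \<otimes>\<^bsub>RM\<^esub> q) \<otimes>\<^bsub>RM\<^esub> r = p \<otimes>\<^bsub>RM\<^esub> (q \<otimes>\<^bsub>RM\<^esub> r)"
    proof (rule pairing_eqI)
      fix h assume h: "h \<in> carrier M \<rightarrow> carrier R"
      then have h': "(\<lambda>b. h (a \<otimes>\<^bsub>M\<^esub> b)) \<in> carrier M \<rightarrow> carrier R" if "a \<in> carrier M" for a
        using that by auto
      have "pairing h (p \<otimes>\<^bsub>RM\<^esub> q \<otimes>\<^bsub>RM\<^esub> r) =
          pairing (\<lambda>a. pairing (\<lambda>b. pairing (\<lambda>x. h (a \<otimes>\<^bsub>M\<^esub> b \<otimes>\<^bsub>M\<^esub> x)) r) q) p"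
        using h h' by (simp add: pairing_mult p q r mult_closed pairing_closed Pi_iff)
      also have "\<dots> = pairing (\<lambda>a. pairing (\<lambda>x. h (a \<otimes>\<^bsub>M\<^esub> x)) (q \<otimes>\<^bsub>RM\<^esub> r)) p"
        using h h' by (intro pairing_cong p)
          (auto intro!: pairing_closed pairing_cong simp: pairing_mult p q r mult_closed M.m_assoc)
      also have "\<dots> = pairing h (p \<otimes>\<^bsub>RM\<^esub> (q \<otimes>\<^bsub>RM\<^esub> r))"
        using h by (simp add: pairing_mult p q r mult_closed)
      finally show "pairing h (p \<otimes>\<^bsub>RM\<^esub> q \<otimes>\<^bsub>RM\<^esub> r) = pairing h (p \<otimes>\<^bsub>RM\<^esub> (q \<otimes>\<^bsub>RM\<^esub> r))" .
    qed (intro mult_closed p q r)+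
  next
    show "\<one>\<^bsub>RM\<^esub> \<in> carrier RM" by (simp add: monoid_algebra_simps(2))
    fix p assume p: "p \<in> carrier RM"
    show "\<one>\<^bsub>RM\<^esub> \<otimes>\<^bsub>RM\<^esub> p = p"
      unfolding monoid_algebra_simps(2)
    proof (rule pairing_eqI)
      fix h assume h: "h \<in> carrier M \<rightarrow> carrier R"
      then have h': "(\<lambda>a. pairing (\<lambda>b. h (a \<otimes>\<^bsub>M\<^esub> b)) p) \<in> carrier M \<rightarrow> carrier R"
        using p by (auto intro!: pairing_closed)
      have "pairing h (monomial R \<one>\<^bsub>M\<^esub> \<otimes>\<^bsub>RM\<^esub> p) = pairing (\<lambda>b. h (\<one>\<^bsub>M\<^esub> \<otimes>\<^bsub>M\<^esub> b)) p"
        using h h' p by (subst pairing_mult) (simp_all add: pairing_monomial)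
      also have "\<dots> = pairing h p"
        using h by (intro pairing_cong p) auto
      finally show "pairing h (monomial R \<one>\<^bsub>M\<^esub> \<otimes>\<^bsub>RM\<^esub> p) = pairing h p" .
    qed (intro mult_closed p monomial_closed M.one_closed)+
  qed
  fix p q r assume p: "p \<in> carrier RM" and q: "q \<in> carrier RM" and r: "r \<in> carrier RM"
  show "(p \<oplus>\<^bsub>RM\<^esub> q) \<otimes>\<^bsub>RM\<^esub> r = p \<otimes>\<^bsub>RM\<^esub> r \<oplus>\<^bsub>RM\<^esub> q \<otimes>\<^bsub>RM\<^esub> r"
  proof (rule pairing_eqI)
    fix h assume h: "h \<in> carrier M \<rightarrow> carrier R"
    then have h': "(\<lambda>a. pairing (\<lambda>b. h (a \<otimes>\<^bsub>M\<^esub> b)) r) \<in> carrier M \<rightarrow> carrier R"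
      using r by (auto intro!: pairing_closed)
    show "pairing h ((p \<oplus>\<^bsub>RM\<^esub> q) \<otimes>\<^bsub>RM\<^esub> r) = pairing h (p \<otimes>\<^bsub>RM\<^esub> r \<oplus>\<^bsub>RM\<^esub> q \<otimes>\<^bsub>RM\<^esub> r)"
      using h h' p q r by (simp only: pairing_mult pairing_add mult_closed add_closed)
  qed (intro mult_closed add_closed p q r)+
qed

lemma algebra_RM: "algebra R RM"
proof (rule algebraI)
  show "cring R" ..
  show "cring RM" by (rule cring_RM)
  fix a p q assume a: "a \<in> carrier R" and p: "p \<in> carrier RM" and q: "q \<in> carrier RM"
  show "a \<odot>\<^bsub>RM\<^esub> p \<otimes>\<^bsub>RM\<^esub> q = a \<odot>\<^bsub>RM\<^esub> (p \<otimes>\<^bsub>RM\<^esub> q)"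
  proof (rule pairing_eqI)
    fix h assume h: "h \<in> carrier M \<rightarrow> carrier R"
    then have h': "(\<lambda>a. pairing (\<lambda>b. h (a \<otimes>\<^bsub>M\<^esub> b)) q) \<in> carrier M \<rightarrow> carrier R"
      using q by (auto intro!: pairing_closed)
    show "pairing h (a \<odot>\<^bsub>RM\<^esub> p \<otimes>\<^bsub>RM\<^esub> q) = pairing h (a \<odot>\<^bsub>RM\<^esub> (p \<otimes>\<^bsub>RM\<^esub> q))"
      using h h' a p q by (simp only: pairing_mult pairing_smult mult_closed smult_closed)
  qed (intro mult_closed smult_closed a p q)+
qed (erule (1) smult_closed, auto simp: monoid_algebra_simps R.l_distr R.r_distr R.m_assoc)

sublocale RM: algebra R RM by (rule algebra_RM)

lemma finsum_apply:
  assumes "f \<in> S \<rightarrow> carrier RM"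
  shows "finsum RM f S m = (\<Oplus>s\<in>S. f s m)"
  by (rule finsum_hom[where h = "\<lambda>p. p m"])
    (use assms in \<open>auto simp: monoid_algebra_simps intro: R.abelian_monoid_axioms RM.M.abelian_monoid_axioms\<close>)

lemma sum_of_monomials:
  assumes p: "p \<in> carrier RM" and F: "finite F" "F \<subseteq> carrier M" "supp R p \<subseteq> F"
  shows "p = (\<Oplus>\<^bsub>RM\<^esub>m\<in>F. p m \<odot>\<^bsub>RM\<^esub> monomial R m)"
proof
  fix x
  note p' = in_carrierD[OF p]
  have "(\<Oplus>\<^bsub>RM\<^esub>m\<in>F. p m \<odot>\<^bsub>RM\<^esub> monomial R m) x = (\<Oplus>m\<in>F. (p m \<odot>\<^bsub>RM\<^esub> monomial R m) x)"
    using p' F by (intro finsum_apply) (auto intro!: smult_closed)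
  also have "\<dots> = (\<Oplus>m\<in>F. if x = m then p m else \<zero>)"
    using p'(1) by (intro R.finsum_cong') (auto simp: monoid_algebra_simps monomial_def)
  also have "\<dots> = p x"
  proof (cases "x \<in> F")
    case True
    then show ?thesis using F p'(1) by (intro R.finsum_delta)
  next
    case False
    then have "(\<Oplus>m\<in>F. if x = m then p m else \<zero>) = (\<Oplus>m\<in>F. \<zero>)"
      by (intro R.finsum_cong') auto
    moreover have "p x = \<zero>" using False F by auto
    ultimately show ?thesis by simp
  qed
  finally show "p x = (\<Oplus>\<^bsub>RM\<^esub>m\<in>F. p m \<odot>\<^bsub>RM\<^esub> monomial R m) x" ..
qed

text \<open>For multiplicative \<open>h\<close> the inner sum in
  \<open>linear_extension_mult\<close> is \<open>h a\<close> times the value at \<open>q\<close>;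
  the latter is constant in \<open>a\<close> and leaves the outer sum.\<close>

lemma linear_extension_ring_hom:
  assumes S: "cring S" and c: "c \<in> ring_hom R S" and h: "h \<in> carrier M \<rightarrow> carrier S"
    and one: "h \<one>\<^bsub>M\<^esub> = \<one>\<^bsub>S\<^esub>"
    and mult: "\<And>a b. a \<in> carrier M \<Longrightarrow> b \<in> carrier M \<Longrightarrow> h (a \<otimes>\<^bsub>M\<^esub> b) = h a \<otimes>\<^bsub>S\<^esub> h b"
  shows "linear_extension R S c h \<in> ring_hom RM S"
proof (rule ring_hom_memI)
  interpret S: cring S by (rule S)
  note cl = linear_extension_closed[OF S c]
  fix p q assume p: "p \<in> carrier RM" and q: "q \<in> carrier RM"
  show "linear_extension R S c h p \<in> carrier S" by (rule cl[OF h p])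
  show "linear_extension R S c h (p \<oplus>\<^bsub>RM\<^esub> q) = linear_extension R S c h p \<oplus>\<^bsub>S\<^esub> linear_extension R S c h q"
    by (rule linear_extension_add[OF S c h p q])
  have cc: "c r \<in> carrier S" if "r \<in> carrier R" for r using ring_hom_closed[OF c that] .
  have ext: "linear_extension R S c (\<lambda>b. s \<otimes>\<^bsub>S\<^esub> h b) q = s \<otimes>\<^bsub>S\<^esub> linear_extension R S c h q"
    if s: "s \<in> carrier S" and q: "q \<in> carrier RM" for s q
  proof -
    have h': "h m \<in> carrier S" if "m \<in> supp R q" for m using that in_carrierD[OF q] h by blast
    show ?thesis
      unfolding linear_extension_def using in_carrierD[OF q] s h' cc
      by (subst S.finsum_rdistr) (auto intro!: S.finsum_cong' simp: S.m_ac)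
  qed
  let ?q = "linear_extension R S c h q"
  have q': "?q \<in> carrier S" by (rule cl[OF h q])
  have "linear_extension R S c h (p \<otimes>\<^bsub>RM\<^esub> q) =
      linear_extension R S c (\<lambda>a. linear_extension R S c (\<lambda>b. h (a \<otimes>\<^bsub>M\<^esub> b)) q) p"
    by (rule linear_extension_mult[OF S c h p q])
  also have "\<dots> = linear_extension R S c (\<lambda>a. ?q \<otimes>\<^bsub>S\<^esub> h a) p"
  proof (rule linear_extension_cong[OF S c _ p])
    show "(\<lambda>a. ?q \<otimes>\<^bsub>S\<^esub> h a) \<in> carrier M \<rightarrow> carrier S" using h q' by auto
    fix a assume a: "a \<in> carrier M"
    have "linear_extension R S c (\<lambda>b. h (a \<otimes>\<^bsub>M\<^esub> b)) q = linear_extension R S c (\<lambda>b. h a \<otimes>\<^bsub>S\<^esub> h b) q"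
      using h a by (intro linear_extension_cong[OF S c _ q]) (auto simp: mult)
    also have "\<dots> = h a \<otimes>\<^bsub>S\<^esub> ?q" using a h by (intro ext q) auto
    also have "\<dots> = ?q \<otimes>\<^bsub>S\<^esub> h a" using a h q' by (intro S.m_comm) auto
    finally show "linear_extension R S c (\<lambda>b. h (a \<otimes>\<^bsub>M\<^esub> b)) q = ?q \<otimes>\<^bsub>S\<^esub> h a" .
  qed
  also have "\<dots> = ?q \<otimes>\<^bsub>S\<^esub> linear_extension R S c h p" by (rule ext[OF q' p])
  also have "\<dots> = linear_extension R S c h p \<otimes>\<^bsub>S\<^esub> ?q" by (intro S.m_comm q' cl[OF h p])
  finally show "linear_extension R S c h (p \<otimes>\<^bsub>RM\<^esub> q) = linear_extension R S c h p \<otimes>\<^bsub>S\<^esub> ?q" .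
next
  show "linear_extension R S c h \<one>\<^bsub>RM\<^esub> = \<one>\<^bsub>S\<^esub>"
    unfolding monoid_algebra_simps(2) one[symmetric] by (intro linear_extension_monomial S c h M.one_closed)
qed

end

lemma comm_monoid_exponents: "comm_monoid (exponents n)"
  by (rule comm_monoidI) (auto simp: exponents_def)

section \<open>Localization at one element\<close>

lemma bchoice2: "\<forall>i\<in>A. \<exists>x y. P i x y \<Longrightarrow> \<exists>f g. \<forall>i\<in>A. P i (f i) (g i)"
  by metis

lemma (in cring) algebra_self: "algebra R (self_algebra R)"
proof (rule algebraI)
  show "cring R" ..
  show "cring (self_algebra R)"
  proof (rule cringI)
    show "abelian_group (self_algebra R)"
      by (rule abelian_groupI) (auto simp: self_algebra_def a_ac intro: l_neg a_inv_closed)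
    show "comm_monoid (self_algebra R)"
      by (rule comm_monoidI) (auto simp: self_algebra_def m_ac)
  qed (auto simp: self_algebra_def l_distr)
qed (auto simp: self_algebra_def l_distr r_distr m_assoc)

lemma self_algebra_simps [simp]:
  "carrier (self_algebra R) = carrier R" "x \<odot>\<^bsub>self_algebra R\<^esub> y = x \<otimes>\<^bsub>R\<^esub> y"
  "\<zero>\<^bsub>self_algebra R\<^esub> = \<zero>\<^bsub>R\<^esub>" "x \<oplus>\<^bsub>self_algebra R\<^esub> y = x \<oplus>\<^bsub>R\<^esub> y"
  by (simp_all add: self_algebra_def)

text \<open>Together with \<open>independent\<close> this describes a basis of the localization of
  \<open>M\<close> at \<open>g\<close> with cleared denominators: the exponent may depend on
  \<open>q\<close>, and a coefficient counts as zero when a power of \<open>g\<close> kills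
  it.\<close>

abbreviation generates ::
    "('r, 'x) ring_scheme \<Rightarrow> ('r, 's, 'z) module_scheme \<Rightarrow> 'r \<Rightarrow> nat \<Rightarrow> (nat \<Rightarrow> 's) \<Rightarrow> bool" where
  "generates R M g d e \<equiv> \<forall>q\<in>carrier M. \<exists>N::nat. \<exists>c\<in>{..<d} \<rightarrow> carrier R.
     (g [^]\<^bsub>R\<^esub> N) \<odot>\<^bsub>M\<^esub> q = lincomb M {..<d} c e"

abbreviation independent ::
    "('r, 'x) ring_scheme \<Rightarrow> ('r, 's, 'z) module_scheme \<Rightarrow> 'r \<Rightarrow> nat \<Rightarrow> (nat \<Rightarrow> 's) \<Rightarrow> bool" where
  "independent R M g d e \<equiv> \<forall>c\<in>{..<d} \<rightarrow> carrier R. lincomb M {..<d} c e = \<zero>\<^bsub>M\<^esub> \<longrightarrow>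
     (\<forall>i<d. \<exists>N::nat. (g [^]\<^bsub>R\<^esub> N) \<otimes>\<^bsub>R\<^esub> c i = \<zero>\<^bsub>R\<^esub>)"

locale localized_module = Module.module R M for R (structure) and M :: "('a, 'q, 'z) module_scheme" (structure) +
  fixes g
  assumes g [simp, intro]: "g \<in> carrier R"
begin

abbreviation "fr \<equiv> fraction R g M"
abbreviation "Loc \<equiv> localization R g M"
abbreviation "LocR \<equiv> localization R g (self_algebra R)"

lemma pow_pow_smult [simp]:
  assumes "x \<in> carrier M"
  shows "(g [^]\<^bsub>R\<^esub> (a::nat)) \<odot>\<^bsub>M\<^esub> ((g [^]\<^bsub>R\<^esub> (b::nat)) \<odot>\<^bsub>M\<^esub> x) = (g [^]\<^bsub>R\<^esub> (a + b)) \<odot>\<^bsub>M\<^esub> x"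
  using assms by (simp add: smult_assoc1[symmetric] R.nat_pow_mult)

lemma smult_commute:
  assumes "a \<in> carrier R" "b \<in> carrier R" "x \<in> carrier M"
  shows "a \<odot>\<^bsub>M\<^esub> (b \<odot>\<^bsub>M\<^esub> x) = b \<odot>\<^bsub>M\<^esub> (a \<odot>\<^bsub>M\<^esub> x)"
  using assms by (simp add: smult_assoc1[symmetric] R.m_comm)

definition frac_rel :: "'q \<Rightarrow> nat \<Rightarrow> 'q \<Rightarrow> nat \<Rightarrow> bool" where
  "frac_rel m i m' j \<longleftrightarrow> (\<exists>l. (g [^]\<^bsub>R\<^esub> (l + j)) \<odot>\<^bsub>M\<^esub> m = (g [^]\<^bsub>R\<^esub> (l + i)) \<odot>\<^bsub>M\<^esub> m')"

lemma frac_rel_sym: "frac_rel m i m' j \<Longrightarrow> frac_rel m' j m i"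
  unfolding frac_rel_def by metis

lemma frac_rel_trans:
  assumes "frac_rel m i m' j" "frac_rel m' j m'' k" and [simp]: "m \<in> carrier M" "m' \<in> carrier M" "m'' \<in> carrier M"
  shows "frac_rel m i m'' k"
proof -
  obtain l where l: "(g [^]\<^bsub>R\<^esub> (l + j)) \<odot>\<^bsub>M\<^esub> m = (g [^]\<^bsub>R\<^esub> (l + i)) \<odot>\<^bsub>M\<^esub> m'"
    using assms(1) unfolding frac_rel_def by blast
  obtain l' where l': "(g [^]\<^bsub>R\<^esub> (l' + k)) \<odot>\<^bsub>M\<^esub> m' = (g [^]\<^bsub>R\<^esub> (l' + j)) \<odot>\<^bsub>M\<^esub> m''"
    using assms(2) unfolding frac_rel_def by blast
  \<comment> \<open>The multiplier \<open>l + l' + j\<close> contains both witnesses and the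
    exponent of the middle fraction, so each given relation can be applied in turn.\<close>
  have "(g [^]\<^bsub>R\<^esub> ((l + l' + j) + k)) \<odot>\<^bsub>M\<^esub> m = (g [^]\<^bsub>R\<^esub> (l' + k)) \<odot>\<^bsub>M\<^esub> ((g [^]\<^bsub>R\<^esub> (l + j)) \<odot>\<^bsub>M\<^esub> m)"
    by (simp add: algebra_simps)
  also have "\<dots> = (g [^]\<^bsub>R\<^esub> (l + i)) \<odot>\<^bsub>M\<^esub> ((g [^]\<^bsub>R\<^esub> (l' + k)) \<odot>\<^bsub>M\<^esub> m')"
    unfolding l by (simp add: algebra_simps)
  also have "\<dots> = (g [^]\<^bsub>R\<^esub> ((l + l' + j) + i)) \<odot>\<^bsub>M\<^esub> m''"
    unfolding l' by (simp add: algebra_simps)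
  finally show ?thesis unfolding frac_rel_def by blast
qed

lemma fraction_iff: "(m', j) \<in> fr m i \<longleftrightarrow> m' \<in> carrier M \<and> frac_rel m i m' j"
  by (simp add: fraction_def frac_rel_def)

lemma fraction_eq_iff_rel:
  assumes "m \<in> carrier M" "m' \<in> carrier M"
  shows "fr m i = fr m' j \<longleftrightarrow> frac_rel m i m' j"
proof
  assume "fr m i = fr m' j"
  moreover have "(m', j) \<in> fr m' j" unfolding fraction_iff using assms by (auto simp: frac_rel_def)
  ultimately show "frac_rel m i m' j" by (metis fraction_iff)
next
  assume "frac_rel m i m' j"
  then show "fr m i = fr m' j"
    using assms by (auto simp: fraction_iff) (blast intro: frac_rel_trans frac_rel_sym)+
qed

lemma fraction_eq_iff:
  assumes "m \<in> carrier M" "m' \<in> carrier M"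
  shows "fr m i = fr m' j \<longleftrightarrow> (\<exists>l. (g [^]\<^bsub>R\<^esub> (l + j)) \<odot>\<^bsub>M\<^esub> m = (g [^]\<^bsub>R\<^esub> (l + i)) \<odot>\<^bsub>M\<^esub> m')"
  using fraction_eq_iff_rel[OF assms] unfolding frac_rel_def .

lemma fraction_self: "m \<in> carrier M \<Longrightarrow> (m, i) \<in> fr m i"
  unfolding fraction_iff by (auto simp: frac_rel_def)

lemma fraction_expand:
  assumes "m \<in> carrier M"
  shows "fr ((g [^]\<^bsub>R\<^esub> (k::nat)) \<odot>\<^bsub>M\<^esub> m) (k + i) = fr m i"
  using assms by (subst fraction_eq_iff) (auto simp: ac_simps)

lemma Loc_simps:
  "carrier Loc = {fr m i | m i. m \<in> carrier M}"
  "\<zero>\<^bsub>Loc\<^esub> = fr \<zero>\<^bsub>M\<^esub> 0"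
  by (simp_all add: localization_def)

lemma fraction_closed [simp]: "m \<in> carrier M \<Longrightarrow> fr m i \<in> carrier Loc"
  by (auto simp: Loc_simps)

text \<open>Addition on the localization is a union over all representatives. Two choices are
  related by powers of \<open>g\<close>, and multiplying these relations crosswise gives equal
  fractions, so it is a union of equal classes and collapses.\<close>

lemma add_fraction:
  assumes [simp]: "m \<in> carrier M" "m' \<in> carrier M"
  shows "fr m i \<oplus>\<^bsub>Loc\<^esub> fr m' j =
    fr (((g [^]\<^bsub>R\<^esub> j) \<odot>\<^bsub>M\<^esub> m) \<oplus>\<^bsub>M\<^esub> ((g [^]\<^bsub>R\<^esub> i) \<odot>\<^bsub>M\<^esub> m')) (i + j)" (is "_ = ?F")
proof -
  have "fr (((g [^]\<^bsub>R\<^esub> j1) \<odot>\<^bsub>M\<^esub> m1) \<oplus>\<^bsub>M\<^esub> ((g [^]\<^bsub>R\<^esub> i1) \<odot>\<^bsub>M\<^esub> m1')) (i1 + j1) = ?F"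
    if 1: "(m1, i1) \<in> fr m i" and 2: "(m1', j1) \<in> fr m' j" for m1 i1 m1' j1
  proof -
    have [simp]: "m1 \<in> carrier M" "m1' \<in> carrier M" using 1 2 by (auto simp: fraction_iff)
    obtain l where l: "(g [^]\<^bsub>R\<^esub> (l + i1)) \<odot>\<^bsub>M\<^esub> m = (g [^]\<^bsub>R\<^esub> (l + i)) \<odot>\<^bsub>M\<^esub> m1"
      using 1 unfolding fraction_iff frac_rel_def by blast
    obtain l' where l': "(g [^]\<^bsub>R\<^esub> (l' + j1)) \<odot>\<^bsub>M\<^esub> m' = (g [^]\<^bsub>R\<^esub> (l' + j)) \<odot>\<^bsub>M\<^esub> m1'"
      using 2 unfolding fraction_iff frac_rel_def by blast
    have e1: "(g [^]\<^bsub>R\<^esub> (l + l' + i + j + j1)) \<odot>\<^bsub>M\<^esub> m1 = (g [^]\<^bsub>R\<^esub> (l + l' + i1 + j1 + j)) \<odot>\<^bsub>M\<^esub> m"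
      using arg_cong[OF l, of "\<lambda>x. (g [^]\<^bsub>R\<^esub> (l' + j + j1)) \<odot>\<^bsub>M\<^esub> x"] by (simp add: ac_simps)
    have e2: "(g [^]\<^bsub>R\<^esub> (l + l' + i + j + i1)) \<odot>\<^bsub>M\<^esub> m1' = (g [^]\<^bsub>R\<^esub> (l + l' + i1 + j1 + i)) \<odot>\<^bsub>M\<^esub> m'"
      using arg_cong[OF l', of "\<lambda>x. (g [^]\<^bsub>R\<^esub> (l + i + i1)) \<odot>\<^bsub>M\<^esub> x"] by (simp add: ac_simps)
    show ?thesis
      by (subst fraction_eq_iff) (auto intro!: exI[of _ "l + l'"] simp: smult_r_distr e1[simplified ac_simps] e2[simplified ac_simps] ac_simps)
  qed
  then have "(\<Union>(m, i)\<in>fr m i. \<Union>(m', j)\<in>fr m' j.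
       fr (((g [^]\<^bsub>R\<^esub> j) \<odot>\<^bsub>M\<^esub> m) \<oplus>\<^bsub>M\<^esub> ((g [^]\<^bsub>R\<^esub> i) \<odot>\<^bsub>M\<^esub> m')) (i + j)) = ?F"
    by (intro UN_constant_eq[OF fraction_self[of m i]] UN_constant_eq[OF fraction_self[of m' j]] assms
        | clarify | simp)+
  then show ?thesis by (simp add: localization_def)
qed

lemma add_fraction_same:
  assumes [simp]: "m \<in> carrier M" "m' \<in> carrier M"
  shows "fr m i \<oplus>\<^bsub>Loc\<^esub> fr m' i = fr (m \<oplus>\<^bsub>M\<^esub> m') i"
  unfolding add_fraction[OF assms] by (simp add: smult_r_distr[symmetric] fraction_expand)

lemma smult_fraction:
  assumes [simp]: "m \<in> carrier M" "b \<in> carrier R"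
  shows "fraction R g (self_algebra R) b i \<odot>\<^bsub>Loc\<^esub> fr m j = fr (b \<odot>\<^bsub>M\<^esub> m) (i + j)" (is "_ = ?F")
proof -
  have "fr (b1 \<odot>\<^bsub>M\<^esub> m1) (i1 + j1) = ?F"
    if 1: "(b1, i1) \<in> fraction R g (self_algebra R) b i" and 2: "(m1, j1) \<in> fr m j" for b1 i1 m1 j1
  proof -
    have [simp]: "m1 \<in> carrier M" "b1 \<in> carrier R" using 1 2 by (auto simp: fraction_iff fraction_def)
    obtain l where l: "(g [^]\<^bsub>R\<^esub> (l + i1)) \<otimes> b = (g [^]\<^bsub>R\<^esub> (l + i)) \<otimes> b1"
      using 1 unfolding fraction_def by auto
    obtain l' where l': "(g [^]\<^bsub>R\<^esub> (l' + j1)) \<odot>\<^bsub>M\<^esub> m = (g [^]\<^bsub>R\<^esub> (l' + j)) \<odot>\<^bsub>M\<^esub> m1"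
      using 2 unfolding fraction_iff frac_rel_def by blast
    \<comment> \<open>The power of \<open>g\<close> is divided between scalar and element, because
      each of them comes with its own relation.\<close>
    have split: "(g [^]\<^bsub>R\<^esub> (x + y)) \<odot>\<^bsub>M\<^esub> (c \<odot>\<^bsub>M\<^esub> z) = ((g [^]\<^bsub>R\<^esub> x) \<otimes> c) \<odot>\<^bsub>M\<^esub> ((g [^]\<^bsub>R\<^esub> y) \<odot>\<^bsub>M\<^esub> z)"
      if "c \<in> carrier R" "z \<in> carrier M" for x y :: nat and c z
      using that smult_commute[of "g [^]\<^bsub>R\<^esub> y" c z] by (simp add: R.nat_pow_mult[symmetric] smult_assoc1 del: pow_pow_smult)
    have "(g [^]\<^bsub>R\<^esub> ((l + i) + (l' + j))) \<odot>\<^bsub>M\<^esub> (b1 \<odot>\<^bsub>M\<^esub> m1) = (g [^]\<^bsub>R\<^esub> ((l + i1) + (l' + j1))) \<odot>\<^bsub>M\<^esub> (b \<odot>\<^bsub>M\<^esub> m)"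
      by (simp only: split l l' \<open>m1 \<in> carrier M\<close> \<open>b1 \<in> carrier R\<close> assms)
    then show ?thesis
      by (subst fraction_eq_iff) (auto intro!: exI[of _ "l + l'"] simp: ac_simps)
  qed
  moreover have "(b, i) \<in> fraction R g (self_algebra R) b i" by (auto simp: fraction_def)
  ultimately have "(\<Union>(b, i)\<in>fraction R g (self_algebra R) b i. \<Union>(m, j)\<in>fr m j. fr (b \<odot>\<^bsub>M\<^esub> m) (i + j)) = ?F"
    by (intro UN_constant_eq[of "(b, i)"] UN_constant_eq[OF fraction_self[of m j]] assms | clarify | simp)+
  then show ?thesis by (simp add: localization_def)
qed

lemma abelian_monoid_Loc: "abelian_monoid Loc"
proof (rule abelian_monoidI)
  fix x y assume x: "x \<in> carrier Loc" and y: "y \<in> carrier Loc"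
  show "x \<oplus>\<^bsub>Loc\<^esub> y \<in> carrier Loc" using x y by (auto simp: Loc_simps(1) add_fraction) (auto simp: Loc_simps(1)[symmetric])
  show "x \<oplus>\<^bsub>Loc\<^esub> y = y \<oplus>\<^bsub>Loc\<^esub> x" using x y by (auto simp: Loc_simps(1) add_fraction M.a_comm ac_simps)
  fix z assume z: "z \<in> carrier Loc"
  show "x \<oplus>\<^bsub>Loc\<^esub> y \<oplus>\<^bsub>Loc\<^esub> z = x \<oplus>\<^bsub>Loc\<^esub> (y \<oplus>\<^bsub>Loc\<^esub> z)"
    using x y z by (auto simp: Loc_simps(1) add_fraction M.a_assoc smult_r_distr ac_simps)
next
  show "\<zero>\<^bsub>Loc\<^esub> \<in> carrier Loc" by (simp add: Loc_simps(2))
  fix x assume x: "x \<in> carrier Loc"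
  show "\<zero>\<^bsub>Loc\<^esub> \<oplus>\<^bsub>Loc\<^esub> x = x"
    using x by (auto simp: Loc_simps add_fraction)
qed

lemma finsum_fraction:
  assumes "x \<in> S \<rightarrow> carrier M"
  shows "finsum Loc (\<lambda>s. fr (x s) N) S = fr (finsum M x S) N"
proof (rule finsum_hom[symmetric, where h = "\<lambda>m. fr m N"])
  show "fr \<zero>\<^bsub>M\<^esub> N = \<zero>\<^bsub>Loc\<^esub>"
    unfolding Loc_simps by (subst fraction_eq_iff) auto
qed (use assms in \<open>auto simp: add_fraction_same intro: abelian_monoid_Loc M.abelian_monoid_axioms\<close>)

lemma fraction_denominator:
  assumes "m \<in> carrier M" "i \<le> N"
  shows "fr m i = fr ((g [^]\<^bsub>R\<^esub> (N - i)) \<odot>\<^bsub>M\<^esub> m) N"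
  using assms fraction_expand[of m "N - i" i] by simp

definition free_after_inverting :: "nat \<Rightarrow> bool" where
  "free_after_inverting d \<longleftrightarrow> (\<exists>e \<in> {..<d} \<rightarrow> carrier M.
     generates R M g d e \<and>
     independent R M g d e)"


abbreviation "frR \<equiv> fraction R g (self_algebra R)"

text \<open>Powers of \<open>g\<close> are units after localization. A basis can therefore be
  replaced by its numerators, and relations by relations with coefficients in \<open>R\<close>;
  conversely the fractions \<open>e i\<close> over 1 form a basis.\<close>

lemma free_of_rank_localization_iff: "free_of_rank LocR Loc d \<longleftrightarrow> free_after_inverting d"
proof
  interpret S: algebra R "self_algebra R" by (rule R.algebra_self)
  interpret self: localized_module R "self_algebra R" g by unfold_locales (rule g)
  interpret L: abelian_monoid Loc by (rule abelian_monoid_Loc)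
  assume "free_of_rank LocR Loc d"
  then obtain \<epsilon> where \<epsilon>: "\<epsilon> \<in> {..<d} \<rightarrow> carrier Loc"
    and ex1: "\<And>m. m \<in> carrier Loc \<Longrightarrow> \<exists>!c. c \<in> {..<d} \<rightarrow>\<^sub>E carrier LocR \<and>
       m = finsum Loc (\<lambda>i. c i \<odot>\<^bsub>Loc\<^esub> \<epsilon> i) {..<d}"
    unfolding free_of_rank_def by (elim bexE) (rule that, assumption, erule bspec)
  have "\<forall>i\<in>{..<d}. \<exists>m k. m \<in> carrier M \<and> \<epsilon> i = fr m k" using \<epsilon> by (simp add: Loc_simps Pi_iff) blast
  from bchoice2[OF this] obtain e k where e: "\<And>i. i < d \<Longrightarrow> e i \<in> carrier M" and ek: "\<And>i. i < d \<Longrightarrow> \<epsilon> i = fr (e i) (k i)"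
    by auto
  show "free_after_inverting d"
    unfolding free_after_inverting_def
  proof (intro bexI[of _ e] conjI ballI impI allI)
    show "e \<in> {..<d} \<rightarrow> carrier M" using e by auto
  next
    fix q assume q: "q \<in> carrier M"
    obtain c where c: "c \<in> {..<d} \<rightarrow> carrier LocR" and qc: "fr q 0 = finsum Loc (\<lambda>i. c i \<odot>\<^bsub>Loc\<^esub> \<epsilon> i) {..<d}"
      using ex1[OF fraction_closed[OF q], of 0] by (auto simp: PiE_def)
    have "\<forall>i\<in>{..<d}. \<exists>b l. b \<in> carrier R \<and> c i = frR b l" using c by (simp add: self.Loc_simps Pi_iff) blast
    from bchoice2[OF this] obtain b l where b: "\<And>i. i < d \<Longrightarrow> b i \<in> carrier R" and bl: "\<And>i. i < d \<Longrightarrow> c i = frR (b i) (l i)"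
      by auto
    \<comment> \<open>A common denominator: the sum of all exponents bounds each of them and is
      defined also when \<open>d\<close> is 0.\<close>
    define N where "N = (\<Sum>i<d. l i + k i)"
    have N: "l i + k i \<le> N" if "i < d" for i
      unfolding N_def using that by (intro member_le_sum) auto
    define b' where "b' i = (g [^] (N - (l i + k i))) \<otimes> b i" for i
    have b': "b' i \<in> carrier R" if "i < d" for i using b[OF that] by (simp add: b'_def)
    have "fr q 0 = finsum Loc (\<lambda>i. fr (b' i \<odot>\<^bsub>M\<^esub> e i) N) {..<d}"
      unfolding qc
    proof (rule L.finsum_cong'[OF refl])
      fix i assume "i \<in> {..<d}"
      then have i: "i < d" by simp
      have "c i \<odot>\<^bsub>Loc\<^esub> \<epsilon> i = fr (b i \<odot>\<^bsub>M\<^esub> e i) (l i + k i)"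
        using i e b by (simp add: ek bl smult_fraction)
      also have "\<dots> = fr (b' i \<odot>\<^bsub>M\<^esub> e i) N"
        using i e b N[OF i] by (subst fraction_denominator[of _ _ N]) (auto simp: b'_def smult_assoc1)
      finally show "c i \<odot>\<^bsub>Loc\<^esub> \<epsilon> i = fr (b' i \<odot>\<^bsub>M\<^esub> e i) N" .
    qed (use b' e in auto)
    also have "\<dots> = fr (lincomb M {..<d} b' e) N"
      using b' e by (intro finsum_fraction) auto
    finally obtain L where L: "(g [^] (L + N)) \<odot>\<^bsub>M\<^esub> q = (g [^] L) \<odot>\<^bsub>M\<^esub> lincomb M {..<d} b' e"
      using q b' e by (subst (asm) fraction_eq_iff) (auto intro!: M.finsum_closed)
    have "\<dots> = (lincomb M {..<d} (\<lambda>i. ((g [^] L) \<otimes> b' i)) e)"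
      using b' e by (subst finsum_smult_ldistr) (auto simp: smult_assoc1 intro!: M.finsum_cong')
    then show "\<exists>N::nat. \<exists>c\<in>{..<d} \<rightarrow> carrier R. (g [^] N) \<odot>\<^bsub>M\<^esub> q = lincomb M {..<d} c e"
      using L b' by (intro exI[of _ "L + N"] bexI[of _ "\<lambda>i. (g [^] L) \<otimes> b' i"]) auto
  next
    fix c i assume c: "c \<in> {..<d} \<rightarrow> carrier R" and 0: "lincomb M {..<d} c e = \<zero>\<^bsub>M\<^esub>"
      and i: "i < d"
    have c': "c j \<in> carrier R" if "j < d" for j using c that by auto
    \<comment> \<open>Two expansions of zero. The factor \<open>g ^ k i\<close> cancels the
      denominator of \<open>\<epsilon> i\<close>; uniqueness of coordinates then identifies
      \<open>u\<close> with the zero family \<open>v\<close>. Both are restricted because uniqueness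
      concerns functions that are extensional on \<open>{..<d}\<close>.\<close>
    define u where "u = restrict (\<lambda>i. frR ((g [^] k i) \<otimes> c i) 0) {..<d}"
    define v where "v = restrict (\<lambda>i. frR \<zero> 0) {..<d}"
    have u: "u \<in> {..<d} \<rightarrow>\<^sub>E carrier LocR" unfolding u_def using c' by auto
    have v: "v \<in> {..<d} \<rightarrow>\<^sub>E carrier LocR" unfolding v_def by auto
    have "finsum Loc (\<lambda>i. u i \<odot>\<^bsub>Loc\<^esub> \<epsilon> i) {..<d} = finsum Loc (\<lambda>i. fr (c i \<odot>\<^bsub>M\<^esub> e i) 0) {..<d}"
    proof (rule L.finsum_cong'[OF refl])
      fix j assume "j \<in> {..<d}"
      then have j: "j < d" by simp
      have "u j \<odot>\<^bsub>Loc\<^esub> \<epsilon> j = fr ((g [^] k j) \<odot>\<^bsub>M\<^esub> (c j \<odot>\<^bsub>M\<^esub> e j)) (k j)"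
        using j e c' by (simp add: u_def ek smult_fraction smult_assoc1)
      also have "\<dots> = fr (c j \<odot>\<^bsub>M\<^esub> e j) 0"
        using j e c' fraction_expand[of "c j \<odot>\<^bsub>M\<^esub> e j" "k j" 0] by simp
      finally show "u j \<odot>\<^bsub>Loc\<^esub> \<epsilon> j = fr (c j \<odot>\<^bsub>M\<^esub> e j) 0" .
    qed (use c' e in auto)
    also have "\<dots> = fr \<zero>\<^bsub>M\<^esub> 0"
      using c' e 0 by (subst finsum_fraction) auto
    also have "\<dots> = finsum Loc (\<lambda>i. \<zero>\<^bsub>Loc\<^esub>) {..<d}"
      by (simp add: Loc_simps(2)[symmetric])
    also have "\<dots> = finsum Loc (\<lambda>i. v i \<odot>\<^bsub>Loc\<^esub> \<epsilon> i) {..<d}"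
    proof (rule L.finsum_cong'[OF refl])
      show "(\<lambda>i. v i \<odot>\<^bsub>Loc\<^esub> \<epsilon> i) \<in> {..<d} \<rightarrow> carrier Loc"
        using e by (auto simp: v_def ek smult_fraction)
      fix j assume "j \<in> {..<d}"
      then show "\<zero>\<^bsub>Loc\<^esub> = v j \<odot>\<^bsub>Loc\<^esub> \<epsilon> j"
        using e by (auto simp: v_def ek smult_fraction Loc_simps fraction_eq_iff)
    qed
    finally have "finsum Loc (\<lambda>i. u i \<odot>\<^bsub>Loc\<^esub> \<epsilon> i) {..<d} = finsum Loc (\<lambda>i. v i \<odot>\<^bsub>Loc\<^esub> \<epsilon> i) {..<d}" .
    moreover have "finsum Loc (\<lambda>i. v i \<odot>\<^bsub>Loc\<^esub> \<epsilon> i) {..<d} \<in> carrier Loc"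
      using e by (intro L.finsum_closed) (auto simp: v_def ek smult_fraction)
    moreover have "a = b" if "\<exists>!x. P x" "P a" "P b" for P and a b :: "nat \<Rightarrow> ('a \<times> nat) set"
      using that by blast
    note this[OF ex1]
    ultimately have "u = v" using u v by simp
    then have "frR ((g [^] k i) \<otimes> c i) 0 = frR \<zero> 0"
      using i by (metis (mono_tags, lifting) lessThan_iff restrict_apply' u_def v_def)
    then obtain l :: nat where "(g [^] l) \<otimes> ((g [^] k i) \<otimes> c i) = \<zero>"
      using c'[OF i] by (subst (asm) self.fraction_eq_iff) auto
    then have "(g [^] (l + k i)) \<otimes> c i = \<zero>"
      using c'[OF i] by (simp add: R.m_assoc[symmetric] R.nat_pow_mult)
    then show "\<exists>N::nat. (g [^] N) \<otimes> c i = \<zero>" by blast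
  qed
next
  interpret S: algebra R "self_algebra R" by (rule R.algebra_self)
  interpret self: localized_module R "self_algebra R" g by unfold_locales (rule g)
  interpret L: abelian_monoid Loc by (rule abelian_monoid_Loc)
  assume "free_after_inverting d"
  then obtain e where e: "e \<in> {..<d} \<rightarrow> carrier M"
    and span: "\<And>q. q \<in> carrier M \<Longrightarrow> \<exists>N::nat. \<exists>c\<in>{..<d} \<rightarrow> carrier R. (g [^] N) \<odot>\<^bsub>M\<^esub> q = lincomb M {..<d} c e"
    and indep: "\<And>c. c \<in> {..<d} \<rightarrow> carrier R \<Longrightarrow> (lincomb M {..<d} c e) = \<zero>\<^bsub>M\<^esub> \<Longrightarrow> (\<forall>i<d. \<exists>N::nat. (g [^] N) \<otimes> c i = \<zero>)"
    unfolding free_after_inverting_def by (elim bexE conjE) (rule that, assumption, erule (1) bspec, drule (1) bspec, erule (1) mp)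
  have e': "e i \<in> carrier M" if "i < d" for i using e that by auto
  have unique: "c = c'" if c: "c \<in> {..<d} \<rightarrow>\<^sub>E carrier LocR" and c': "c' \<in> {..<d} \<rightarrow>\<^sub>E carrier LocR"
    and eq: "finsum Loc (\<lambda>i. c i \<odot>\<^bsub>Loc\<^esub> fr (e i) 0) {..<d} = finsum Loc (\<lambda>i. c' i \<odot>\<^bsub>Loc\<^esub> fr (e i) 0) {..<d}" for c c'
  proof -
    have "\<forall>i\<in>{..<d}. \<exists>b l. b \<in> carrier R \<and> c i = frR b l" using c by (simp add: self.Loc_simps PiE_iff) blast
    from bchoice2[OF this] obtain b l where b: "\<And>i. i < d \<Longrightarrow> b i \<in> carrier R" and bl: "\<And>i. i < d \<Longrightarrow> c i = frR (b i) (l i)"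
      by auto
    have "\<forall>i\<in>{..<d}. \<exists>b l. b \<in> carrier R \<and> c' i = frR b l" using c' by (simp add: self.Loc_simps PiE_iff) blast
    from bchoice2[OF this] obtain b' l' where b': "\<And>i. i < d \<Longrightarrow> b' i \<in> carrier R" and bl': "\<And>i. i < d \<Longrightarrow> c' i = frR (b' i) (l' i)"
      by auto
    define N where "N = (\<Sum>i<d. l i + l' i)"
    have N: "l i \<le> N" "l' i \<le> N" if "i < d" for i
    proof -
      have "l i + l' i \<le> N" unfolding N_def using that by (intro member_le_sum) auto
      then show "l i \<le> N" "l' i \<le> N" by auto
    qed
    \<comment> \<open>Numerators over the common denominator \<open>N\<close>, so that equality of
      the two combinations becomes an equation in \<open>M\<close>.\<close>
    define x where "x i = (g [^] (N - l i)) \<otimes> b i" for i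
    define x' where "x' i = (g [^] (N - l' i)) \<otimes> b' i" for i
    have x: "x i \<in> carrier R" "x' i \<in> carrier R" if "i < d" for i using b b' that by (auto simp: x_def x'_def)
    have cx: "c i = frR (x i) N" "c' i = frR (x' i) N" if "i < d" for i
      using that N[OF that] b b' self.fraction_denominator[of "b i" "l i" N] self.fraction_denominator[of "b' i" "l' i" N]
      by (simp_all add: bl bl' x_def x'_def)
    have sum: "finsum Loc (\<lambda>i. w i \<odot>\<^bsub>Loc\<^esub> fr (e i) 0) {..<d} = fr (lincomb M {..<d} y e) N"
      if w: "\<And>i. i < d \<Longrightarrow> w i = frR (y i) N" and y: "\<And>i. i < d \<Longrightarrow> y i \<in> carrier R" for w y
    proof -
      have "finsum Loc (\<lambda>i. w i \<odot>\<^bsub>Loc\<^esub> fr (e i) 0) {..<d} = finsum Loc (\<lambda>i. fr (y i \<odot>\<^bsub>M\<^esub> e i) N) {..<d}"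
        using w y e' by (intro L.finsum_cong' refl) (simp_all add: smult_fraction)
      also have "\<dots> = fr (lincomb M {..<d} y e) N"
        using y e' by (intro finsum_fraction) auto
      finally show ?thesis .
    qed
    have "fr (lincomb M {..<d} x e) N = fr (lincomb M {..<d} x' e) N"
      using eq sum[of c x] sum[of c' x'] cx x by simp
    then obtain L where L: "(g [^] (L + N)) \<odot>\<^bsub>M\<^esub> lincomb M {..<d} x e = (g [^] (L + N)) \<odot>\<^bsub>M\<^esub> lincomb M {..<d} x' e"
      using x e' by (subst (asm) fraction_eq_iff) (auto intro!: M.finsum_closed)
    \<comment> \<open>The left side adds the scaled second combination to a combination of the
      differences \<open>x i - x' i\<close>. It equals the scaled first combination, hence by
      \<open>L\<close> the scaled second one; cancellation leaves a relation to which
      \<open>indep\<close> applies.\<close>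
    have "(lincomb M {..<d} (\<lambda>i. ((g [^] (L + N)) \<otimes> (x i \<ominus> x' i))) e) \<oplus>\<^bsub>M\<^esub> (g [^] (L + N)) \<odot>\<^bsub>M\<^esub> (lincomb M {..<d} x' e)
        = (\<Oplus>\<^bsub>M\<^esub>i\<in>{..<d}. ((g [^] (L + N)) \<otimes> (x i \<ominus> x' i)) \<odot>\<^bsub>M\<^esub> e i \<oplus>\<^bsub>M\<^esub> (g [^] (L + N)) \<odot>\<^bsub>M\<^esub> (x' i \<odot>\<^bsub>M\<^esub> e i))"
      using x e' by (subst M.finsum_addf) (auto simp: finsum_smult_ldistr)
    also have "\<dots> = (lincomb M {..<d} (\<lambda>i. (g [^] (L + N))) (\<lambda>i. (x i \<odot>\<^bsub>M\<^esub> e i)))"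
    proof (rule M.finsum_cong'[OF refl])
      fix i assume "i \<in> {..<d}"
      then have i: "i < d" by simp
      have "x i \<ominus> x' i \<oplus> x' i = x i" using x[OF i] by (simp add: R.minus_eq R.a_assoc R.l_neg)
      then show "((g [^] (L + N)) \<otimes> (x i \<ominus> x' i)) \<odot>\<^bsub>M\<^esub> e i \<oplus>\<^bsub>M\<^esub> (g [^] (L + N)) \<odot>\<^bsub>M\<^esub> (x' i \<odot>\<^bsub>M\<^esub> e i) =
          (g [^] (L + N)) \<odot>\<^bsub>M\<^esub> (x i \<odot>\<^bsub>M\<^esub> e i)"
        using x[OF i] e'[OF i] by (simp add: smult_assoc1 smult_r_distr[symmetric] smult_l_distr[symmetric])
    qed (use x e' in auto)
    also have "\<dots> = (g [^] (L + N)) \<odot>\<^bsub>M\<^esub> lincomb M {..<d} x' e"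
      unfolding L[symmetric] using x e' by (subst finsum_smult_ldistr) auto
    finally have "(lincomb M {..<d} (\<lambda>i. ((g [^] (L + N)) \<otimes> (x i \<ominus> x' i))) e) = \<zero>\<^bsub>M\<^esub>"
    proof (subst (asm) M.add.r_cancel_one)
    qed (use x e' in \<open>auto intro!: M.finsum_closed\<close>)
    then have tors: "\<exists>K::nat. (g [^] K) \<otimes> ((g [^] (L + N)) \<otimes> (x i \<ominus> x' i)) = \<zero>" if "i < d" for i
      using indep[of "\<lambda>i. (g [^] (L + N)) \<otimes> (x i \<ominus> x' i)"] x that by auto
    have "c i = c' i" if i: "i < d" for i
    proof -
      obtain K :: nat where "(g [^] K) \<otimes> ((g [^] (L + N)) \<otimes> (x i \<ominus> x' i)) = \<zero>" using tors[OF i] by blast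
      then have "(g [^] (K + L + N)) \<otimes> (x i \<ominus> x' i) = \<zero>"
        using x[OF i] by (simp add: R.m_assoc[symmetric] R.nat_pow_mult add.assoc)
      then have "(g [^] (K + L + N)) \<otimes> x i \<ominus> (g [^] (K + L + N)) \<otimes> x' i = \<zero>"
        using x[OF i] by (simp add: R.minus_eq R.r_distr R.r_minus)
      then have "(g [^] (K + L + N)) \<otimes> x i = (g [^] (K + L + N)) \<otimes> x' i"
        using x[OF i] R.add.inv_solve_right[of "\<zero>"] by (simp add: R.minus_eq) (metis R.add.inv_comm R.add.inv_equality R.add.inv_inv R.a_inv_closed R.m_closed R.nat_pow_closed g)
      then show ?thesis
        unfolding cx[OF i] using x[OF i] by (subst self.fraction_eq_iff) (auto simp: ac_simps intro!: exI[of _ "K + L"])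
    qed
    then show "c = c'" using c c' by (auto intro: PiE_ext)
  qed
  show "free_of_rank LocR Loc d"
    unfolding free_of_rank_def
  proof (intro bexI[of _ "\<lambda>i. fr (e i) 0"] ballI)
    show "(\<lambda>i. fr (e i) 0) \<in> {..<d} \<rightarrow> carrier Loc" using e' by auto
    fix m assume "m \<in> carrier Loc"
    then obtain q j where q: "q \<in> carrier M" and m: "m = fr q j" by (auto simp: Loc_simps)
    obtain N :: nat and c where c: "c \<in> {..<d} \<rightarrow> carrier R" and N: "(g [^] N) \<odot>\<^bsub>M\<^esub> q = lincomb M {..<d} c e"
      using span[OF q] by blast
    have c': "c i \<in> carrier R" if "i < d" for i using c that by auto
    \<comment> \<open>The denominator is \<open>N + j\<close>: \<open>N\<close> is the power that
      brings \<open>q\<close> into the span of \<open>e\<close>, and \<open>j\<close> is the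
      denominator of \<open>m\<close>.\<close>
    define w where "w = restrict (\<lambda>i. frR (c i) (N + j)) {..<d}"
    have w: "w \<in> {..<d} \<rightarrow>\<^sub>E carrier LocR" unfolding w_def using c' by auto
    have "finsum Loc (\<lambda>i. w i \<odot>\<^bsub>Loc\<^esub> fr (e i) 0) {..<d} = finsum Loc (\<lambda>i. fr (c i \<odot>\<^bsub>M\<^esub> e i) (N + j)) {..<d}"
      using c' e' by (intro L.finsum_cong' refl) (auto simp: w_def smult_fraction)
    also have "\<dots> = fr ((g [^] N) \<odot>\<^bsub>M\<^esub> q) (N + j)"
      unfolding N using c' e' by (intro finsum_fraction) auto
    also have "\<dots> = m" unfolding m by (rule fraction_expand[OF q])
    finally have mw: "m = finsum Loc (\<lambda>i. w i \<odot>\<^bsub>Loc\<^esub> fr (e i) 0) {..<d}" ..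
    show "\<exists>!c. c \<in> {..<d} \<rightarrow>\<^sub>E carrier LocR \<and> m = finsum Loc (\<lambda>i. c i \<odot>\<^bsub>Loc\<^esub> fr (e i) 0) {..<d}"
    proof (rule ex1I[of _ w])
      fix c assume "c \<in> {..<d} \<rightarrow>\<^sub>E carrier LocR \<and> m = finsum Loc (\<lambda>i. c i \<odot>\<^bsub>Loc\<^esub> fr (e i) 0) {..<d}"
      then show "c = w" using mw w by (intro unique) auto
    qed (use w mw in auto)
  qed
qed

end

section \<open>Points of the Hilbert functors as ideals\<close>

lemma (in abelian_group) minus_eq_zero_iff:
  "x \<in> carrier G \<Longrightarrow> y \<in> carrier G \<Longrightarrow> x \<ominus> y = \<zero> \<longleftrightarrow> x = y"
  by (metis add.inv_equality add.inv_inv a_inv_closed minus_eq r_neg)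

text \<open>Used for \<open>quotient_algebra\<close>, a record of another type with the ring
  operations of \<open>S Quot I\<close>.\<close>

lemma cring_cong:
  assumes "cring A" "carrier B = carrier A" "monoid.mult B = monoid.mult A" "one B = one A"
    "zero B = zero A" "add B = add A"
  shows "cring B"
proof -
  interpret cring A by fact
  show ?thesis
  proof (rule cringI)
    show "abelian_group B"
      by (rule abelian_groupI) (auto simp: assms(2-) a_ac intro: l_neg a_inv_closed)
    show "comm_monoid B"
      by (rule comm_monoidI) (auto simp: assms(2-) m_ac)
  qed (auto simp: assms(2-) l_distr)
qed

text \<open>A scalar acts as multiplication by the class of its multiple of one, so the module laws
  follow from the ring laws of the quotient and no representatives of cosets have to be
  chosen.\<close>

definition quotient_algebra ::
    "('r, 's, 'z) module_scheme \<Rightarrow> 's set \<Rightarrow> ('r, 's set) module" where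
  "quotient_algebra S I =
    \<lparr>carrier = carrier (S Quot I), monoid.mult = monoid.mult (S Quot I), one = one (S Quot I),
     zero = zero (S Quot I), add = add (S Quot I),
     smult = (\<lambda>r X. (I +>\<^bsub>S\<^esub> (r \<odot>\<^bsub>S\<^esub> \<one>\<^bsub>S\<^esub>)) \<otimes>\<^bsub>S Quot I\<^esub> X)\<rparr>"

text \<open>The condition \<open>generates\<close> for \<open>S / I\<close>, with equality in the
  quotient replaced by congruence in \<open>S\<close>. No quotient is formed, so \<open>I\<close>
  may also be a mere submodule, as in the exchange argument.\<close>

abbreviation generates_mod ::
    "('r, 'x) ring_scheme \<Rightarrow> ('r, 's, 'z) module_scheme \<Rightarrow> 's set \<Rightarrow> 'r \<Rightarrow> nat \<Rightarrow> (nat \<Rightarrow> 's) \<Rightarrow> bool" where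
  "generates_mod R S I g d e \<equiv> \<forall>q\<in>carrier S. \<exists>N::nat. \<exists>c\<in>{..<d} \<rightarrow> carrier R.
     ((g [^]\<^bsub>R\<^esub> N) \<odot>\<^bsub>S\<^esub> q) \<ominus>\<^bsub>S\<^esub> lincomb S {..<d} c e \<in> I"

abbreviation independent_mod ::
    "('r, 'x) ring_scheme \<Rightarrow> ('r, 's, 'z) module_scheme \<Rightarrow> 's set \<Rightarrow> 'r \<Rightarrow> nat \<Rightarrow> (nat \<Rightarrow> 's) \<Rightarrow> bool" where
  "independent_mod R S I g d e \<equiv> \<forall>c\<in>{..<d} \<rightarrow> carrier R. lincomb S {..<d} c e \<in> I \<longrightarrow>
     (\<forall>i<d. \<exists>N::nat. (g [^]\<^bsub>R\<^esub> N) \<otimes>\<^bsub>R\<^esub> c i = \<zero>\<^bsub>R\<^esub>)"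

text \<open>Freeness of \<open>Q\<^sub>g\<close> for \<open>Q = S / I\<close>, written without localizations.\<close>

definition locally_free_quotient ::
    "('r, 'x) ring_scheme \<Rightarrow> ('r, 's, 'z) module_scheme \<Rightarrow> 's set \<Rightarrow> nat \<Rightarrow> bool" where
  "locally_free_quotient R S I d \<longleftrightarrow> (\<forall>P. primeideal P R \<longrightarrow>
     (\<exists>g \<in> carrier R - P. \<exists>e \<in> {..<d} \<rightarrow> carrier S.
       generates_mod R S I g d e \<and>
       independent_mod R S I g d e))"

context algebra
begin

lemma smult_eq_mult: "a \<in> carrier R \<Longrightarrow> x \<in> carrier M \<Longrightarrow> a \<odot>\<^bsub>M\<^esub> x = (a \<odot>\<^bsub>M\<^esub> \<one>\<^bsub>M\<^esub>) \<otimes>\<^bsub>M\<^esub> x"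
  by (simp add: smult_assoc2)

lemma ideal_smult_closed:
  assumes "ideal I M" "a \<in> carrier R" "x \<in> I"
  shows "a \<odot>\<^bsub>M\<^esub> x \<in> I"
  using assms smult_eq_mult[of a x] ideal.I_l_closed[OF assms(1,3), of "a \<odot>\<^bsub>M\<^esub> \<one>\<^bsub>M\<^esub>"] ideal.Icarr[OF assms(1,3)]
  by simp

context
  fixes I assumes I: "ideal I M"
begin

interpretation I: ideal I M by (rule I)
interpretation Q: cring "M Quot I" by (rule I.quotient_is_cring[OF M_cring])

lemma quotient_algebra: "algebra R (quotient_algebra M I)"
proof (rule algebraI)
  show "cring R" by (rule R_cring)
  show "cring (quotient_algebra M I)"
    by (rule cring_cong[OF Q.cring_axioms]) (simp_all add: quotient_algebra_def)
  note h = I.rcos_ring_hom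
  note hc = ring_hom_closed[OF h] and ha = ring_hom_add[OF h, symmetric] and hm = ring_hom_mult[OF h, symmetric]
    and h1 = ring_hom_one[OF h]
  fix a b x y assume *: "a \<in> carrier R" "b \<in> carrier R" "x \<in> carrier (quotient_algebra M I)" "y \<in> carrier (quotient_algebra M I)"
  then have x: "x \<in> carrier (M Quot I)" and y: "y \<in> carrier (M Quot I)"
    by (auto simp: quotient_algebra_def)
  show "a \<odot>\<^bsub>quotient_algebra M I\<^esub> x \<in> carrier (quotient_algebra M I)"
    using * by (auto simp: quotient_algebra_def intro!: hc Q.m_closed)
  show "(a \<oplus> b) \<odot>\<^bsub>quotient_algebra M I\<^esub> x = a \<odot>\<^bsub>quotient_algebra M I\<^esub> x \<oplus>\<^bsub>quotient_algebra M I\<^esub> b \<odot>\<^bsub>quotient_algebra M I\<^esub> x"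
    using * x by (simp add: quotient_algebra_def Q.l_distr[symmetric] hc ha smult_l_distr)
  show "a \<odot>\<^bsub>quotient_algebra M I\<^esub> (x \<oplus>\<^bsub>quotient_algebra M I\<^esub> y) = a \<odot>\<^bsub>quotient_algebra M I\<^esub> x \<oplus>\<^bsub>quotient_algebra M I\<^esub> a \<odot>\<^bsub>quotient_algebra M I\<^esub> y"
    using * x y by (simp add: quotient_algebra_def Q.r_distr hc)
  show "(a \<otimes> b) \<odot>\<^bsub>quotient_algebra M I\<^esub> x = a \<odot>\<^bsub>quotient_algebra M I\<^esub> (b \<odot>\<^bsub>quotient_algebra M I\<^esub> x)"
    using * x smult_eq_mult[of a "b \<odot>\<^bsub>M\<^esub> \<one>\<^bsub>M\<^esub>"]
    by (simp add: quotient_algebra_def Q.m_assoc[symmetric] hc hm smult_assoc1)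
  show "(a \<odot>\<^bsub>quotient_algebra M I\<^esub> x) \<otimes>\<^bsub>quotient_algebra M I\<^esub> y = a \<odot>\<^bsub>quotient_algebra M I\<^esub> (x \<otimes>\<^bsub>quotient_algebra M I\<^esub> y)"
    using * x y by (simp add: quotient_algebra_def Q.m_assoc hc)
next
  fix x assume "x \<in> carrier (quotient_algebra M I)"
  then have x: "x \<in> carrier (M Quot I)"
    by (auto simp: quotient_algebra_def)
  then show "\<one> \<odot>\<^bsub>quotient_algebra M I\<^esub> x = x"
    using ring_hom_one[OF I.rcos_ring_hom] by (simp add: quotient_algebra_def)
qed

lemma quotient_algebra_hom: "(+>\<^bsub>M\<^esub>) I \<in> alg_hom R M (quotient_algebra M I)"
proof -
  note h = I.rcos_ring_hom
  have "(+>\<^bsub>M\<^esub>) I \<in> ring_hom M (quotient_algebra M I)"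
    using h by (simp add: ring_hom_def quotient_algebra_def)
  moreover have "I +>\<^bsub>M\<^esub> (r \<odot>\<^bsub>M\<^esub> m) = r \<odot>\<^bsub>quotient_algebra M I\<^esub> (I +>\<^bsub>M\<^esub> m)" if "r \<in> carrier R" "m \<in> carrier M" for r m
    using that ring_hom_mult[OF h, symmetric] smult_eq_mult[of r m] by (simp add: quotient_algebra_def)
  ultimately show ?thesis by (simp add: alg_hom_def)
qed

lemma quotient_algebra_surj: "((+>\<^bsub>M\<^esub>) I) ` carrier M = carrier (quotient_algebra M I)"
  by (auto simp: quotient_algebra_def FactRing_simps)

lemma quotient_algebra_kernel: "a_kernel M (quotient_algebra M I) ((+>\<^bsub>M\<^esub>) I) = I"
proof -
  have "\<zero>\<^bsub>quotient_algebra M I\<^esub> = I" by (simp add: quotient_algebra_def FactRing_def)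
  moreover have "I +>\<^bsub>M\<^esub> x = I \<longleftrightarrow> x \<in> I" if "x \<in> carrier M" for x
    by (rule iffI, rule I.rcos_const_imp_mem[OF that], assumption,
        rule ring.a_rcos_zero[OF cring.axioms(1)[OF M_cring] I])
  ultimately have "x \<in> a_kernel M (quotient_algebra M I) ((+>\<^bsub>M\<^esub>) I) \<longleftrightarrow> x \<in> I" for x
    unfolding a_kernel_def' mem_Collect_eq using I.Icarr by metis
  then show ?thesis by blast
qed

end

end

section \<open>Surjective algebra maps seen through their kernels\<close>

locale algebra_surjection = dom: algebra R S + cod: algebra R Q
  for R (structure) and S :: "('r, 's, 'y) module_scheme" and Q :: "('r, 'q, 'z) module_scheme" +
  fixes \<phi> I
  assumes hom: "\<phi> \<in> alg_hom R S Q" and surj: "\<phi> ` carrier S = carrier Q"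
    and kernel: "a_kernel S Q \<phi> = I"
begin

sublocale ring_hom_cring S Q \<phi>
  by unfold_locales (use hom in \<open>simp add: alg_hom_def\<close>)

lemma phi_smult: "r \<in> carrier R \<Longrightarrow> x \<in> carrier S \<Longrightarrow> \<phi> (r \<odot>\<^bsub>S\<^esub> x) = r \<odot>\<^bsub>Q\<^esub> \<phi> x"
  using hom by (simp add: alg_hom_def)

lemma kernel_iff: "x \<in> I \<longleftrightarrow> x \<in> carrier S \<and> \<phi> x = \<zero>\<^bsub>Q\<^esub>"
  unfolding kernel[symmetric] a_kernel_def' by simp

lemma phi_eq_iff:
  assumes "x \<in> carrier S" "y \<in> carrier S"
  shows "x \<ominus>\<^bsub>S\<^esub> y \<in> I \<longleftrightarrow> \<phi> x = \<phi> y"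
  using assms cod.M.minus_eq_zero_iff[of "\<phi> x" "\<phi> y"]
  by (simp add: kernel_iff dom.M.minus_eq cod.M.minus_eq)

lemma ideal: "ideal I S"
  using ring_hom_ring.kernel_is_ideal[OF ring_hom_ringI2[OF cring.axioms(1)[OF dom.M_cring] cring.axioms(1)[OF cod.M_cring] homh]]
  unfolding kernel .

lemma phi_sum:
  assumes "c \<in> A \<rightarrow> carrier R" "e \<in> A \<rightarrow> carrier S"
  shows "\<phi> (lincomb S A c e) = lincomb Q A c (\<lambda>i. \<phi> (e i))"
proof -
  have c: "c i \<in> carrier R" "e i \<in> carrier S" if "i \<in> A" for i using assms that by auto
  have "\<phi> (lincomb S A c e) = (\<Oplus>\<^bsub>Q\<^esub>i\<in>A. \<phi> (c i \<odot>\<^bsub>S\<^esub> e i))"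
    using c by (subst hom_finsum) (auto simp: comp_def)
  also have "\<dots> = lincomb Q A c (\<lambda>i. \<phi> (e i))"
    using c by (intro cod.M.finsum_cong' refl) (auto simp: phi_smult)
  finally show ?thesis .
qed

lemma ex_preimage_family:
  assumes "e \<in> A \<rightarrow> carrier Q"
  shows "\<exists>p. p \<in> A \<rightarrow> carrier S \<and> (\<forall>i\<in>A. \<phi> (p i) = e i)"
proof -
  have "\<forall>i\<in>A. \<exists>x. x \<in> carrier S \<and> \<phi> x = e i"
  proof
    fix i assume "i \<in> A"
    then have "e i \<in> \<phi> ` carrier S" unfolding surj using assms by auto
    then show "\<exists>x. x \<in> carrier S \<and> \<phi> x = e i" by auto
  qed
  from bchoice[OF this] show ?thesis by auto
qed

lemma finsum_cong_basis:
  assumes "\<And>i. i \<in> A \<Longrightarrow> \<phi> (p i) = e i" "c \<in> A \<rightarrow> carrier R" "e \<in> A \<rightarrow> carrier Q"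
  shows "lincomb Q A c (\<lambda>i. \<phi> (p i)) = lincomb Q A c e"
  using assms by (intro cod.M.finsum_cong' refl) (auto simp: Pi_iff)

text \<open>Since \<open>\<phi>\<close> is onto with kernel \<open>I\<close>, families in
  \<open>Q\<close> lift to \<open>S\<close> and equations in \<open>Q\<close> are congruences modulo
  \<open>I\<close>. Hence local freeness of \<open>Q\<close> is a property of the kernel.\<close>

lemma locally_free_iff: "locally_free_of_rank R Q d \<longleftrightarrow> locally_free_quotient R S I d"
proof -
  have *: "free_of_rank (localization R g (self_algebra R)) (localization R g Q) d \<longleftrightarrow>
     (\<exists>p \<in> {..<d} \<rightarrow> carrier S.
       generates_mod R S I g d p \<and>
       independent_mod R S I g d p)" (is "_ \<longleftrightarrow> ?rhs") if g: "g \<in> carrier R" for g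
  proof -
    interpret L: localized_module R Q g by unfold_locales (rule g)
    have up: "generates_mod R S I g d p \<longleftrightarrow>
          generates R Q g d e"
       "independent_mod R S I g d p \<longleftrightarrow>
        independent R Q g d e"
      if p: "p \<in> {..<d} \<rightarrow> carrier S" and e: "e \<in> {..<d} \<rightarrow> carrier Q" and pe: "\<forall>i\<in>{..<d}. \<phi> (p i) = e i" for p e
    proof -
      have cl: "lincomb S {..<d} c p \<in> carrier S" if "c \<in> {..<d} \<rightarrow> carrier R" for c
        using that p by (intro dom.M.finsum_closed) (auto simp: Pi_iff)
      have s: "\<phi> (lincomb S {..<d} c p) = lincomb Q {..<d} c e" if "c \<in> {..<d} \<rightarrow> carrier R" for c
        unfolding phi_sum[OF that p] by (rule finsum_cong_basis[OF bspec[OF pe] that e])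
      have iff: "((g [^] N) \<odot>\<^bsub>S\<^esub> q) \<ominus>\<^bsub>S\<^esub> lincomb S {..<d} c p \<in> I \<longleftrightarrow>
          (g [^] N) \<odot>\<^bsub>Q\<^esub> \<phi> q = lincomb Q {..<d} c e"
        if c: "c \<in> {..<d} \<rightarrow> carrier R" and q: "q \<in> carrier S" for c q and N :: nat
        using cl[OF c] q g by (subst phi_eq_iff) (auto simp: s[OF c] phi_smult)
      show "generates_mod R S I g d p \<longleftrightarrow>
          generates R Q g d e"
        unfolding surj[symmetric] ball_simps by (intro ball_cong refl ex_cong bex_cong iff) (auto simp: iff)
      show "independent_mod R S I g d p \<longleftrightarrow>
        independent R Q g d e"
        by (intro ball_cong refl imp_cong) (auto simp: kernel_iff s cl)
    qed
    show ?thesis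
      unfolding L.free_of_rank_localization_iff L.free_after_inverting_def
    proof
      assume "\<exists>e\<in>{..<d} \<rightarrow> carrier Q.
         generates R Q g d e \<and>
         independent R Q g d e"
      then obtain e where e: "e\<in>{..<d} \<rightarrow> carrier Q" and 1: "generates R Q g d e"
        and 2: "independent R Q g d e"
        by (elim bexE conjE)
      from ex_preimage_family[OF e] obtain p where p: "p \<in> {..<d} \<rightarrow> carrier S" and pe: "\<forall>i\<in>{..<d}. \<phi> (p i) = e i" by blast
      show ?rhs
        using iffD2[OF up(1)[OF p e pe] 1] iffD2[OF up(2)[OF p e pe] 2] p by (intro bexI[of _ p] conjI)
    next
      assume ?rhs
      then obtain p where p: "p\<in>{..<d} \<rightarrow> carrier S" and 1: "generates_mod R S I g d p"
        and 2: "independent_mod R S I g d p"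
        by (elim bexE conjE)
      have e: "(\<lambda>i. \<phi> (p i)) \<in> {..<d} \<rightarrow> carrier Q" using p by auto
      show "\<exists>e\<in>{..<d} \<rightarrow> carrier Q.
         generates R Q g d e \<and>
         independent R Q g d e"
        using iffD1[OF up(1)[OF p e] 1] iffD1[OF up(2)[OF p e] 2] e by (intro bexI[of _ "\<lambda>i. \<phi> (p i)"] conjI) simp_all
    qed
  qed
  show ?thesis
    unfolding locally_free_of_rank_def locally_free_quotient_def
    by (intro all_cong imp_cong refl bex_cong) (simp add: *)
qed

lemma image_eq_carrier_iff:
  assumes "W \<subseteq> carrier S"
  shows "\<phi> ` W = carrier Q \<longleftrightarrow> (\<forall>p\<in>carrier S. \<exists>w\<in>W. p \<ominus>\<^bsub>S\<^esub> w \<in> I)"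
proof -
  have "\<phi> ` W \<subseteq> carrier Q" using assms by auto
  then have "\<phi> ` W = carrier Q \<longleftrightarrow> \<phi> ` carrier S \<subseteq> \<phi> ` W" unfolding surj by blast
  also have "\<dots> \<longleftrightarrow> (\<forall>p\<in>carrier S. \<exists>w\<in>W. \<phi> p = \<phi> w)" by blast
  also have "\<dots> \<longleftrightarrow> (\<forall>p\<in>carrier S. \<exists>w\<in>W. p \<ominus>\<^bsub>S\<^esub> w \<in> I)"
    using assms phi_eq_iff by (auto simp: subset_iff)
  finally show ?thesis .
qed

end

lemma (in algebra) quotient_algebra_surjection:
  assumes "ideal I M"
  shows "algebra_surjection R M (quotient_algebra M I) ((+>\<^bsub>M\<^esub>) I) I"
proof -
  interpret Q: algebra R "quotient_algebra M I" by (rule quotient_algebra[OF assms])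
  show ?thesis
    by unfold_locales (simp_all add: quotient_algebra_hom quotient_algebra_surj quotient_algebra_kernel assms)
qed

lemma mpoly_ring_algebra: "cring B \<Longrightarrow> algebra B (mpoly_ring n B)"
  unfolding mpoly_ring_def
  by (intro monoid_algebra_over.algebra_RM monoid_algebra_over.intro comm_monoid_exponents)

lemma hilb_surjection_imp_algebra_surjection:
  assumes "cring B" "hilb_surjection n d B Q \<phi>"
  shows "algebra_surjection B (mpoly_ring n B) Q \<phi> (a_kernel (mpoly_ring n B) Q \<phi>)"
proof -
  interpret P: algebra B "mpoly_ring n B" by (rule mpoly_ring_algebra) fact
  interpret Q: algebra B Q using assms by (simp add: hilb_surjection_def)
  show ?thesis
    using assms by unfold_locales (auto simp: hilb_surjection_def)
qed

lemma algebra_surjection_imp_hilb_surjection: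
  assumes "algebra_surjection B (mpoly_ring n B) Q \<phi> I" "locally_free_quotient B (mpoly_ring n B) I d"
  shows "hilb_surjection n d B Q \<phi>"
proof -
  interpret algebra_surjection B "mpoly_ring n B" Q \<phi> I by fact
  show ?thesis
    unfolding hilb_surjection_def using hom surj assms(2) locally_free_iff cod.algebra_axioms by auto
qed

text \<open>Removes the existential over \<open>Q\<close>: a given \<open>Q\<close> is judged by its
  kernel, and an ideal is realized by its quotient algebra, whose cosets have exactly the element
  type prescribed for \<open>Q\<close>.\<close>

lemma Hilb_iff:
  fixes B :: "('k, 'b) module"
  assumes "cring B"
  shows "I \<in> fobj (Hilb n d) B \<longleftrightarrow>
    ideal I (mpoly_ring n B) \<and> locally_free_quotient B (mpoly_ring n B) I d"
proof
  assume "I \<in> fobj (Hilb n d) B"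
  then obtain Q :: "('b, ((nat \<Rightarrow> nat) \<Rightarrow> 'b) set) module" and \<phi>
    where h: "hilb_surjection n d B Q \<phi>" and I: "I = a_kernel (mpoly_ring n B) Q \<phi>"
    by (auto simp: Hilb_def)
  interpret algebra_surjection B "mpoly_ring n B" Q \<phi> I
    unfolding I by (rule hilb_surjection_imp_algebra_surjection[OF assms h])
  show "ideal I (mpoly_ring n B) \<and> locally_free_quotient B (mpoly_ring n B) I d"
    using ideal locally_free_iff h by (simp add: hilb_surjection_def)
next
  assume I: "ideal I (mpoly_ring n B) \<and> locally_free_quotient B (mpoly_ring n B) I d"
  interpret P: algebra B "mpoly_ring n B" by (rule mpoly_ring_algebra) fact
  have s: "algebra_surjection B (mpoly_ring n B) (quotient_algebra (mpoly_ring n B) I)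
      ((+>\<^bsub>mpoly_ring n B\<^esub>) I) I"
    using I by (intro P.quotient_algebra_surjection) simp
  from algebra_surjection_imp_hilb_surjection[OF s] I algebra_surjection.kernel[OF s]
  show "I \<in> fobj (Hilb n d) B"
    by (auto simp: Hilb_def intro!: exI[of _ "quotient_algebra (mpoly_ring n B) I"] exI[of _ "(+>\<^bsub>mpoly_ring n B\<^esub>) I"])
qed

text \<open>Surjectivity on the span of \<Delta> is again a condition on the kernel, so whichever
  representative is given for the point can be kept.\<close>

lemma Hilb_Delta_iff:
  fixes B :: "('k, 'b) module"
  assumes "cring B"
  shows "I \<in> fobj (Hilb_Delta n d \<Delta>) B \<longleftrightarrow> I \<in> fobj (Hilb n d) B \<and>
    (\<forall>p\<in>carrier (mpoly_ring n B). \<exists>w\<in>monomial_span n \<Delta> B. p \<ominus>\<^bsub>mpoly_ring n B\<^esub> w \<in> I)"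
proof -
  have sp: "monomial_span n \<Delta> B \<subseteq> carrier (mpoly_ring n B)" by (auto simp: monomial_span_def)
  have *: "\<phi> ` monomial_span n \<Delta> B = carrier Q \<longleftrightarrow>
     (\<forall>p\<in>carrier (mpoly_ring n B). \<exists>w\<in>monomial_span n \<Delta> B. p \<ominus>\<^bsub>mpoly_ring n B\<^esub> w \<in> a_kernel (mpoly_ring n B) Q \<phi>)"
    if h: "hilb_surjection n d B Q \<phi>" for \<phi> and Q :: "('b, ((nat \<Rightarrow> nat) \<Rightarrow> 'b) set) module"
  proof -
    interpret algebra_surjection B "mpoly_ring n B" Q \<phi> "a_kernel (mpoly_ring n B) Q \<phi>"
      by (rule hilb_surjection_imp_algebra_surjection[OF assms h])
    show ?thesis by (rule image_eq_carrier_iff[OF sp])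
  qed
  show ?thesis
    unfolding Hilb_def Hilb_Delta_def alg_functor.simps
  proof (intro iffI conjI)
    assume "I \<in> {a_kernel (mpoly_ring n B) Q \<phi> | (Q :: ('b, ((nat \<Rightarrow> nat) \<Rightarrow> 'b) set) module) \<phi>.
      hilb_surjection n d B Q \<phi> \<and> \<phi> ` monomial_span n \<Delta> B = carrier Q}"
    then obtain Q :: "('b, ((nat \<Rightarrow> nat) \<Rightarrow> 'b) set) module" and \<phi>
      where h: "hilb_surjection n d B Q \<phi>" and s: "\<phi> ` monomial_span n \<Delta> B = carrier Q"
      and I: "I = a_kernel (mpoly_ring n B) Q \<phi>" by (elim CollectE exE conjE)
    show "I \<in> {a_kernel (mpoly_ring n B) Q \<phi> | (Q :: ('b, ((nat \<Rightarrow> nat) \<Rightarrow> 'b) set) module) \<phi>.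
      hilb_surjection n d B Q \<phi>}" using h I by (intro CollectI exI conjI)
    show "\<forall>p\<in>carrier (mpoly_ring n B). \<exists>w\<in>monomial_span n \<Delta> B. p \<ominus>\<^bsub>mpoly_ring n B\<^esub> w \<in> I"
      using iffD1[OF *[OF h] s] unfolding I .
  next
    assume 1: "I \<in> {a_kernel (mpoly_ring n B) Q \<phi> | (Q :: ('b, ((nat \<Rightarrow> nat) \<Rightarrow> 'b) set) module) \<phi>.
        hilb_surjection n d B Q \<phi>} \<and>
      (\<forall>p\<in>carrier (mpoly_ring n B). \<exists>w\<in>monomial_span n \<Delta> B. p \<ominus>\<^bsub>mpoly_ring n B\<^esub> w \<in> I)"
    then obtain Q :: "('b, ((nat \<Rightarrow> nat) \<Rightarrow> 'b) set) module" and \<phi>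
      where h: "hilb_surjection n d B Q \<phi>"
      and I: "I = a_kernel (mpoly_ring n B) Q \<phi>" by (elim CollectE exE conjE)
    show "I \<in> {a_kernel (mpoly_ring n B) Q \<phi> | (Q :: ('b, ((nat \<Rightarrow> nat) \<Rightarrow> 'b) set) module) \<phi>.
      hilb_surjection n d B Q \<phi> \<and> \<phi> ` monomial_span n \<Delta> B = carrier Q}"
      using h I iffD2[OF *[OF h] conjunct2[OF 1, unfolded I]] by (intro CollectI exI conjI)
  qed
qed

section \<open>Base change of ideals\<close>

text \<open>The extended ideal of \<open>I\<close> along \<open>f\<close>, built from sums of scalar
  multiples of images of elements of \<open>I\<close>. Multiplication by monomials is left out to
  keep inductions simple; that the set is nevertheless an ideal is
  \<open>extension_ideal\<close>.\<close>

inductive_set extension ::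
    "('b \<Rightarrow> 'a) \<Rightarrow> ('a, 'x) ring_scheme \<Rightarrow> ('m, 'y) monoid_scheme \<Rightarrow> ('m \<Rightarrow> 'b) set \<Rightarrow> ('m \<Rightarrow> 'a) set"
  for f A M I where
  zero: "\<zero>\<^bsub>monoid_algebra A M\<^esub> \<in> extension f A M I"
| step: "p \<in> extension f A M I \<Longrightarrow> a \<in> carrier A \<Longrightarrow> u \<in> I \<Longrightarrow>
    p \<oplus>\<^bsub>monoid_algebra A M\<^esub> (a \<odot>\<^bsub>monoid_algebra A M\<^esub> (\<lambda>m. f (u m))) \<in> extension f A M I"

text \<open>Agrees with \<open>base_change_map\<close>, but for monomials from any monoid in place
  of exponent vectors.\<close>

definition monoid_base_change_map ::
    "('b \<Rightarrow> 'a) \<Rightarrow> ('b, 'x) ring_scheme \<Rightarrow> ('a, 'y) ring_scheme \<Rightarrow> ('b, 'q, 'z) module_scheme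
      \<Rightarrow> (('m \<Rightarrow> 'b) \<Rightarrow> 'q) \<Rightarrow> ('m \<Rightarrow> 'a) \<Rightarrow> ('a \<times> 'q \<Rightarrow> int) set" where
  "monoid_base_change_map f B A Q \<phi> p = finsum (tensor_ring f B A Q)
     (\<lambda>m. pure_tensor f B A Q (p m) (\<phi> (monomial B m))) (supp A p)"

lemma comm_monoid_DirProd:
  assumes "comm_monoid G" "comm_monoid H"
  shows "comm_monoid (G \<times>\<times> H)"
proof -
  interpret G: comm_monoid G by fact
  interpret H: comm_monoid H by fact
  show ?thesis
    by (rule comm_monoidI) (auto simp: G.m_ac H.m_ac)
qed

text \<open>The coefficient map needed to extend a multiplicative map on pairs in \<open>A\<close>
  and \<open>Q\<close> to the integral monoid algebra.\<close>

lemma (in ring) add_pow_one_hom: "(\<lambda>k::int. [k] \<cdot> \<one>) \<in> ring_hom \<Z> R"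
proof (rule ring_hom_memI)
  fix i j :: int
  have cl: "[k] \<cdot> \<one> \<in> carrier R" for k :: int by (rule add.int_pow_closed) simp
  then show "[i] \<cdot> \<one> \<in> carrier R" .
  show "[(i \<oplus>\<^bsub>\<Z>\<^esub> j)] \<cdot> \<one> = ([i] \<cdot> \<one>) \<oplus> ([j] \<cdot> \<one>)" by (simp add: add.int_pow_mult)
  have "([i] \<cdot> \<one>) \<otimes> ([j] \<cdot> \<one>) = [i] \<cdot> ([j] \<cdot> \<one>)"
    using cl by (subst add_pow_ldistr_int) simp_all
  also have "\<dots> = [(j * i)] \<cdot> \<one>" by (rule add.int_pow_pow) simp
  finally show "[(i \<otimes>\<^bsub>\<Z>\<^esub> j)] \<cdot> \<one> = ([i] \<cdot> \<one>) \<otimes> ([j] \<cdot> \<one>)" by (simp add: mult.commute)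
next
  show "[(\<one>\<^bsub>\<Z>\<^esub>)] \<cdot> \<one> = \<one>" using add.int_pow_1[of \<one>] by simp
qed

locale base_change = MB: monoid_algebra_over B M + MA: monoid_algebra_over A M
  for B :: "('b, 'x) ring_scheme" and A :: "('a, 'y) ring_scheme" (structure) and M :: "('m, 'w) monoid_scheme" +
  fixes f
  assumes f: "f \<in> ring_hom B A"
begin

sublocale f: ring_hom_cring B A f
  by unfold_locales (rule f)

abbreviation "BM \<equiv> monoid_algebra B M"
abbreviation "AM \<equiv> monoid_algebra A M"
abbreviation "push \<equiv> \<lambda>p m. f (p m)"
abbreviation "ext \<equiv> extension f A M"

lemma supp_push: "supp A (push p) \<subseteq> supp B p"
  using f.hom_zero by auto

lemma push_closed:
  assumes "p \<in> carrier BM"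
  shows "push p \<in> carrier AM"
  using MB.in_carrierD[OF assms] supp_push[of p] f.hom_zero assms
  by (auto simp: monoid_algebra_simps intro: finite_subset)

lemma push_smult: "b \<in> carrier B \<Longrightarrow> p \<in> carrier BM \<Longrightarrow> push (b \<odot>\<^bsub>BM\<^esub> p) = f b \<odot>\<^bsub>AM\<^esub> push p"
  by (auto simp: monoid_algebra_simps)

lemma push_monomial: "push (monomial B m) = monomial A m"
  by (auto simp: monomial_def fun_eq_iff)

lemma push_hom: "push \<in> ring_hom BM AM"
proof (rule ring_hom_memI)
  fix p q assume p: "p \<in> carrier BM" and q: "q \<in> carrier BM"
  show "push p \<in> carrier AM" by (rule push_closed[OF p])
  show "push (p \<oplus>\<^bsub>BM\<^esub> q) = push p \<oplus>\<^bsub>AM\<^esub> push q"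
    using p q by (auto simp: monoid_algebra_simps)
  show "push (p \<otimes>\<^bsub>BM\<^esub> q) = push p \<otimes>\<^bsub>AM\<^esub> push q"
  proof
    fix m
    note p' = MB.in_carrierD[OF p] and q' = MB.in_carrierD[OF q]
    have "push (p \<otimes>\<^bsub>BM\<^esub> q) m =
        finsum A (\<lambda>a. finsum A (\<lambda>b. if a \<otimes>\<^bsub>M\<^esub> b = m then f (p a) \<otimes> f (q b) else \<zero>) (supp B q)) (supp B p)"
      unfolding MB.mult_apply[OF p q p'(3,2) order_refl q'(3,2) order_refl] using p'(1) q'(1)
      by (subst f.hom_finsum) (auto intro!: MB.R.finsum_closed MA.R.finsum_cong' MA.R.finsum_closed
          simp: f.hom_finsum[unfolded comp_def] comp_def if_distrib[of f] cong: if_cong)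
    also have "\<dots> = (push p \<otimes>\<^bsub>AM\<^esub> push q) m"
      by (rule MA.mult_apply[OF push_closed[OF p] push_closed[OF q] p'(3,2) supp_push q'(3,2) supp_push, symmetric])
    finally show "push (p \<otimes>\<^bsub>BM\<^esub> q) m = (push p \<otimes>\<^bsub>AM\<^esub> push q) m" .
  qed
next
  show "push \<one>\<^bsub>BM\<^esub> = \<one>\<^bsub>AM\<^esub>"
    unfolding monoid_algebra_simps(2) by (rule push_monomial)
qed

sublocale push: ring_hom_cring BM AM push
  by unfold_locales (rule push_hom)

context
  fixes I assumes I: "ideal I BM"
begin

lemma extension_step_closed: "a \<in> carrier A \<Longrightarrow> u \<in> I \<Longrightarrow> a \<odot>\<^bsub>AM\<^esub> push u \<in> carrier AM"
  by (intro MA.smult_closed push_closed ideal.Icarr[OF I])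

lemma extension_carrier: "p \<in> ext I \<Longrightarrow> p \<in> carrier AM"
proof (induction rule: extension.induct)
  case zero
  then show ?case by simp
next
  case (step p a u)
  then show ?case using extension_step_closed by (intro MA.add_closed)
qed

lemma extension_add:
  assumes "q \<in> ext I" "p \<in> ext I"
  shows "p \<oplus>\<^bsub>AM\<^esub> q \<in> ext I"
  using assms(1)
proof (induction rule: extension.induct)
  case zero
  then show ?case using extension_carrier[OF assms(2)] assms(2) by simp
next
  case (step q a u)
  have "p \<oplus>\<^bsub>AM\<^esub> (q \<oplus>\<^bsub>AM\<^esub> (a \<odot>\<^bsub>AM\<^esub> push u)) = (p \<oplus>\<^bsub>AM\<^esub> q) \<oplus>\<^bsub>AM\<^esub> (a \<odot>\<^bsub>AM\<^esub> push u)"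
    using extension_carrier step extension_step_closed assms(2) by (intro MA.RM.M.a_assoc[symmetric]) auto
  then show ?case using extension.step[OF step.IH step.hyps(2,3)] by simp
qed

lemma extension_generator: "a \<in> carrier A \<Longrightarrow> u \<in> I \<Longrightarrow> a \<odot>\<^bsub>AM\<^esub> push u \<in> ext I"
  using extension.step[OF extension.zero[where f = f and A = A and M = M and I = I], of a u] extension_step_closed[of a u]
  by simp

lemma extension_push: "u \<in> I \<Longrightarrow> push u \<in> ext I"
  using extension_generator[of "\<one>" u] push_closed[OF ideal.Icarr[OF I]] by simp

text \<open>Expanding \<open>v\<close> reduces this to a single monomial. A monomial over
  \<open>A\<close> is the image of the same monomial over \<open>B\<close>, so it can be absorbed
  into \<open>u\<close> because \<open>I\<close> is an ideal of \<open>BM\<close>.\<close>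

lemma extension_mult_generator:
  assumes v: "v \<in> carrier AM" and a: "a \<in> carrier A" and u: "u \<in> I"
  shows "v \<otimes>\<^bsub>AM\<^esub> (a \<odot>\<^bsub>AM\<^esub> push u) \<in> ext I"
proof -
  note v' = MA.in_carrierD[OF v]
  have u': "u \<in> carrier BM" by (rule ideal.Icarr[OF I u])
  have finsum_ext: "finsum AM g S \<in> ext I" if "finite S" "\<And>s. s \<in> S \<Longrightarrow> g s \<in> ext I" for g and S :: "'m set"
    using that
  proof (induction S rule: finite_induct)
    case empty
    then show ?case by (simp add: extension.zero)
  next
    case (insert s S)
    then show ?case
      using extension_carrier by (subst MA.RM.M.finsum_insert) (auto intro!: extension_add)
  qed
  have "v \<otimes>\<^bsub>AM\<^esub> (a \<odot>\<^bsub>AM\<^esub> push u) = (\<Oplus>\<^bsub>AM\<^esub>m\<in>supp A v. v m \<odot>\<^bsub>AM\<^esub> monomial A m) \<otimes>\<^bsub>AM\<^esub> (a \<odot>\<^bsub>AM\<^esub> push u)"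
    by (simp only: MA.sum_of_monomials[OF v v'(3,2) order_refl, symmetric])
  also have "\<dots> = (\<Oplus>\<^bsub>AM\<^esub>m\<in>supp A v. (v m \<odot>\<^bsub>AM\<^esub> monomial A m) \<otimes>\<^bsub>AM\<^esub> (a \<odot>\<^bsub>AM\<^esub> push u))"
    using v' a u by (intro MA.RM.finsum_ldistr extension_step_closed) (auto intro!: MA.smult_closed)
  also have "\<dots> \<in> ext I"
  proof (rule finsum_ext)
    fix m assume m: "m \<in> supp A v"
    then have mM: "m \<in> carrier M" using v'(2) by blast
    have mu: "monomial B m \<otimes>\<^bsub>BM\<^esub> u \<in> I"
      using mM by (intro ideal.I_l_closed[OF I u]) simp
    have "(v m \<odot>\<^bsub>AM\<^esub> monomial A m) \<otimes>\<^bsub>AM\<^esub> (a \<odot>\<^bsub>AM\<^esub> push u) =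
        (v m \<otimes> a) \<odot>\<^bsub>AM\<^esub> (monomial A m \<otimes>\<^bsub>AM\<^esub> push u)"
      using v'(1) a mM push_closed[OF u'] MA.RM.smult_assoc2
      by (simp add: MA.RM.smult_assoc1 MA.RM.m_comm[of "monomial A m"])
    also have "monomial A m \<otimes>\<^bsub>AM\<^esub> push u = push (monomial B m \<otimes>\<^bsub>BM\<^esub> u)"
      using mM u' by (simp add: push_monomial)
    finally show "(v m \<odot>\<^bsub>AM\<^esub> monomial A m) \<otimes>\<^bsub>AM\<^esub> (a \<odot>\<^bsub>AM\<^esub> push u) \<in> ext I"
      using extension_generator[OF _ mu] v'(1) a by simp
  qed (rule v'(3))
  finally show ?thesis .
qed

lemma extension_mult:
  assumes "p \<in> ext I" and v: "v \<in> carrier AM"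
  shows "v \<otimes>\<^bsub>AM\<^esub> p \<in> ext I"
  using assms(1)
proof (induction rule: extension.induct)
  case zero
  then show ?case using v by (simp add: extension.zero)
next
  case (step p a u)
  have "v \<otimes>\<^bsub>AM\<^esub> (p \<oplus>\<^bsub>AM\<^esub> (a \<odot>\<^bsub>AM\<^esub> push u)) = v \<otimes>\<^bsub>AM\<^esub> p \<oplus>\<^bsub>AM\<^esub> v \<otimes>\<^bsub>AM\<^esub> (a \<odot>\<^bsub>AM\<^esub> push u)"
    using step v extension_carrier extension_step_closed by (intro MA.RM.r_distr) auto
  then show ?case
    using extension_add[OF extension_mult_generator[OF v step.hyps(2,3)] step.IH] by simp
qed

lemma extension_ideal: "ideal (ext I) AM"
proof (rule idealI)
  show "ring AM" by (rule cring.axioms(1)[OF MA.cring_RM])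
  show "subgroup (ext I) (add_monoid AM)"
  proof (rule group.subgroupI[OF MA.RM.M.a_group])
    show "ext I \<subseteq> carrier (add_monoid AM)" using extension_carrier by auto
    show "ext I \<noteq> {}" using extension.zero by blast
    fix p assume p: "p \<in> ext I"
    have "\<ominus>\<^bsub>AM\<^esub> p = (\<ominus>\<^bsub>AM\<^esub> \<one>\<^bsub>AM\<^esub>) \<otimes>\<^bsub>AM\<^esub> p"
      using extension_carrier[OF p] by (simp add: MA.RM.l_minus)
    then show "inv\<^bsub>add_monoid AM\<^esub> p \<in> ext I"
      using extension_mult[OF p, of "\<ominus>\<^bsub>AM\<^esub> \<one>\<^bsub>AM\<^esub>"] by (simp add: a_inv_def[symmetric])
  qed (auto intro: extension_add)
  fix p v assume p: "p \<in> ext I" and v: "v \<in> carrier AM"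
  show "v \<otimes>\<^bsub>AM\<^esub> p \<in> ext I" by (rule extension_mult[OF p v])
  then show "p \<otimes>\<^bsub>AM\<^esub> v \<in> ext I" using MA.RM.m_comm[OF v extension_carrier[OF p]] by simp
qed

text \<open>Only closure under addition and scalars from \<open>A\<close> is asked of
  \<open>J\<close>: later it is the set on which a linear coordinate function vanishes, which is a
  submodule but need not be an ideal.\<close>

lemma extension_minimal:
  assumes "J \<subseteq> carrier AM" "\<zero>\<^bsub>AM\<^esub> \<in> J" "\<And>p q. p \<in> J \<Longrightarrow> q \<in> J \<Longrightarrow> p \<oplus>\<^bsub>AM\<^esub> q \<in> J"
    and "\<And>a p. a \<in> carrier A \<Longrightarrow> p \<in> J \<Longrightarrow> a \<odot>\<^bsub>AM\<^esub> p \<in> J" "\<And>u. u \<in> I \<Longrightarrow> push u \<in> J"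
  shows "ext I \<subseteq> J"
proof
  fix p assume "p \<in> ext I"
  then show "p \<in> J" by (induction rule: extension.induct) (auto intro: assms)
qed

lemma extension_minimal_ideal:
  assumes J: "ideal J AM" and "\<And>u. u \<in> I \<Longrightarrow> push u \<in> J"
  shows "ext I \<subseteq> J"
proof (rule extension_minimal)
  interpret J: ideal J AM by fact
  show "J \<subseteq> carrier AM" "\<zero>\<^bsub>AM\<^esub> \<in> J" by (auto simp: J.a_subset)
  show "p \<oplus>\<^bsub>AM\<^esub> q \<in> J" if "p \<in> J" "q \<in> J" for p q using that by (rule J.a_closed)
  show "a \<odot>\<^bsub>AM\<^esub> p \<in> J" if "a \<in> carrier A" "p \<in> J" for a p
    using that by (rule MA.RM.ideal_smult_closed[OF J])
qed (rule assms)

end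

section \<open>The kernel of the base-changed surjection\<close>

context
  fixes Q :: "('b, 'q, 'z) module_scheme" and \<phi> I
  assumes surjection: "algebra_surjection B BM Q \<phi> I"
begin

interpretation \<phi>: algebra_surjection B BM Q \<phi> I by (rule surjection)

interpretation Z: monoid_algebra_over \<Z> "A \<times>\<times> Q"
  by (intro monoid_algebra_over.intro int_is_cring comm_monoid_DirProd
      MA.R.comm_monoid_axioms cring.axioms(2)[OF \<phi>.cod.M_cring])

abbreviation (input) "ZM \<equiv> monoid_algebra \<Z> (A \<times>\<times> Q)"
abbreviation (input) "gen_pair \<equiv> \<lambda>a q. monomial \<Z> (a, q)"

lemma tensor_relations_carrier: "tensor_relations f B A Q \<subseteq> carrier ZM"
  by (auto simp: tensor_relations_def Let_def intro!: Z.RM.M.minus_closed Z.add_closed Z.monomial_closed)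

lemma tensor_ideal_is_ideal: "ideal (tensor_ideal f B A Q) ZM"
  unfolding tensor_ideal_def by (rule Z.RM.genideal_ideal[OF tensor_relations_carrier])

interpretation T: ideal "tensor_ideal f B A Q" ZM by (rule tensor_ideal_is_ideal)
interpretation TR: cring "tensor_ring f B A Q"
  unfolding tensor_ring_def by (rule T.quotient_is_cring[OF Z.cring_RM])

abbreviation (input) "TR \<equiv> tensor_ring f B A Q"
abbreviation (input) "pt \<equiv> pure_tensor f B A Q"

lemma coset_hom: "(+>\<^bsub>ZM\<^esub>) (tensor_ideal f B A Q) \<in> ring_hom ZM TR"
  unfolding tensor_ring_def by (rule T.rcos_ring_hom)

lemma pure_tensor_closed: "a \<in> carrier A \<Longrightarrow> q \<in> carrier Q \<Longrightarrow> pt a q \<in> carrier TR"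
  unfolding pure_tensor_def by (rule ring_hom_closed[OF coset_hom]) simp

lemma coset_eq_of_relation:
  assumes "x \<ominus>\<^bsub>ZM\<^esub> y \<in> tensor_relations f B A Q" "x \<in> carrier ZM" "y \<in> carrier ZM"
  shows "tensor_ideal f B A Q +>\<^bsub>ZM\<^esub> x = tensor_ideal f B A Q +>\<^bsub>ZM\<^esub> y"
  using Z.RM.genideal_self[OF tensor_relations_carrier] assms
  by (subst ring.quotient_eq_iff_same_a_r_cos[OF cring.axioms(1)[OF Z.cring_RM] tensor_ideal_is_ideal, symmetric])
     (auto simp: tensor_ideal_def)

lemma pure_tensor_add_left:
  assumes "a \<in> carrier A" "a' \<in> carrier A" "q \<in> carrier Q"
  shows "pt (a \<oplus> a') q = pt a q \<oplus>\<^bsub>TR\<^esub> pt a' q"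
proof -
  have "pt (a \<oplus> a') q = tensor_ideal f B A Q +>\<^bsub>ZM\<^esub> (gen_pair a q \<oplus>\<^bsub>ZM\<^esub> gen_pair a' q)"
    unfolding pure_tensor_def
    using assms by (intro coset_eq_of_relation) (auto simp: tensor_relations_def Let_def intro!: Z.add_closed Z.monomial_closed)
  then show ?thesis
    unfolding pure_tensor_def using assms by (simp add: ring_hom_add[OF coset_hom])
qed

lemma pure_tensor_add_right:
  assumes "a \<in> carrier A" "q \<in> carrier Q" "q' \<in> carrier Q"
  shows "pt a (q \<oplus>\<^bsub>Q\<^esub> q') = pt a q \<oplus>\<^bsub>TR\<^esub> pt a q'"
proof -
  have "pt a (q \<oplus>\<^bsub>Q\<^esub> q') = tensor_ideal f B A Q +>\<^bsub>ZM\<^esub> (gen_pair a q \<oplus>\<^bsub>ZM\<^esub> gen_pair a q')"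
    unfolding pure_tensor_def
    using assms by (intro coset_eq_of_relation) (auto simp: tensor_relations_def Let_def intro!: Z.add_closed Z.monomial_closed)
  then show ?thesis
    unfolding pure_tensor_def using assms by (simp add: ring_hom_add[OF coset_hom])
qed

lemma pure_tensor_smult:
  assumes "a \<in> carrier A" "b \<in> carrier B" "q \<in> carrier Q"
  shows "pt (f b \<otimes> a) q = pt a (b \<odot>\<^bsub>Q\<^esub> q)"
  unfolding pure_tensor_def
  using assms by (intro coset_eq_of_relation) (auto simp: tensor_relations_def Let_def intro!: Z.monomial_closed)

lemma pure_tensor_zero_left: "q \<in> carrier Q \<Longrightarrow> pt \<zero> q = \<zero>\<^bsub>TR\<^esub>"
  using pure_tensor_add_left[of "\<zero>" "\<zero>" q] pure_tensor_closed[of "\<zero>" q]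
  by simp

lemma pure_tensor_zero_right: "a \<in> carrier A \<Longrightarrow> pt a \<zero>\<^bsub>Q\<^esub> = \<zero>\<^bsub>TR\<^esub>"
  using pure_tensor_add_right[of a "\<zero>\<^bsub>Q\<^esub>" "\<zero>\<^bsub>Q\<^esub>"] pure_tensor_closed[of a "\<zero>\<^bsub>Q\<^esub>"]
  by simp

abbreviation (input) "tensor_map \<equiv> monoid_base_change_map f B A Q \<phi>"
lemmas tensor_map_def = monoid_base_change_map_def

lemma phi_monomial: "m \<in> carrier M \<Longrightarrow> \<phi> (monomial B m) \<in> carrier Q"
  by simp

lemma tensor_map_superset:
  assumes "p \<in> carrier AM" "finite F" "F \<subseteq> carrier M" "supp A p \<subseteq> F"
  shows "tensor_map p = finsum TR (\<lambda>m. pt (p m) (\<phi> (monomial B m))) F"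
  unfolding tensor_map_def using assms MA.in_carrierD[OF assms(1)]
  by (intro TR.finsum_superset)
    (auto intro!: pure_tensor_closed pure_tensor_zero_left phi_monomial)

lemma tensor_map_add:
  assumes p: "p \<in> carrier AM" and q: "q \<in> carrier AM"
  shows "tensor_map (p \<oplus>\<^bsub>AM\<^esub> q) = tensor_map p \<oplus>\<^bsub>TR\<^esub> tensor_map q"
proof -
  let ?F = "supp A p \<union> supp A q"
  note p' = MA.in_carrierD[OF p] and q' = MA.in_carrierD[OF q]
  have F: "finite ?F" "?F \<subseteq> carrier M" using p' q' by auto
  have s: "supp A (p \<oplus>\<^bsub>AM\<^esub> q) \<subseteq> ?F"
    using p by (auto simp: monoid_algebra_simps)
  have "m \<in> carrier M" if "m \<in> ?F" for m using that F by blast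
  note mem = phi_monomial[OF this]
  have "tensor_map (p \<oplus>\<^bsub>AM\<^esub> q) = finsum TR (\<lambda>m. pt (p m) (\<phi> (monomial B m)) \<oplus>\<^bsub>TR\<^esub> pt (q m) (\<phi> (monomial B m))) ?F"
    unfolding tensor_map_superset[OF MA.add_closed[OF p q] F s]
    unfolding monoid_algebra_simps(4) using mem p'(1) q'(1)
    by (intro TR.finsum_cong' refl) (simp_all add: Pi_iff pure_tensor_closed pure_tensor_add_left)
  also have "\<dots> = finsum TR (\<lambda>m. pt (p m) (\<phi> (monomial B m))) ?F \<oplus>\<^bsub>TR\<^esub> finsum TR (\<lambda>m. pt (q m) (\<phi> (monomial B m))) ?F"
    using mem p'(1) q'(1) by (intro TR.finsum_addf) (auto intro!: pure_tensor_closed)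
  finally show ?thesis
    using tensor_map_superset[OF p F] tensor_map_superset[OF q F] by simp
qed

lemma phi_as_sum:
  assumes u: "u \<in> carrier BM"
  shows "\<phi> u = (\<Oplus>\<^bsub>Q\<^esub>m\<in>supp B u. u m \<odot>\<^bsub>Q\<^esub> \<phi> (monomial B m))"
proof -
  note u' = MB.in_carrierD[OF u]
  have "\<phi> u = \<phi> (\<Oplus>\<^bsub>BM\<^esub>m\<in>supp B u. u m \<odot>\<^bsub>BM\<^esub> monomial B m)"
    by (simp only: MB.sum_of_monomials[OF u u'(3,2) order_refl, symmetric])
  also have "\<dots> = (\<Oplus>\<^bsub>Q\<^esub>m\<in>supp B u. u m \<odot>\<^bsub>Q\<^esub> \<phi> (monomial B m))"
    using u' by (intro \<phi>.phi_sum) auto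
  finally show ?thesis .
qed

text \<open>Balancedness moves every coefficient of \<open>u\<close> to the right of the tensor
  sign, where additivity collects the terms into \<open>\<phi> u\<close>.\<close>

lemma tensor_map_generator:
  assumes a: "a \<in> carrier A" and u: "u \<in> carrier BM"
  shows "tensor_map (a \<odot>\<^bsub>AM\<^esub> push u) = pt a (\<phi> u)"
proof -
  note u' = MB.in_carrierD[OF u]
  have cl: "a \<odot>\<^bsub>AM\<^esub> push u \<in> carrier AM" by (intro MA.smult_closed push_closed a u)
  have s: "supp A (a \<odot>\<^bsub>AM\<^esub> push u) \<subseteq> supp B u"
    using a by (auto simp: monoid_algebra_simps)
  have mem: "\<phi> (monomial B m) \<in> carrier Q" if "m \<in> supp B u" for m
    using that u'(2) by (intro phi_monomial) blast
  have "tensor_map (a \<odot>\<^bsub>AM\<^esub> push u) = finsum TR (\<lambda>m. pt a (u m \<odot>\<^bsub>Q\<^esub> \<phi> (monomial B m))) (supp B u)"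
    unfolding tensor_map_superset[OF cl u'(3,2) s]
    unfolding monoid_algebra_simps(5) using u'(1) a mem pure_tensor_smult[OF a]
    by (intro TR.finsum_cong' refl) (auto intro!: pure_tensor_closed simp: MA.R.m_comm[OF a])
  also have "\<dots> = pt a (\<Oplus>\<^bsub>Q\<^esub>m\<in>supp B u. u m \<odot>\<^bsub>Q\<^esub> \<phi> (monomial B m))"
    using mem u'(1) a
    by (intro finsum_hom[symmetric, where h = "pt a"] \<phi>.cod.M.abelian_monoid_axioms TR.abelian_monoid_axioms)
       (simp_all add: Pi_iff pure_tensor_closed pure_tensor_add_right pure_tensor_zero_right)
  finally show ?thesis unfolding phi_as_sum[OF u] .
qed

text \<open>A generator goes to the tensor of \<open>a\<close> with \<open>\<phi> u\<close>, and
  \<open>\<phi> u\<close> is zero for \<open>u\<close> in the kernel.\<close>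

lemma extension_in_kernel:
  assumes "p \<in> ext I"
  shows "tensor_map p = \<zero>\<^bsub>TR\<^esub>"
  using assms
proof (induction rule: extension.induct)
  case zero
  then show ?case by (simp add: tensor_map_def monoid_algebra_simps(3))
next
  case (step p a u)
  have u: "u \<in> carrier BM" and 0: "\<phi> u = \<zero>\<^bsub>Q\<^esub>" using step.hyps \<phi>.kernel_iff by auto
  have "a \<odot>\<^bsub>AM\<^esub> push u \<in> carrier AM" by (intro MA.smult_closed push_closed step.hyps u)
  then have "tensor_map (p \<oplus>\<^bsub>AM\<^esub> (a \<odot>\<^bsub>AM\<^esub> push u)) = tensor_map p \<oplus>\<^bsub>TR\<^esub> tensor_map (a \<odot>\<^bsub>AM\<^esub> push u)"
    using extension_carrier[OF \<phi>.ideal] step.hyps by (intro tensor_map_add) auto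
  also have "\<dots> = \<zero>\<^bsub>TR\<^esub>"
    using step tensor_map_generator[OF step.hyps(2) u] by (simp add: 0 pure_tensor_zero_right)
  finally show ?case .
qed

text \<open>A section of \<open>\<phi>\<close> turns \<open>(a, q)\<close> into a class in \<open>A[M] / ext I\<close>; this extends to a ring
  homomorphism whose kernel contains the tensor relations.\<close>

lemma kernel_in_extension:
  assumes p: "p \<in> carrier AM" and 0: "tensor_map p = \<zero>\<^bsub>TR\<^esub>"
  shows "p \<in> ext I"
proof -
  note extI = extension_ideal[OF \<phi>.ideal]
  interpret J: ideal "ext I" AM by (rule extI)
  interpret W: cring "AM Quot ext I" by (rule J.quotient_is_cring[OF MA.cring_RM])
  let ?W = "AM Quot ext I"
  define cls where "cls = (+>\<^bsub>AM\<^esub>) (ext I)"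
  interpret cls: ring_hom_cring AM ?W cls
    unfolding cls_def by (rule J.rcos_ring_hom_cring[OF MA.cring_RM])
  have cls_eq: "cls x = cls y \<longleftrightarrow> x \<ominus>\<^bsub>AM\<^esub> y \<in> ext I" if "x \<in> carrier AM" "y \<in> carrier AM" for x y
    unfolding cls_def using ring.quotient_eq_iff_same_a_r_cos[OF cring.axioms(1)[OF MA.cring_RM] extI that] by simp
  have "\<exists>s. s \<in> carrier Q \<rightarrow> carrier BM \<and> (\<forall>q\<in>carrier Q. \<phi> (s q) = q)"
    using \<phi>.ex_preimage_family[of "\<lambda>q. q" "carrier Q"] by auto
  then obtain s where s: "\<And>q. q \<in> carrier Q \<Longrightarrow> s q \<in> carrier BM" "\<And>q. q \<in> carrier Q \<Longrightarrow> \<phi> (s q) = q"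
    by auto
  define h where "h = (\<lambda>(a, q). cls (a \<odot>\<^bsub>AM\<^esub> push (s q)))"
  have cl: "a \<odot>\<^bsub>AM\<^esub> push u \<in> carrier AM" if "a \<in> carrier A" "u \<in> carrier BM" for a u
    using that by (intro MA.smult_closed push_closed)
  \<comment> \<open>The section \<open>s\<close> is a mere choice of preimages, neither additive nor
    multiplicative. Two preimages of \<open>q\<close> differ by an element of \<open>I\<close>,
    whose image lies in \<open>ext I\<close>, so any preimage may replace \<open>s q\<close>. This
    makes \<open>h\<close> multiplicative, and additive and balanced in \<open>q\<close>.\<close>
  have h_eq: "h (a, q) = cls (a \<odot>\<^bsub>AM\<^esub> push u)" if a: "a \<in> carrier A" and u: "u \<in> carrier BM" and q: "\<phi> u = q" for a u q
  proof -
    have qQ: "q \<in> carrier Q" using q u by auto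
    have d: "s q \<ominus>\<^bsub>BM\<^esub> u \<in> I" using \<phi>.phi_eq_iff[of "s q" u] s[OF qQ] u q by simp
    have "(a \<odot>\<^bsub>AM\<^esub> push (s q)) \<ominus>\<^bsub>AM\<^esub> (a \<odot>\<^bsub>AM\<^esub> push u) = a \<odot>\<^bsub>AM\<^esub> push (s q \<ominus>\<^bsub>BM\<^esub> u)"
    proof -
      have "push (s q \<ominus>\<^bsub>BM\<^esub> u) = push (s q) \<oplus>\<^bsub>AM\<^esub> \<ominus>\<^bsub>AM\<^esub> push u"
        using s[OF qQ] u push.hom_add[of "s q" "\<ominus>\<^bsub>BM\<^esub> u"] push.hom_a_inv[of u] by (simp only: MB.RM.M.minus_eq MB.RM.M.a_inv_closed)
      then show ?thesis
        using s[OF qQ] u a push_closed[of u] push_closed[of "s q"]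
        by (simp only: MA.RM.M.minus_eq MA.RM.smult_r_distr MA.RM.smult_r_minus MA.RM.M.a_inv_closed)
    qed
    then have "(a \<odot>\<^bsub>AM\<^esub> push (s q)) \<ominus>\<^bsub>AM\<^esub> (a \<odot>\<^bsub>AM\<^esub> push u) \<in> ext I"
      using extension_generator[OF \<phi>.ideal a d] by simp
    then show ?thesis
      unfolding h_def using cls_eq[OF cl[OF a s(1)[OF qQ]] cl[OF a u]] by simp
  qed
  have hcl: "h (a, q) \<in> carrier ?W" if "a \<in> carrier A" "q \<in> carrier Q" for a q
    unfolding h_def using cl[OF that(1) s(1)[OF that(2)]] by simp
  define c where "c = (\<lambda>k::int. add_pow ?W k \<one>\<^bsub>?W\<^esub>)"
  have c: "c \<in> ring_hom \<Z> ?W" unfolding c_def by (rule W.add_pow_one_hom)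
  define \<Theta> where "\<Theta> = linear_extension \<Z> ?W c h"
  have h: "h \<in> carrier (A \<times>\<times> Q) \<rightarrow> carrier ?W" using hcl by auto
  have "\<Theta> \<in> ring_hom ZM ?W"
    unfolding \<Theta>_def
  proof (rule Z.linear_extension_ring_hom[OF W.cring_axioms c h])
    have "\<one> \<odot>\<^bsub>AM\<^esub> push \<one>\<^bsub>BM\<^esub> = \<one>\<^bsub>AM\<^esub>" by simp
    then show "h \<one>\<^bsub>A \<times>\<times> Q\<^esub> = \<one>\<^bsub>?W\<^esub>"
      using h_eq[of "\<one>" "\<one>\<^bsub>BM\<^esub>" "\<one>\<^bsub>Q\<^esub>"] by simp
    fix x y assume x: "x \<in> carrier (A \<times>\<times> Q)" and y: "y \<in> carrier (A \<times>\<times> Q)"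
    obtain a q where aq: "x = (a, q)" "a \<in> carrier A" "q \<in> carrier Q" using x by auto
    obtain a' q' where aq': "y = (a', q')" "a' \<in> carrier A" "q' \<in> carrier Q" using y by auto
    have "h (a \<otimes> a', q \<otimes>\<^bsub>Q\<^esub> q') = cls ((a \<otimes> a') \<odot>\<^bsub>AM\<^esub> push (s q \<otimes>\<^bsub>BM\<^esub> s q'))"
      using aq aq' s by (intro h_eq) auto
    also have "(a \<otimes> a') \<odot>\<^bsub>AM\<^esub> push (s q \<otimes>\<^bsub>BM\<^esub> s q') = (a \<odot>\<^bsub>AM\<^esub> push (s q)) \<otimes>\<^bsub>AM\<^esub> (a' \<odot>\<^bsub>AM\<^esub> push (s q'))"
    proof -
      have 1: "push (s q) \<in> carrier AM" "push (s q') \<in> carrier AM" using aq aq' s push_closed by blast+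
      have "(a \<odot>\<^bsub>AM\<^esub> push (s q)) \<otimes>\<^bsub>AM\<^esub> (a' \<odot>\<^bsub>AM\<^esub> push (s q')) = a \<odot>\<^bsub>AM\<^esub> (a' \<odot>\<^bsub>AM\<^esub> (push (s q) \<otimes>\<^bsub>AM\<^esub> push (s q')))"
        using 1 aq(2) aq'(2) MA.RM.smult_assoc2[of a' "push (s q')" "push (s q)"]
        by (simp add: MA.RM.smult_assoc2 MA.RM.m_comm[of "push (s q)"])
      then show ?thesis
        using 1 aq(2,3) aq'(2,3) s(1) by (simp add: MA.RM.smult_assoc1)
    qed
    also have "cls \<dots> = h (a, q) \<otimes>\<^bsub>?W\<^esub> h (a', q')"
      unfolding h_def using cl aq aq' s by simp
    finally show "h (x \<otimes>\<^bsub>A \<times>\<times> Q\<^esub> y) = h x \<otimes>\<^bsub>?W\<^esub> h y" by (simp add: aq aq')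
  qed
  interpret \<Theta>: ring_hom_cring ZM ?W \<Theta>
    by unfold_locales fact
  have \<Theta>e: "\<Theta> (gen_pair a q) = h (a, q)" if "a \<in> carrier A" "q \<in> carrier Q" for a q
    unfolding \<Theta>_def using that by (intro Z.linear_extension_monomial[OF W.cring_axioms c h]) simp
  have ker: "ideal (a_kernel ZM ?W \<Theta>) ZM"
    by (rule ring_hom_ring.kernel_is_ideal[OF ring_hom_ringI2[OF cring.axioms(1)[OF Z.cring_RM] W.ring_axioms \<Theta>.homh]])
  have \<Theta>_minus: "x \<ominus>\<^bsub>ZM\<^esub> y \<in> a_kernel ZM ?W \<Theta>" if "x \<in> carrier ZM" "y \<in> carrier ZM" "\<Theta> x = \<Theta> y" for x y
    unfolding a_kernel_def' using that by (simp add: Z.RM.M.minus_eq W.r_neg)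
  have rel: "tensor_relations f B A Q \<subseteq> a_kernel ZM ?W \<Theta>"
  proof
    fix z assume "z \<in> tensor_relations f B A Q"
    then consider (1) a a' q where "z = gen_pair (a \<oplus> a') q \<ominus>\<^bsub>ZM\<^esub> (gen_pair a q \<oplus>\<^bsub>ZM\<^esub> gen_pair a' q)"
        "a \<in> carrier A" "a' \<in> carrier A" "q \<in> carrier Q"
      | (2) a q q' where "z = gen_pair a (q \<oplus>\<^bsub>Q\<^esub> q') \<ominus>\<^bsub>ZM\<^esub> (gen_pair a q \<oplus>\<^bsub>ZM\<^esub> gen_pair a q')"
        "a \<in> carrier A" "q \<in> carrier Q" "q' \<in> carrier Q"
      | (3) a b q where "z = gen_pair (f b \<otimes> a) q \<ominus>\<^bsub>ZM\<^esub> gen_pair a (b \<odot>\<^bsub>Q\<^esub> q)"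
        "a \<in> carrier A" "b \<in> carrier B" "q \<in> carrier Q"
      unfolding tensor_relations_def Let_def by auto
    then show "z \<in> a_kernel ZM ?W \<Theta>"
    proof cases
      case 1
      have "h (a \<oplus> a', q) = h (a, q) \<oplus>\<^bsub>?W\<^esub> h (a', q)"
        unfolding h_def using 1 cl s push_closed[OF s(1)] by (simp add: MA.RM.smult_l_distr)
      then show ?thesis
        unfolding 1(1) using 1 by (intro \<Theta>_minus) (auto simp: \<Theta>e intro!: Z.add_closed Z.monomial_closed)
    next
      case 2
      have "h (a, q \<oplus>\<^bsub>Q\<^esub> q') = cls (a \<odot>\<^bsub>AM\<^esub> push (s q \<oplus>\<^bsub>BM\<^esub> s q'))"
        using 2 s by (intro h_eq) auto
      also have "\<dots> = h (a, q) \<oplus>\<^bsub>?W\<^esub> h (a, q')"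
        unfolding h_def using 2 cl s push_closed[OF s(1)] by (simp add: MA.RM.smult_r_distr)
      finally show ?thesis
        unfolding 2(1) using 2 by (intro \<Theta>_minus) (auto simp: \<Theta>e intro!: Z.add_closed Z.monomial_closed)
    next
      case 3
      have "h (a, b \<odot>\<^bsub>Q\<^esub> q) = cls (a \<odot>\<^bsub>AM\<^esub> push (b \<odot>\<^bsub>BM\<^esub> s q))"
        using 3 s by (intro h_eq) (auto simp: \<phi>.phi_smult intro!: MB.smult_closed)
      also have "a \<odot>\<^bsub>AM\<^esub> push (b \<odot>\<^bsub>BM\<^esub> s q) = (f b \<otimes> a) \<odot>\<^bsub>AM\<^esub> push (s q)"
        using 3 s push_closed[OF s(1)] by (simp add: push_smult MA.RM.smult_assoc1[symmetric] MA.R.m_comm)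
      also have "cls \<dots> = h (f b \<otimes> a, q)" by (simp add: h_def)
      finally show ?thesis
        unfolding 3(1) using 3 by (intro \<Theta>_minus) (auto simp: \<Theta>e intro!: Z.monomial_closed)
    qed
  qed
  have T_ker: "tensor_ideal f B A Q \<subseteq> a_kernel ZM ?W \<Theta>"
    unfolding tensor_ideal_def by (rule Z.RM.genideal_minimal[OF ker rel])
  note p' = MA.in_carrierD[OF p]
  have mem: "\<phi> (monomial B m) \<in> carrier Q" "m \<in> carrier M" if "m \<in> supp A p" for m
    using that p'(2) phi_monomial by blast+
  \<comment> \<open>An explicit lift of \<open>tensor_map p\<close> to the integral monoid algebra.
    It lies in \<open>tensor_ideal\<close>, so \<open>\<Theta>\<close> kills it; on the other hand
    \<open>\<Theta> z\<close> is the class of \<open>p\<close>.\<close>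
  define z where "z = (\<Oplus>\<^bsub>ZM\<^esub>m\<in>supp A p. gen_pair (p m) (\<phi> (monomial B m)))"
  have zc: "(\<lambda>m. gen_pair (p m) (\<phi> (monomial B m))) \<in> supp A p \<rightarrow> carrier ZM"
    using mem p'(1) by (intro funcsetI Z.monomial_closed) auto
  have z: "z \<in> carrier ZM" unfolding z_def by (rule Z.RM.M.finsum_closed[OF zc])
  interpret \<rho>: ring_hom_cring ZM TR "(+>\<^bsub>ZM\<^esub>) (tensor_ideal f B A Q)"
    by unfold_locales (rule coset_hom)
  have "tensor_map p = tensor_ideal f B A Q +>\<^bsub>ZM\<^esub> z"
    unfolding z_def tensor_map_def pure_tensor_def by (subst \<rho>.hom_finsum[OF zc]) (simp add: comp_def)
  moreover have "\<zero>\<^bsub>TR\<^esub> = tensor_ideal f B A Q"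
    by (simp only: tensor_ring_def FactRing_def ring.simps)
  ultimately have "tensor_ideal f B A Q +>\<^bsub>ZM\<^esub> z = tensor_ideal f B A Q"
    using 0 by metis
  from subsetD[OF T_ker T.rcos_const_imp_mem[OF z this]] have "\<Theta> z = \<zero>\<^bsub>?W\<^esub>"
    unfolding a_kernel_def' mem_Collect_eq by (rule conjunct2)
  moreover have "\<Theta> z = finsum ?W (\<lambda>m. cls (p m \<odot>\<^bsub>AM\<^esub> monomial A m)) (supp A p)"
    unfolding z_def
  proof (subst \<Theta>.hom_finsum[OF zc], rule W.finsum_cong'[OF refl])
    show "(\<lambda>m. cls (p m \<odot>\<^bsub>AM\<^esub> monomial A m)) \<in> supp A p \<rightarrow> carrier ?W"
      using mem p'(1) by (auto intro!: cls.hom_closed MA.smult_closed)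
    fix m assume m: "m \<in> supp A p"
    have "h (p m, \<phi> (monomial B m)) = cls (p m \<odot>\<^bsub>AM\<^esub> push (monomial B m))"
      using p'(1) mem[OF m] by (intro h_eq) auto
    then show "(\<Theta> \<circ> (\<lambda>m. gen_pair (p m) (\<phi> (monomial B m)))) m = cls (p m \<odot>\<^bsub>AM\<^esub> monomial A m)"
      using p'(1) mem[OF m] by (simp add: \<Theta>e push_monomial)
  qed
  moreover have "\<dots> = cls (\<Oplus>\<^bsub>AM\<^esub>m\<in>supp A p. p m \<odot>\<^bsub>AM\<^esub> monomial A m)"
    using mem p'(1) by (subst cls.hom_finsum) (auto intro!: MA.smult_closed simp: comp_def)
  moreover have "\<dots> = cls p"
    by (simp only: MA.sum_of_monomials[OF p p'(3,2) order_refl, symmetric])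
  moreover have "\<zero>\<^bsub>?W\<^esub> = ext I" by (simp only: FactRing_def ring.simps)
  ultimately have "cls p = ext I" by metis
  then show ?thesis unfolding cls_def by (rule J.rcos_const_imp_mem[OF p])
qed

lemma tensor_map_kernel: "a_kernel AM TR tensor_map = ext I"
  unfolding a_kernel_def' using kernel_in_extension extension_in_kernel extension_carrier[OF \<phi>.ideal] by auto

end

end

section \<open>Prime ideals and submodules\<close>

lemma (in cring) exists_prime_above:
  assumes I: "ideal I R" and one: "\<one> \<notin> I"
  shows "\<exists>P. primeideal P R \<and> I \<subseteq> P"
proof -
  let ?S = "{J. ideal J R \<and> I \<subseteq> J \<and> \<one> \<notin> J}"
  have "\<exists>M\<in>?S. \<forall>X\<in>?S. M \<subseteq> X \<longrightarrow> X = M"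
  proof (rule subset_Zorn)
    fix C assume C: "subset.chain ?S C"
    show "\<exists>U\<in>?S. \<forall>X\<in>C. X \<subseteq> U"
    proof (cases "C = {}")
      case True
      then show ?thesis using assms by blast
    next
      case False
      have "subset.chain {J. ideal J R} C" using C unfolding pred_on.chain_def by blast
      from chain_Union_is_ideal[OF this] False have "ideal (\<Union>C) R" by simp
      moreover have "I \<subseteq> \<Union>C" "\<one> \<notin> \<Union>C" using C False unfolding pred_on.chain_def by blast+
      ultimately show ?thesis by blast
    qed
  qed
  then obtain P where PS: "P \<in> ?S" and max: "\<forall>X\<in>?S. P \<subseteq> X \<longrightarrow> X = P"
    by (elim bexE)
  then have P: "ideal P R" "I \<subseteq> P" "\<one> \<notin> P" by simp_all
  have "maximalideal P R"
  proof (rule maximalidealI[OF P(1)])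
    show "carrier R \<noteq> P" using P(3) by auto
    fix J assume J: "ideal J R" "P \<subseteq> J" "J \<subseteq> carrier R"
    show "J = P \<or> J = carrier R"
    proof (cases "\<one> \<in> J")
      case True
      then show ?thesis using ideal.one_imp_carrier[OF J(1)] by simp
    next
      case False
      then have "J \<in> ?S" using J P(2) by simp
      then show ?thesis using bspec[OF max] J(2) by simp
    qed
  qed
  then show ?thesis using maximalideal_prime P(2) by blast
qed

lemma (in primeideal) pow_mem:
  assumes "a \<in> carrier R" "a [^] (n::nat) \<in> I"
  shows "a \<in> I"
  using assms(2)
proof (induction n)
  case 0
  then have "\<one> \<in> I" by simp
  then show ?case using one_imp_carrier I_notcarr by auto
next
  case (Suc n)
  then show ?case using I_prime[of "a [^] n" a] assms(1) by auto
qed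

lemma (in abelian_group) minus_zero_right: "x \<in> carrier G \<Longrightarrow> x \<ominus> \<zero> = x"
  using minus_equality[of \<zero> \<zero>] by (simp add: minus_eq)

context Module.module
begin

lemma submoduleI':
  assumes "H \<subseteq> carrier M" "\<zero>\<^bsub>M\<^esub> \<in> H" "\<And>x y. x \<in> H \<Longrightarrow> y \<in> H \<Longrightarrow> x \<oplus>\<^bsub>M\<^esub> y \<in> H"
    and "\<And>a x. a \<in> carrier R \<Longrightarrow> x \<in> H \<Longrightarrow> a \<odot>\<^bsub>M\<^esub> x \<in> H"
  shows "submodule H R M"
proof (rule submoduleI)
  fix x assume x: "x \<in> H"
  have "(\<ominus> \<one>) \<odot>\<^bsub>M\<^esub> x \<in> H" using x by (intro assms) simp
  then show "\<ominus>\<^bsub>M\<^esub> x \<in> H" using x assms(1) by (subst (asm) smult_l_minus) auto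
qed (use assms in auto)

context
  fixes H assumes H: "submodule H R M"
begin

lemma submodule_zero: "\<zero>\<^bsub>M\<^esub> \<in> H"
  using subgroup.one_closed[OF submodule.axioms(1)[OF H]] by simp

lemma submodule_carrier: "x \<in> H \<Longrightarrow> x \<in> carrier M"
  using submoduleE(1)[OF H] by blast

lemma submodule_add: "x \<in> H \<Longrightarrow> y \<in> H \<Longrightarrow> x \<oplus>\<^bsub>M\<^esub> y \<in> H"
  by (rule submoduleE(5)[OF H])

lemma submodule_smult: "a \<in> carrier R \<Longrightarrow> x \<in> H \<Longrightarrow> a \<odot>\<^bsub>M\<^esub> x \<in> H"
  by (rule submoduleE(4)[OF H])

lemma submodule_minus: "x \<in> H \<Longrightarrow> y \<in> H \<Longrightarrow> x \<ominus>\<^bsub>M\<^esub> y \<in> H"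
  using submoduleE(3)[OF H] submodule_add by (simp add: M.minus_eq)

lemma submodule_finsum:
  assumes "\<And>s. s \<in> S \<Longrightarrow> g s \<in> H"
  shows "finsum M g S \<in> H"
proof (cases "finite S")
  case True
  then show ?thesis using assms
  proof (induction S rule: finite_induct)
    case empty
    then show ?case by (simp add: submodule_zero)
  next
    case (insert s S)
    then show ?case
      by (subst M.finsum_insert) (auto intro: submodule_add submodule_carrier)
  qed
qed (simp add: M.finsum_infinite submodule_zero)

lemma submodule_minus_cancel:
  assumes "x \<in> carrier M" "y \<in> H" "x \<ominus>\<^bsub>M\<^esub> y \<in> H"
  shows "x \<in> H"
proof -
  have "x = (x \<ominus>\<^bsub>M\<^esub> y) \<oplus>\<^bsub>M\<^esub> y"
    using assms submodule_carrier[of y] by (simp add: M.minus_eq M.a_assoc M.l_neg)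
  then show ?thesis using submodule_add[OF assms(3,2)] by simp
qed

lemma submodule_minus_cancel':
  assumes "y \<in> carrier M" "x \<in> H" "x \<ominus>\<^bsub>M\<^esub> y \<in> H"
  shows "y \<in> H"
proof -
  have "y = x \<ominus>\<^bsub>M\<^esub> (x \<ominus>\<^bsub>M\<^esub> y)"
    using assms submodule_carrier[of x]
    by (simp add: M.minus_eq M.minus_add M.a_assoc[symmetric] M.r_neg)
  then show ?thesis using submodule_minus[OF assms(2,3)] by simp
qed

lemma smult_minus_right:
  assumes "a \<in> carrier R" "x \<in> carrier M" "y \<in> carrier M"
  shows "a \<odot>\<^bsub>M\<^esub> (x \<ominus>\<^bsub>M\<^esub> y) = (a \<odot>\<^bsub>M\<^esub> x) \<ominus>\<^bsub>M\<^esub> (a \<odot>\<^bsub>M\<^esub> y)"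
  using assms by (simp add: M.minus_eq smult_r_distr smult_r_minus)

lemma add_minus_add:
  assumes "x \<in> carrier M" "y \<in> carrier M" "x' \<in> carrier M" "y' \<in> carrier M"
  shows "(x \<oplus>\<^bsub>M\<^esub> x') \<ominus>\<^bsub>M\<^esub> (y \<oplus>\<^bsub>M\<^esub> y') = (x \<ominus>\<^bsub>M\<^esub> y) \<oplus>\<^bsub>M\<^esub> (x' \<ominus>\<^bsub>M\<^esub> y')"
  using assms by (simp add: M.minus_eq M.minus_add M.a_ac)

text \<open>This is the sum of \<open>W\<close> and \<open>H\<close>, written with differences in
  the same way as the spanning condition for \<Delta>.\<close>

lemma submodule_add_generated:
  assumes W: "W \<subseteq> carrier M" "\<zero>\<^bsub>M\<^esub> \<in> W" "\<And>x y. x \<in> W \<Longrightarrow> y \<in> W \<Longrightarrow> x \<oplus>\<^bsub>M\<^esub> y \<in> W"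
    and "\<And>a x. a \<in> carrier R \<Longrightarrow> x \<in> W \<Longrightarrow> a \<odot>\<^bsub>M\<^esub> x \<in> W"
  shows "submodule {p \<in> carrier M. \<exists>w\<in>W. p \<ominus>\<^bsub>M\<^esub> w \<in> H} R M"
proof (rule submoduleI')
  show "\<zero>\<^bsub>M\<^esub> \<in> {p \<in> carrier M. \<exists>w\<in>W. p \<ominus>\<^bsub>M\<^esub> w \<in> H}"
    using W(2) submodule_zero by (auto intro!: bexI[of _ "\<zero>\<^bsub>M\<^esub>"] simp: M.minus_zero_right)
next
  fix x y assume "x \<in> {p \<in> carrier M. \<exists>w\<in>W. p \<ominus>\<^bsub>M\<^esub> w \<in> H}" "y \<in> {p \<in> carrier M. \<exists>w\<in>W. p \<ominus>\<^bsub>M\<^esub> w \<in> H}"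
  then obtain w w' where x: "x \<in> carrier M" "w \<in> W" "x \<ominus>\<^bsub>M\<^esub> w \<in> H" and y: "y \<in> carrier M" "w' \<in> W" "y \<ominus>\<^bsub>M\<^esub> w' \<in> H"
    by blast
  have "(x \<oplus>\<^bsub>M\<^esub> y) \<ominus>\<^bsub>M\<^esub> (w \<oplus>\<^bsub>M\<^esub> w') \<in> H"
    using x y W(1) submodule_add[OF x(3) y(3)] by (subst add_minus_add) auto
  then show "x \<oplus>\<^bsub>M\<^esub> y \<in> {p \<in> carrier M. \<exists>w\<in>W. p \<ominus>\<^bsub>M\<^esub> w \<in> H}"
    using x y W(3) by auto
next
  fix a x assume a: "a \<in> carrier R" and "x \<in> {p \<in> carrier M. \<exists>w\<in>W. p \<ominus>\<^bsub>M\<^esub> w \<in> H}"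
  then obtain w where x: "x \<in> carrier M" "w \<in> W" "x \<ominus>\<^bsub>M\<^esub> w \<in> H"
    by blast
  have "(a \<odot>\<^bsub>M\<^esub> x) \<ominus>\<^bsub>M\<^esub> (a \<odot>\<^bsub>M\<^esub> w) \<in> H"
    using x a W(1) submodule_smult[OF a x(3)] by (subst smult_minus_right[symmetric]) auto
  then show "a \<odot>\<^bsub>M\<^esub> x \<in> {p \<in> carrier M. \<exists>w\<in>W. p \<ominus>\<^bsub>M\<^esub> w \<in> H}"
    using x a assms(4) by auto
qed auto

lemma submodule_add_principal:
  assumes m: "m \<in> carrier M"
  shows "submodule {p \<in> carrier M. \<exists>b\<in>carrier R. p \<ominus>\<^bsub>M\<^esub> (b \<odot>\<^bsub>M\<^esub> m) \<in> H} R M"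
proof -
  have "submodule {p \<in> carrier M. \<exists>w\<in>(\<lambda>b. b \<odot>\<^bsub>M\<^esub> m) ` carrier R. p \<ominus>\<^bsub>M\<^esub> w \<in> H} R M"
  proof (rule submodule_add_generated)
    show "\<zero>\<^bsub>M\<^esub> \<in> (\<lambda>b. b \<odot>\<^bsub>M\<^esub> m) ` carrier R"
      using m by (auto intro!: image_eqI[of _ _ \<zero>])
    fix x y assume "x \<in> (\<lambda>b. b \<odot>\<^bsub>M\<^esub> m) ` carrier R" "y \<in> (\<lambda>b. b \<odot>\<^bsub>M\<^esub> m) ` carrier R"
    then show "x \<oplus>\<^bsub>M\<^esub> y \<in> (\<lambda>b. b \<odot>\<^bsub>M\<^esub> m) ` carrier R"
      using m by (auto simp: smult_l_distr[symmetric])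
  next
    fix a x assume "a \<in> carrier R" "x \<in> (\<lambda>b. b \<odot>\<^bsub>M\<^esub> m) ` carrier R"
    then show "a \<odot>\<^bsub>M\<^esub> x \<in> (\<lambda>b. b \<odot>\<^bsub>M\<^esub> m) ` carrier R"
      using m by (auto simp: smult_assoc1[symmetric])
  qed (use m in auto)
  then show ?thesis by (simp add: bex_simps)
qed

end

text \<open>Generators are discarded one at a time: a relation whose coefficient at the last generator lies
  outside \<open>P\<close> makes that generator redundant after inverting one element. This replaces Nakayama's lemma.\<close>

lemma submodule_exchange:
  fixes e :: "nat \<Rightarrow> 'c"
  assumes N0: "submodule N0 R M" and P: "primeideal P R" and e': "\<forall>i<d. e i \<in> carrier M"
    and s: "s \<in> carrier R - P"
    and gen: "generates_mod R M N0 s d e"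
  shows "(\<exists>s\<in>carrier R - P. \<forall>q\<in>carrier M. \<exists>k::nat. (s [^] k) \<odot>\<^bsub>M\<^esub> q \<in> N0) \<or>
    (\<exists>N. \<exists>s\<in>carrier R - P. \<exists>m\<in>carrier M. submodule N R M \<and> N0 \<subseteq> N \<and>
      (\<forall>q\<in>carrier M. \<exists>k::nat. \<exists>b\<in>carrier R. ((s [^] k) \<odot>\<^bsub>M\<^esub> q) \<ominus>\<^bsub>M\<^esub> (b \<odot>\<^bsub>M\<^esub> m) \<in> N) \<and>
      (\<forall>b\<in>carrier R. b \<odot>\<^bsub>M\<^esub> m \<in> N \<longrightarrow> b \<in> P))"
proof -
  interpret P: primeideal P R by (rule P)
  have e: "e i \<in> carrier M" if "i < d" for i using e' that by blast
  \<comment> \<open>\<open>gens i\<close> is \<open>N0 + R e 0 + ... + R e (i - 1)\<close>, obtained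
    by adjoining one generator at a time.\<close>
  define gens where "gens = rec_nat N0 (\<lambda>i N. {p \<in> carrier M. \<exists>b\<in>carrier R. p \<ominus>\<^bsub>M\<^esub> (b \<odot>\<^bsub>M\<^esub> e i) \<in> N})"
  have g0: "gens 0 = N0" and gSuc: "gens (Suc i) = {p \<in> carrier M. \<exists>b\<in>carrier R. p \<ominus>\<^bsub>M\<^esub> (b \<odot>\<^bsub>M\<^esub> e i) \<in> gens i}" for i
    by (simp_all add: gens_def)
  have sub: "submodule (gens i) R M" if "i \<le> d" for i
    using that
  proof (induction i)
    case 0
    then show ?case by (simp add: g0 N0)
  next
    case (Suc i)
    then show ?case unfolding gSuc by (intro submodule_add_principal e) auto
  qed
  have incl: "N0 \<subseteq> gens i" if "i \<le> d" for i
    using that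
  proof (induction i)
    case 0
    then show ?case by (simp add: g0)
  next
    case (Suc i)
    then have N: "N0 \<subseteq> gens i" and i: "i < d" by auto
    show ?case
    proof
      fix p assume "p \<in> N0"
      then have p: "p \<in> gens i" using N by blast
      have "p \<in> carrier M" using i by (intro submodule_carrier[OF sub p]) simp
      then show "p \<in> gens (Suc i)"
        unfolding gSuc using p e[OF i] by (auto intro!: bexI[of _ \<zero>] simp: M.minus_zero_right)
    qed
  qed
  have sums: "p \<in> gens i" if "i \<le> d" "p \<in> carrier M" "c \<in> {..<i} \<rightarrow> carrier R" "p \<ominus>\<^bsub>M\<^esub> lincomb M {..<i} c e \<in> N0" for p i c
    using that
  proof (induction i arbitrary: p)
    case 0
    then show ?case by (simp add: g0 M.minus_zero_right)
  next
    case (Suc i)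
    then have i: "i < d" by auto
    have c: "c j \<in> carrier R" if "j \<le> i" for j using Suc.prems(3) that by auto
    let ?s = "\<Oplus>\<^bsub>M\<^esub>j\<in>{..<i}. c j \<odot>\<^bsub>M\<^esub> e j"
    have s: "?s \<in> carrier M" using c e i by (intro M.finsum_closed) auto
    have ce: "c i \<odot>\<^bsub>M\<^esub> e i \<in> carrier M" using c[of i] e i by auto
    have "lincomb M {..<Suc i} c e = c i \<odot>\<^bsub>M\<^esub> e i \<oplus>\<^bsub>M\<^esub> ?s"
      unfolding lessThan_Suc using c e i by (subst M.finsum_insert) auto
    then have "(p \<ominus>\<^bsub>M\<^esub> (c i \<odot>\<^bsub>M\<^esub> e i)) \<ominus>\<^bsub>M\<^esub> ?s \<in> N0"
      using Suc.prems s ce by (simp add: M.minus_eq M.minus_add M.a_assoc)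
    from Suc.IH[OF _ _ _ this] have "p \<ominus>\<^bsub>M\<^esub> (c i \<odot>\<^bsub>M\<^esub> e i) \<in> gens i"
      using i Suc.prems(2) c ce by auto
    then show ?case unfolding gSuc using Suc.prems c[of i] by auto
  qed
  \<comment> \<open>Induction on \<open>i\<close>, so the last generator is examined first. The
    second alternative arises with \<open>gens i\<close> and \<open>e i\<close> at the first
    generator met that cannot be discarded, and the first alternative if all of them can.\<close>
  have main: "?thesis" if "i \<le> d" "s \<in> carrier R - P" "\<forall>q\<in>carrier M. \<exists>k::nat. (s [^] k) \<odot>\<^bsub>M\<^esub> q \<in> gens i" for i s
    using that
  proof (induction i arbitrary: s)
    case 0
    then show ?case unfolding g0 by blast
  next
    case (Suc i)
    then have i: "i < d" "i \<le> d" by auto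
    note subi = sub[OF i(2)]
    have s: "s \<in> carrier R" "s \<notin> P" using Suc.prems by auto
    have gen: "\<exists>k::nat. \<exists>b\<in>carrier R. ((s [^] k) \<odot>\<^bsub>M\<^esub> q) \<ominus>\<^bsub>M\<^esub> (b \<odot>\<^bsub>M\<^esub> e i) \<in> gens i" if "q \<in> carrier M" for q
      using Suc.prems(3) that unfolding gSuc by blast
    show ?case
    proof (cases "\<forall>b\<in>carrier R. b \<odot>\<^bsub>M\<^esub> e i \<in> gens i \<longrightarrow> b \<in> P")
      case True
      then show ?thesis using subi incl[OF i(2)] gen s e[OF i(1)] by blast
    next
      case False
      then obtain b where b: "b \<in> carrier R" "b \<odot>\<^bsub>M\<^esub> e i \<in> gens i" "b \<notin> P" by blast
      have sb: "s \<otimes> b \<in> carrier R - P" using s b P.I_prime by blast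
      have "\<forall>q\<in>carrier M. \<exists>k::nat. ((s \<otimes> b) [^] k) \<odot>\<^bsub>M\<^esub> q \<in> gens i"
      proof
        fix q assume q: "q \<in> carrier M"
        from gen[OF q] obtain k :: nat and c where c: "c \<in> carrier R" "((s [^] k) \<odot>\<^bsub>M\<^esub> q) \<ominus>\<^bsub>M\<^esub> (c \<odot>\<^bsub>M\<^esub> e i) \<in> gens i"
          by blast
        have "b \<odot>\<^bsub>M\<^esub> (((s [^] k) \<odot>\<^bsub>M\<^esub> q) \<ominus>\<^bsub>M\<^esub> (c \<odot>\<^bsub>M\<^esub> e i)) \<in> gens i"
          by (rule submodule_smult[OF subi b(1) c(2)])
        then have bc: "(b \<odot>\<^bsub>M\<^esub> ((s [^] k) \<odot>\<^bsub>M\<^esub> q)) \<ominus>\<^bsub>M\<^esub> (c \<odot>\<^bsub>M\<^esub> (b \<odot>\<^bsub>M\<^esub> e i)) \<in> gens i"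
          using b c s q e[OF i(1)] smult_minus_right[OF N0] by (simp add: smult_assoc1[symmetric] R.m_comm)
        have "b \<odot>\<^bsub>M\<^esub> ((s [^] k) \<odot>\<^bsub>M\<^esub> q) \<in> carrier M" using b s q by simp
        note 1 = submodule_minus_cancel[OF subi this submodule_smult[OF subi c(1) b(2)] bc]
        \<comment> \<open>The exponent is \<open>Suc k\<close> because one factor \<open>b\<close>
          must be available even when \<open>k\<close> is 0; the surplus factor
          \<open>s b ^ k\<close> is harmless.\<close>
        have "((s \<otimes> b) [^] Suc k) \<odot>\<^bsub>M\<^esub> q = (s \<otimes> (b [^] k)) \<odot>\<^bsub>M\<^esub> (b \<odot>\<^bsub>M\<^esub> ((s [^] k) \<odot>\<^bsub>M\<^esub> q))"
          using b s q by (simp add: smult_assoc1[symmetric] R.nat_pow_distrib R.m_ac)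
        then show "\<exists>k::nat. ((s \<otimes> b) [^] k) \<odot>\<^bsub>M\<^esub> q \<in> gens i"
          using submodule_smult[OF subi _ 1, of "s \<otimes> (b [^] k)"] b s by (metis R.m_closed R.nat_pow_closed)
      qed
      then show ?thesis using Suc.IH[OF i(2) sb] by blast
    qed
  qed
  have "\<exists>k::nat. (s [^] k) \<odot>\<^bsub>M\<^esub> q \<in> gens d" if q: "q \<in> carrier M" for q
  proof -
    from bspec[OF gen q] obtain k :: nat and c where c: "c \<in> {..<d} \<rightarrow> carrier R"
      "((s [^] k) \<odot>\<^bsub>M\<^esub> q) \<ominus>\<^bsub>M\<^esub> lincomb M {..<d} c e \<in> N0" by blast
    have "(s [^] k) \<odot>\<^bsub>M\<^esub> q \<in> gens d"
      using s q by (intro sums[OF order_refl _ c]) auto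
    then show ?thesis by blast
  qed
  then show ?thesis using main[OF order_refl s] by blast
qed

end

lemma (in algebra) ideal_submodule:
  assumes "ideal I M"
  shows "submodule I R M"
proof (rule submoduleI')
  interpret I: ideal I M by fact
  show "I \<subseteq> carrier M" "\<zero>\<^bsub>M\<^esub> \<in> I" by (auto simp: I.a_subset)
  show "x \<oplus>\<^bsub>M\<^esub> y \<in> I" if "x \<in> I" "y \<in> I" for x y using that by (rule I.a_closed)
  show "a \<odot>\<^bsub>M\<^esub> x \<in> I" if "a \<in> carrier R" "x \<in> I" for a x
    by (rule ideal_smult_closed[OF assms that])
qed


section \<open>Torsion\<close>

lemma (in ideal) finsum_mem:
  assumes "finite S" "\<And>s. s \<in> S \<Longrightarrow> F s \<in> I"
  shows "(\<Oplus>s\<in>S. F s) \<in> I"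
  using assms
proof (induction S rule: finite_induct)
  case (insert s S)
  then show ?case using Icarr by (subst finsum_insert) (auto intro: a_closed)
qed simp

text \<open>The kernel of the localization map of \<open>R\<close> at \<open>h\<close>.\<close>

definition (in cring) torsion :: "'a \<Rightarrow> 'a set" where
  "torsion h = {a \<in> carrier R. \<exists>L::nat. (h [^] L) \<otimes> a = \<zero>}"

lemma (in cring) torsion_ideal:
  assumes h: "h \<in> carrier R"
  shows "ideal (torsion h) R"
proof (rule idealI[OF ring_axioms])
  show "subgroup (torsion h) (add_monoid R)"
  proof (rule group.subgroupI[OF a_group])
    show "torsion h \<noteq> {}" using h by (auto simp: torsion_def intro!: exI[of _ \<zero>])
    fix a assume "a \<in> torsion h"
    then obtain K :: nat where a: "a \<in> carrier R" "(h [^] K) \<otimes> a = \<zero>" by (auto simp: torsion_def)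
    show "inv\<^bsub>add_monoid R\<^esub> a \<in> torsion h"
      using a h by (auto simp: torsion_def a_inv_def[symmetric] r_minus intro!: exI[of _ K])
    fix b assume "b \<in> torsion h"
    then obtain L :: nat where b: "b \<in> carrier R" "(h [^] L) \<otimes> b = \<zero>" by (auto simp: torsion_def)
    have "(h [^] (K + L)) \<otimes> (a \<oplus> b) = (h [^] L) \<otimes> ((h [^] K) \<otimes> a) \<oplus> (h [^] K) \<otimes> ((h [^] L) \<otimes> b)"
      using a(1) b(1) h by (simp add: nat_pow_mult[symmetric] r_distr m_ac)
    then have "(h [^] (K + L)) \<otimes> (a \<oplus> b) = \<zero>" using a b h by simp
    then show "a \<otimes>\<^bsub>add_monoid R\<^esub> b \<in> torsion h" using a b by (auto simp: torsion_def)
  qed (auto simp: torsion_def)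
  fix a x assume "a \<in> torsion h" and x: "x \<in> carrier R"
  then obtain K :: nat where a: "a \<in> carrier R" "(h [^] K) \<otimes> a = \<zero>" by (auto simp: torsion_def)
  have "(h [^] K) \<otimes> (x \<otimes> a) = x \<otimes> ((h [^] K) \<otimes> a)" using a(1) x h by (simp add: m_lcomm)
  then show "x \<otimes> a \<in> torsion h" using a x by (auto simp: torsion_def)
  then show "a \<otimes> x \<in> torsion h" using a x by (simp add: m_comm)
qed

lemma (in cring) torsion_pow_cancel:
  assumes "(h [^] (K::nat)) \<otimes> a \<in> torsion h" "h \<in> carrier R" "a \<in> carrier R"
  shows "a \<in> torsion h"
proof -
  obtain L :: nat where "(h [^] L) \<otimes> ((h [^] K) \<otimes> a) = \<zero>" using assms(1) by (auto simp: torsion_def)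
  then have "(h [^] (L + K)) \<otimes> a = \<zero>" using assms(2,3) by (simp add: nat_pow_mult[symmetric] m_assoc)
  then show ?thesis using assms(3) by (auto simp: torsion_def)
qed


section \<open>Division with denominators in monoid algebras\<close>

context monoid_algebra_over
begin

lemma pairing_zero: "pairing h \<zero>\<^bsub>RM\<^esub> = \<zero>"
  by (simp add: pairing_def linear_extension_def monoid_algebra_simps(3))

lemma pairing_finsum:
  assumes h: "h \<in> carrier M \<rightarrow> carrier R" and g: "g \<in> S \<rightarrow> carrier RM"
  shows "pairing h (finsum RM g S) = (\<Oplus>s\<in>S. pairing h (g s))"
  by (rule finsum_hom[where h = "pairing h"])
    (use h g in \<open>auto simp: pairing_closed pairing_add pairing_zero intro: R.abelian_monoid_axioms RM.M.abelian_monoid_axioms\<close>)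

text \<open>Below \<open>n\<close> is bounded by \<open>K\<close> on the support of \<open>v\<close>, so that the subtraction is not truncated.\<close>

definition scaled_pairing :: "'a \<Rightarrow> ('c \<Rightarrow> nat) \<Rightarrow> ('c \<Rightarrow> 'a) \<Rightarrow> nat \<Rightarrow> ('c \<Rightarrow> 'a) \<Rightarrow> 'a" where
  "scaled_pairing h n c K = pairing (\<lambda>m. (h [^] (K - n m)) \<otimes> c m)"

context
  fixes h c and n :: "'c \<Rightarrow> nat"
  assumes h: "h \<in> carrier R" and c: "\<And>m. m \<in> carrier M \<Longrightarrow> c m \<in> carrier R"
begin

lemma scaled_coefficient: "(\<lambda>m. (h [^] (K - n m)) \<otimes> c m) \<in> carrier M \<rightarrow> carrier R"
  using h c by auto

lemmas scaled_pairing_closed = pairing_closed[OF scaled_coefficient, folded scaled_pairing_def]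
lemmas scaled_pairing_add = pairing_add[OF scaled_coefficient, folded scaled_pairing_def]
lemmas scaled_pairing_smult = pairing_smult[OF scaled_coefficient, folded scaled_pairing_def]
lemmas scaled_pairing_finsum = pairing_finsum[OF scaled_coefficient, folded scaled_pairing_def]
lemmas scaled_pairing_monomial = pairing_monomial[OF scaled_coefficient, folded scaled_pairing_def]

end

text \<open>For fixed \<open>K\<close> the function is linear, so membership in \<open>T\<close> is
  closed under addition and scalars; the thresholds of two summands are merged by taking their
  maximum. Allowing the threshold to depend on \<open>v\<close> admits exponents \<open>n\<close>
  that are unbounded on the monoid.\<close>

lemma eventually_in_ideal_submodule:
  fixes n :: "'c \<Rightarrow> nat"
  assumes h: "h \<in> carrier R" and c: "\<And>m. m \<in> carrier M \<Longrightarrow> c m \<in> carrier R" and T: "ideal T R"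
  shows "submodule {v \<in> carrier RM. \<exists>K0. \<forall>K\<ge>K0. scaled_pairing h n c K v \<in> T} R RM" (is "submodule ?X R RM")
proof (rule RM.submoduleI')
  interpret T: ideal T R by (rule T)
  show "\<zero>\<^bsub>RM\<^esub> \<in> ?X" by (simp add: scaled_pairing_def pairing_zero)
  fix p assume "p \<in> ?X"
  then obtain K1 where p: "p \<in> carrier RM" "\<And>K. K \<ge> K1 \<Longrightarrow> scaled_pairing h n c K p \<in> T" by auto
  {
    fix q assume "q \<in> ?X"
    then obtain K2 where q: "q \<in> carrier RM" "\<And>K. K \<ge> K2 \<Longrightarrow> scaled_pairing h n c K q \<in> T" by auto
    have "scaled_pairing h n c K (p \<oplus>\<^bsub>RM\<^esub> q) \<in> T" if "K \<ge> max K1 K2" for K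
    proof -
      have "scaled_pairing h n c K (p \<oplus>\<^bsub>RM\<^esub> q) = scaled_pairing h n c K p \<oplus> scaled_pairing h n c K q"
        by (intro scaled_pairing_add h c p q)
      then show ?thesis using p(2)[of K] q(2)[of K] that by simp
    qed
    then show "p \<oplus>\<^bsub>RM\<^esub> q \<in> ?X"
      unfolding mem_Collect_eq using add_closed[OF p(1) q(1)] by blast
  }
  fix a assume a: "a \<in> carrier R"
  have "scaled_pairing h n c K (a \<odot>\<^bsub>RM\<^esub> p) \<in> T" if "K \<ge> K1" for K
  proof -
    have "scaled_pairing h n c K (a \<odot>\<^bsub>RM\<^esub> p) = a \<otimes> scaled_pairing h n c K p"
      by (intro scaled_pairing_smult h c p a)
    then show ?thesis using T.I_l_closed[OF p(2)[OF that] a] by simp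
  qed
  then show "a \<odot>\<^bsub>RM\<^esub> p \<in> ?X"
    unfolding mem_Collect_eq using smult_closed[OF a p(1)] by blast
qed auto

text \<open>For fixed \<open>K\<close> the difference is linear in \<open>v\<close>, so monomials
  suffice; there the relation with exponent \<open>n m\<close> is multiplied by
  \<open>h ^ (K - n m)\<close>. The coefficients come from one formula for all \<open>v\<close>,
  which is what lets them be base-changed.\<close>

lemma division_with_denominators:
  fixes n :: "'c \<Rightarrow> nat"
  assumes N: "submodule N R RM" and h: "h \<in> carrier R" and J: "finite J" and e: "\<And>i. i \<in> J \<Longrightarrow> e i \<in> carrier RM"
    and c: "\<And>m i. m \<in> carrier M \<Longrightarrow> i \<in> J \<Longrightarrow> c m i \<in> carrier R"
    and rel: "\<And>m. m \<in> carrier M \<Longrightarrow>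
      ((h [^] n m) \<odot>\<^bsub>RM\<^esub> monomial R m) \<ominus>\<^bsub>RM\<^esub> lincomb RM J (c m) e \<in> N"
    and v: "v \<in> carrier RM" and K: "\<And>m. m \<in> supp R v \<Longrightarrow> n m \<le> K"
  shows "((h [^] K) \<odot>\<^bsub>RM\<^esub> v) \<ominus>\<^bsub>RM\<^esub>
    lincomb RM J (\<lambda>i. scaled_pairing h n (\<lambda>m. c m i) K v) e \<in> N"
proof -
  let ?L = "\<lambda>i. scaled_pairing h n (\<lambda>m. c m i) K"
  note Lcl = scaled_pairing_closed[OF h c]
  define D where "D w = ((h [^] K) \<odot>\<^bsub>RM\<^esub> w) \<ominus>\<^bsub>RM\<^esub> lincomb RM J (\<lambda>i. ?L i w) e" for w
  have scl: "lincomb RM J (\<lambda>i. ?L i w) e \<in> carrier RM" if "w \<in> carrier RM" for w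
    using that e Lcl by (intro RM.M.finsum_closed) (auto intro!: smult_closed)
  have kcl: "(h [^] K) \<odot>\<^bsub>RM\<^esub> w \<in> carrier RM" if "w \<in> carrier RM" for w using that h by (intro smult_closed) auto
  have Dcl: "D w \<in> carrier RM" if "w \<in> carrier RM" for w unfolding D_def using scl[OF that] kcl[OF that] by (rule RM.M.minus_closed[rotated])
  have Dadd: "D (w \<oplus>\<^bsub>RM\<^esub> w') = D w \<oplus>\<^bsub>RM\<^esub> D w'" if w: "w \<in> carrier RM" "w' \<in> carrier RM" for w w'
  proof -
    have "(\<Oplus>\<^bsub>RM\<^esub>i\<in>J. ?L i (w \<oplus>\<^bsub>RM\<^esub> w') \<odot>\<^bsub>RM\<^esub> e i) = (\<Oplus>\<^bsub>RM\<^esub>i\<in>J. ?L i w \<odot>\<^bsub>RM\<^esub> e i \<oplus>\<^bsub>RM\<^esub> ?L i w' \<odot>\<^bsub>RM\<^esub> e i)"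
      using w e Lcl by (intro RM.M.finsum_cong' refl) (simp_all add: Pi_iff scaled_pairing_add[OF h c] RM.smult_l_distr smult_closed)
    also have "\<dots> = lincomb RM J (\<lambda>i. ?L i w) e \<oplus>\<^bsub>RM\<^esub> lincomb RM J (\<lambda>i. ?L i w') e"
      using w e Lcl by (intro RM.M.finsum_addf) (auto intro!: smult_closed)
    moreover have "(h [^] K) \<odot>\<^bsub>RM\<^esub> (w \<oplus>\<^bsub>RM\<^esub> w') = (h [^] K) \<odot>\<^bsub>RM\<^esub> w \<oplus>\<^bsub>RM\<^esub> (h [^] K) \<odot>\<^bsub>RM\<^esub> w'"
      using w h by (intro RM.smult_r_distr) auto
    ultimately show ?thesis
      unfolding D_def using RM.add_minus_add[OF N kcl[OF w(1)] scl[OF w(1)] kcl[OF w(2)] scl[OF w(2)]] by (simp only:)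
  qed
  have Dsmult: "D (a \<odot>\<^bsub>RM\<^esub> w) = a \<odot>\<^bsub>RM\<^esub> D w" if w: "w \<in> carrier RM" and a: "a \<in> carrier R" for w a
  proof -
    have "lincomb RM J (\<lambda>i. ?L i (a \<odot>\<^bsub>RM\<^esub> w)) e = (\<Oplus>\<^bsub>RM\<^esub>i\<in>J. a \<odot>\<^bsub>RM\<^esub> (?L i w \<odot>\<^bsub>RM\<^esub> e i))"
      using w a e Lcl by (intro RM.M.finsum_cong' refl) (simp_all add: Pi_iff scaled_pairing_smult[OF h c] RM.smult_assoc1 smult_closed)
    also have "\<dots> = a \<odot>\<^bsub>RM\<^esub> lincomb RM J (\<lambda>i. ?L i w) e"
      using w a e Lcl J by (intro RM.finsum_smult_ldistr[symmetric]) (auto intro!: smult_closed)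
    moreover have "(h [^] K) \<odot>\<^bsub>RM\<^esub> (a \<odot>\<^bsub>RM\<^esub> w) = a \<odot>\<^bsub>RM\<^esub> ((h [^] K) \<odot>\<^bsub>RM\<^esub> w)"
      using w a h by (simp add: RM.smult_assoc1[symmetric] R.m_comm)
    ultimately show ?thesis
      unfolding D_def using RM.smult_minus_right[OF N a kcl[OF w] scl[OF w]] by (simp only:)
  qed
  have D0: "D \<zero>\<^bsub>RM\<^esub> = \<zero>\<^bsub>RM\<^esub>"
    using Dsmult[of "\<zero>\<^bsub>RM\<^esub>" \<zero>] Dcl[of "\<zero>\<^bsub>RM\<^esub>"] by simp
  \<comment> \<open>The bound on \<open>n m\<close> enters here: above \<open>K\<close> the
    truncated subtraction would not restore the exponent \<open>K\<close>.\<close>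
  have Dmono: "D (monomial R m) \<in> N" if m: "m \<in> carrier M" "n m \<le> K" for m
  proof -
    let ?s = "lincomb RM J (c m) e"
    have s: "?s \<in> carrier RM" using m c e by (intro RM.M.finsum_closed) (auto intro!: smult_closed)
    have "lincomb RM J (\<lambda>i. ?L i (monomial R m)) e = (\<Oplus>\<^bsub>RM\<^esub>i\<in>J. (h [^] (K - n m)) \<odot>\<^bsub>RM\<^esub> (c m i \<odot>\<^bsub>RM\<^esub> e i))"
      using m c e h by (intro RM.M.finsum_cong' refl) (simp_all add: Pi_iff scaled_pairing_monomial[OF h c] RM.smult_assoc1 smult_closed)
    also have "\<dots> = (h [^] (K - n m)) \<odot>\<^bsub>RM\<^esub> ?s"
      using m c e h J by (intro RM.finsum_smult_ldistr[symmetric]) (auto intro!: smult_closed)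
    moreover have "(h [^] K) \<odot>\<^bsub>RM\<^esub> monomial R m = (h [^] (K - n m)) \<odot>\<^bsub>RM\<^esub> ((h [^] n m) \<odot>\<^bsub>RM\<^esub> monomial R m)"
      using m h by (simp add: RM.smult_assoc1[symmetric] R.nat_pow_mult)
    ultimately have "D (monomial R m) = (h [^] (K - n m)) \<odot>\<^bsub>RM\<^esub> (((h [^] n m) \<odot>\<^bsub>RM\<^esub> monomial R m) \<ominus>\<^bsub>RM\<^esub> ?s)"
      unfolding D_def using RM.smult_minus_right[OF N _ _ s, of "h [^] (K - n m)" "(h [^] n m) \<odot>\<^bsub>RM\<^esub> monomial R m"] m h
      by (simp add: smult_closed)
    then show ?thesis
      using RM.submodule_smult[OF N _ rel[OF m(1)], of "h [^] (K - n m)"] h by simp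
  qed
  note v' = in_carrierD[OF v]
  have mcl: "v m \<odot>\<^bsub>RM\<^esub> monomial R m \<in> carrier RM" if "m \<in> supp R v" for m
    using that v' by (intro smult_closed) auto
  have "D v = D (lincomb RM (supp R v) v (monomial R))"
    by (simp only: sum_of_monomials[OF v v'(3,2) order_refl, symmetric])
  also have "\<dots> = (\<Oplus>\<^bsub>RM\<^esub>m\<in>supp R v. D (v m \<odot>\<^bsub>RM\<^esub> monomial R m))"
    using mcl by (intro finsum_hom[where h = D] RM.M.abelian_monoid_axioms Dcl D0 Dadd) auto
  also have "\<dots> \<in> N"
  proof (rule RM.submodule_finsum[OF N])
    fix m assume m: "m \<in> supp R v"
    then have "m \<in> carrier M" using v'(2) by blast
    then show "D (v m \<odot>\<^bsub>RM\<^esub> monomial R m) \<in> N"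
      using Dmono[OF _ K[OF m]] v'(1)[of m] by (simp add: Dsmult RM.submodule_smult[OF N])
  qed
  finally show ?thesis unfolding D_def .
qed

end

section \<open>Compatibility of the coordinate functions with base change\<close>

context base_change
begin

lemma f_pow: "b \<in> carrier B \<Longrightarrow> f (b [^]\<^bsub>B\<^esub> (k::nat)) = f b [^] k"
  by (induction k) auto

lemma torsion_push: "b \<in> MB.R.torsion g \<Longrightarrow> g \<in> carrier B \<Longrightarrow> f b \<in> MA.R.torsion (f g)"
proof -
  assume "b \<in> MB.R.torsion g" and g: "g \<in> carrier B"
  then obtain L :: nat where b: "b \<in> carrier B" "(g [^]\<^bsub>B\<^esub> L) \<otimes>\<^bsub>B\<^esub> b = \<zero>\<^bsub>B\<^esub>" by (auto simp: MB.R.torsion_def)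
  from arg_cong[OF b(2), of f] show ?thesis
    using b(1) g by (auto simp: MA.R.torsion_def f_pow)
qed

lemma extension_minimal_submodule:
  assumes "ideal I BM" "submodule J A AM" "\<And>u. u \<in> I \<Longrightarrow> push u \<in> J"
  shows "ext I \<subseteq> J"
  by (rule extension_minimal[OF assms(1) _ MA.RM.submodule_zero[OF assms(2)] MA.RM.submodule_add[OF assms(2)]
      MA.RM.submodule_smult[OF assms(2)] assms(3)]) (auto dest: MA.RM.submodule_carrier[OF assms(2)])

lemma pairing_push:
  assumes h: "h \<in> carrier M \<rightarrow> carrier B" and u: "u \<in> carrier BM" and h': "\<And>m. m \<in> carrier M \<Longrightarrow> h' m = f (h m)"
  shows "MA.pairing h' (push u) = f (MB.pairing h u)"
proof -
  note u' = MB.in_carrierD[OF u]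
  have mem: "m \<in> carrier M" "h m \<in> carrier B" if "m \<in> supp B u" for m using that u'(2) h by blast+
  have h'cl: "h' \<in> carrier M \<rightarrow> carrier A" using funcset_mem[OF h] h' f.hom_closed by (intro funcsetI) simp
  have "MA.pairing h' (push u) = finsum A (\<lambda>m. f (u m) \<otimes> h' m) (supp B u)"
    by (rule MA.pairing_superset[OF h'cl push_closed[OF u] u'(3,2) supp_push])
  also have "\<dots> = finsum A (\<lambda>m. f (u m \<otimes>\<^bsub>B\<^esub> h m)) (supp B u)"
    using mem u'(1) h' by (intro MA.R.finsum_cong' refl) auto
  also have "\<dots> = f (finsum B (\<lambda>m. u m \<otimes>\<^bsub>B\<^esub> h m) (supp B u))"
    using mem u'(1) by (subst f.hom_finsum) (auto simp: comp_def)
  also have "finsum B (\<lambda>m. u m \<otimes>\<^bsub>B\<^esub> h m) (supp B u) = MB.pairing h u"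
    by (rule MB.pairing_superset[OF h u u'(3,2) order_refl, symmetric])
  finally show ?thesis .
qed

text \<open>Lets coordinate functions over \<open>A\<close> be evaluated on the generators of
  \<open>ext I\<close>, which come from \<open>B\<close>: both sides are sums of the same products,
  transported by \<open>f\<close>.\<close>

lemma scaled_pairing_push:
  assumes g: "g \<in> carrier B" and c: "\<And>m. m \<in> carrier M \<Longrightarrow> c m \<in> carrier B" and u: "u \<in> carrier BM"
  shows "MA.scaled_pairing (f g) n (\<lambda>m. f (c m)) K (push u) = f (MB.scaled_pairing g n c K u)"
  unfolding MA.scaled_pairing_def MB.scaled_pairing_def
  using g c by (intro pairing_push[OF MB.scaled_coefficient[OF g c] u]) (simp_all add: f_pow)

end

section \<open>Base change of local freeness and of the spanning condition\<close>

lemma finite_nat_bound: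
  fixes n :: "'c \<Rightarrow> nat"
  assumes "finite S"
  shows "\<exists>K0. \<forall>m\<in>S. n m \<le> K0"
  using assms finite_nat_set_iff_bounded_le[of "n ` S"] by auto

definition (in monoid_algebra_over) supported :: "'c set \<Rightarrow> ('c \<Rightarrow> 'a) set" where
  "supported \<Delta> = {p \<in> carrier RM. \<forall>m. m \<notin> \<Delta> \<longrightarrow> p m = \<zero>}"

text \<open>Surjectivity of the span of \<Delta> onto the quotient by \<open>I\<close> after
  inverting \<open>s\<close>, with cleared denominators.\<close>

abbreviation (in monoid_algebra_over) spans_after :: "'c set \<Rightarrow> ('c \<Rightarrow> 'a) set \<Rightarrow> 'a \<Rightarrow> bool" where
  "spans_after \<Delta> I s \<equiv> \<forall>q\<in>carrier RM. \<exists>k::nat. \<exists>w\<in>supported \<Delta>. ((s [^] k) \<odot>\<^bsub>RM\<^esub> q) \<ominus>\<^bsub>RM\<^esub> w \<in> I"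

lemma (in monoid_algebra_over) supported_props:
  shows "supported \<Delta> \<subseteq> carrier RM" "\<zero>\<^bsub>RM\<^esub> \<in> supported \<Delta>"
    and "x \<in> supported \<Delta> \<Longrightarrow> y \<in> supported \<Delta> \<Longrightarrow> x \<oplus>\<^bsub>RM\<^esub> y \<in> supported \<Delta>"
    and "a \<in> carrier R \<Longrightarrow> x \<in> supported \<Delta> \<Longrightarrow> a \<odot>\<^bsub>RM\<^esub> x \<in> supported \<Delta>"
  by (auto simp: supported_def add_closed smult_closed) (auto simp: monoid_algebra_simps)

lemma (in monoid_algebra_over) submodule_supported_add:
  assumes "submodule N R RM"
  shows "submodule {p \<in> carrier RM. \<exists>w\<in>supported \<Delta>. p \<ominus>\<^bsub>RM\<^esub> w \<in> N} R RM"
  by (rule RM.submodule_add_generated[OF assms supported_props])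

text \<open>An element is the sum of its coefficients times monomials. With \<open>UNIV\<close> as
  \<Delta> this shows that a submodule containing every monomial is the whole algebra.\<close>

lemma (in monoid_algebra_over) supported_in_submodule:
  assumes N: "submodule N R RM" and mono: "\<And>m. m \<in> \<Delta> \<Longrightarrow> m \<in> carrier M \<Longrightarrow> monomial R m \<in> N"
    and p: "p \<in> supported \<Delta>"
  shows "p \<in> N"
proof -
  have pc: "p \<in> carrier RM" using p supported_props(1) by blast
  note p' = in_carrierD[OF pc]
  have "lincomb RM (supp R p) p (monomial R) \<in> N"
  proof (rule RM.submodule_finsum[OF N])
    fix m assume m: "m \<in> supp R p"
    then have "m \<in> \<Delta>" "m \<in> carrier M" using p p'(2) by (auto simp: supported_def)
    then show "p m \<odot>\<^bsub>RM\<^esub> monomial R m \<in> N"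
      by (intro RM.submodule_smult[OF N] p'(1) mono)
  qed
  then show ?thesis by (simp only: sum_of_monomials[OF pc p'(3,2) order_refl, symmetric])
qed

context base_change
begin

lemma primeideal_preimage:
  assumes "primeideal P A"
  shows "primeideal {b \<in> carrier B. f b \<in> P} B"
proof (rule primeidealI)
  interpret P: primeideal P A by fact
  show "ideal {b \<in> carrier B. f b \<in> P} B"
    by (rule ring_hom_ring.ideal_vimage[OF ring_hom_ringI2[OF MB.R.ring_axioms MA.R.ring_axioms f] P.is_ideal])
  show "cring B" ..
  have "f \<one>\<^bsub>B\<^esub> \<notin> P" using P.one_imp_carrier P.I_notcarr by auto
  then show "carrier B \<noteq> {b \<in> carrier B. f b \<in> P}" using MB.R.one_closed by blast
  fix a b assume "a \<in> carrier B" "b \<in> carrier B" "a \<otimes>\<^bsub>B\<^esub> b \<in> {b \<in> carrier B. f b \<in> P}"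
  then show "a \<in> {b \<in> carrier B. f b \<in> P} \<or> b \<in> {b \<in> carrier B. f b \<in> P}"
    using P.I_prime[of "f a" "f b"] by auto
qed

lemma push_relation:
  assumes "b \<in> carrier B" "p \<in> carrier BM" "\<And>i. i \<in> J \<Longrightarrow> c i \<in> carrier B" "\<And>i. i \<in> J \<Longrightarrow> e i \<in> carrier BM"
  shows "push ((b \<odot>\<^bsub>BM\<^esub> p) \<ominus>\<^bsub>BM\<^esub> (lincomb BM J c e)) =
    (f b \<odot>\<^bsub>AM\<^esub> push p) \<ominus>\<^bsub>AM\<^esub> lincomb AM J (\<lambda>i. f (c i)) (\<lambda>i. push (e i))"
proof -
  let ?s = "\<Oplus>\<^bsub>BM\<^esub>i\<in>J. c i \<odot>\<^bsub>BM\<^esub> e i"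
  have cl: "b \<odot>\<^bsub>BM\<^esub> p \<in> carrier BM" "?s \<in> carrier BM"
    using assms by (auto intro!: MB.smult_closed MB.RM.M.finsum_closed)
  have "push ?s = (\<Oplus>\<^bsub>AM\<^esub>i\<in>J. push (c i \<odot>\<^bsub>BM\<^esub> e i))"
    using assms by (subst push.hom_finsum) (auto intro!: MB.smult_closed simp: comp_def)
  also have "\<dots> = lincomb AM J (\<lambda>i. f (c i)) (\<lambda>i. push (e i))"
    using assms by (intro MA.RM.M.finsum_cong' refl) (auto intro!: MA.smult_closed push_closed simp: push_smult)
  finally have s: "push ?s = lincomb AM J (\<lambda>i. f (c i)) (\<lambda>i. push (e i))" .
  have "push ((b \<odot>\<^bsub>BM\<^esub> p) \<ominus>\<^bsub>BM\<^esub> ?s) = push (b \<odot>\<^bsub>BM\<^esub> p) \<oplus>\<^bsub>AM\<^esub> \<ominus>\<^bsub>AM\<^esub> push ?s"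
    unfolding MB.RM.M.minus_eq
    using push.hom_add[OF cl(1) MB.RM.M.a_inv_closed[OF cl(2)]] push.hom_a_inv[OF cl(2)] by (simp only:)
  then show ?thesis
    unfolding MA.RM.M.minus_eq push_smult[OF assms(1,2)] s .
qed

text \<open>Proved with the image of the local basis \<open>e\<close> and with \<open>f g\<close>
  inverted. Generation follows by pushing the division relations forward. For independence, the
  \<open>i\<close>-th coordinate function over \<open>A\<close> sends \<open>ext I\<close> to
  torsion because its counterpart over \<open>B\<close> does so on \<open>I\<close>, and it sends
  the image of \<open>e j\<close> to \<open>(f g) ^ K\<close> or 0 modulo torsion; applied to a
  relation it isolates the \<open>i\<close>-th coefficient.\<close>

lemma locally_free_extension:
  assumes I: "ideal I BM" and lf: "locally_free_quotient B BM I d"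
  shows "locally_free_quotient A AM (ext I) d"
  unfolding locally_free_quotient_def
proof (intro allI impI)
  fix P' assume P': "primeideal P' A"
  note IN = MB.RM.ideal_submodule[OF I] and EN = MA.RM.ideal_submodule[OF extension_ideal[OF I]]
  obtain g e where g: "g \<in> carrier B" "f g \<notin> P'" and e: "e \<in> {..<d} \<rightarrow> carrier BM"
    and gen: "generates_mod B BM I g d e"
    and indep: "independent_mod B BM I g d e"
    using lf[unfolded locally_free_quotient_def, rule_format, OF primeideal_preimage[OF P']] by auto
  have e': "e i \<in> carrier BM" if "i \<in> {..<d}" for i using e that by auto
  \<comment> \<open>Reductions are chosen for monomials only; by linearity they determine the
    coordinates of every polynomial.\<close>
  have "\<forall>m\<in>carrier M. \<exists>N::nat. \<exists>c. c \<in> {..<d} \<rightarrow> carrier B \<and>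
      ((g [^]\<^bsub>B\<^esub> N) \<odot>\<^bsub>BM\<^esub> monomial B m) \<ominus>\<^bsub>BM\<^esub> lincomb BM {..<d} c e \<in> I"
  proof
    fix m assume "m \<in> carrier M"
    from bspec[OF gen MB.monomial_closed[OF this]] show "\<exists>N::nat. \<exists>c. c \<in> {..<d} \<rightarrow> carrier B \<and>
      ((g [^]\<^bsub>B\<^esub> N) \<odot>\<^bsub>BM\<^esub> monomial B m) \<ominus>\<^bsub>BM\<^esub> lincomb BM {..<d} c e \<in> I"
      by (simp only: Bex_def)
  qed
  from bchoice2[OF this] obtain n :: "'m \<Rightarrow> nat" and c where
    c0: "\<And>m. m \<in> carrier M \<Longrightarrow> c m \<in> {..<d} \<rightarrow> carrier B" and
    rel: "\<And>m. m \<in> carrier M \<Longrightarrow> ((g [^]\<^bsub>B\<^esub> n m) \<odot>\<^bsub>BM\<^esub> monomial B m) \<ominus>\<^bsub>BM\<^esub> lincomb BM {..<d} (c m) e \<in> I"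
    by blast
  have c: "c m i \<in> carrier B" if "m \<in> carrier M" "i \<in> {..<d}" for m i using c0[OF that(1)] that(2) by auto
  have relA: "((f g [^] n m) \<odot>\<^bsub>AM\<^esub> monomial A m) \<ominus>\<^bsub>AM\<^esub> lincomb AM {..<d} (\<lambda>i. f (c m i)) (\<lambda>i. push (e i)) \<in> ext I"
    if m: "m \<in> carrier M" for m
  proof -
    have "push (((g [^]\<^bsub>B\<^esub> n m) \<odot>\<^bsub>BM\<^esub> monomial B m) \<ominus>\<^bsub>BM\<^esub> (lincomb BM {..<d} (c m) e)) \<in> ext I"
      by (rule extension_push[OF I rel[OF m]])
    also have "push (((g [^]\<^bsub>B\<^esub> n m) \<odot>\<^bsub>BM\<^esub> monomial B m) \<ominus>\<^bsub>BM\<^esub> (lincomb BM {..<d} (c m) e)) =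
        ((f g [^] n m) \<odot>\<^bsub>AM\<^esub> monomial A m) \<ominus>\<^bsub>AM\<^esub> lincomb AM {..<d} (\<lambda>i. f (c m i)) (\<lambda>i. push (e i))"
      using m g c e' by (subst push_relation) (simp_all add: f_pow push_monomial)
    finally show ?thesis .
  qed
  note cA = f.hom_closed[OF c] and gA = f.hom_closed[OF g(1)]
  \<comment> \<open>\<open>LB K i u\<close> represents \<open>g ^ K\<close> times the
    \<open>i\<close>-th coordinate of \<open>u\<close> in the localized quotient, provided
    \<open>K\<close> bounds \<open>n\<close> on the support of \<open>u\<close>.\<close>
  define LB where "LB K i = MB.scaled_pairing g n (\<lambda>m. c m i) K" for K i
  define LA where "LA K i = MA.scaled_pairing (f g) n (\<lambda>m. f (c m i)) K" for K i
  have LBcl: "LB K i u \<in> carrier B" if "i \<in> {..<d}" "u \<in> carrier BM" for K i u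
    unfolding LB_def using that by (intro MB.scaled_pairing_closed g c)
  have LAcl: "LA K i v \<in> carrier A" if "i \<in> {..<d}" "v \<in> carrier AM" for K i v
    unfolding LA_def using that by (intro MA.scaled_pairing_closed gA cA)
  have LApush: "LA K i (push u) = f (LB K i u)" if "i \<in> {..<d}" "u \<in> carrier BM" for K i u
    unfolding LA_def LB_def using that by (intro scaled_pairing_push g c)
  have divB: "((g [^]\<^bsub>B\<^esub> K) \<odot>\<^bsub>BM\<^esub> u) \<ominus>\<^bsub>BM\<^esub> lincomb BM {..<d} (\<lambda>i. LB K i u) e \<in> I"
    if "u \<in> carrier BM" "\<And>m. m \<in> supp B u \<Longrightarrow> n m \<le> K" for K u
    unfolding LB_def by (rule MB.division_with_denominators[OF IN g(1) finite_lessThan e' c rel that])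
  have divA: "((f g [^] K) \<odot>\<^bsub>AM\<^esub> v) \<ominus>\<^bsub>AM\<^esub> lincomb AM {..<d} (\<lambda>i. LA K i v) (\<lambda>i. push (e i)) \<in> ext I"
    if "v \<in> carrier AM" "\<And>m. m \<in> supp A v \<Longrightarrow> n m \<le> K" for K v
    unfolding LA_def
    by (rule MA.division_with_denominators[OF EN gA finite_lessThan push_closed[OF e'] cA relA that])
  show "\<exists>g\<in>carrier A - P'. \<exists>e\<in>{..<d} \<rightarrow> carrier AM.
       generates_mod A AM (ext I) g d e \<and> independent_mod A AM (ext I) g d e"
  proof (intro bexI[of _ "f g"] bexI[of _ "\<lambda>i. push (e i)"] conjI ballI impI allI)
    show "f g \<in> carrier A - P'" using g by simp
    show "(\<lambda>i. push (e i)) \<in> {..<d} \<rightarrow> carrier AM" using push_closed[OF e'] by (intro funcsetI)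
  next
    fix v assume v: "v \<in> carrier AM"
    obtain K where K: "\<forall>m\<in>supp A v. n m \<le> K" using finite_nat_bound[OF MA.in_carrierD(3)[OF v]] by blast
    show "\<exists>N::nat. \<exists>c\<in>{..<d} \<rightarrow> carrier A.
          ((f g [^] N) \<odot>\<^bsub>AM\<^esub> v) \<ominus>\<^bsub>AM\<^esub> lincomb AM {..<d} c (\<lambda>i. push (e i)) \<in> ext I"
      using divA[OF v bspec[OF K]] LAcl[OF _ v, of _ K]
      by (intro exI[of _ K] bexI[of _ "\<lambda>i. LA K i v"]) auto
  next
    fix a i assume a: "a \<in> {..<d} \<rightarrow> carrier A" and mem: "lincomb AM {..<d} a (\<lambda>i. push (e i)) \<in> ext I" and "i < d"
    then have i: "i \<in> {..<d}" by simp
    have a': "a j \<in> carrier A" if "j \<in> {..<d}" for j using a that by auto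
    have ci: "c m i \<in> carrier B" "f (c m i) \<in> carrier A" if "m \<in> carrier M" for m using c[OF that i] by auto
    interpret T: ideal "MA.R.torsion (f g)" A by (rule MA.R.torsion_ideal[OF gA])
    \<comment> \<open>The kernel of the \<open>i\<close>-th coordinate function over
      \<open>A\<close>, up to torsion. As an \<open>A\<close>-submodule it contains
      \<open>ext I\<close> once it contains the images of elements of \<open>I\<close>.\<close>
    define X where "X = {v \<in> carrier AM. \<exists>K0. \<forall>K\<ge>K0. LA K i v \<in> MA.R.torsion (f g)}"
    have X: "submodule X A AM"
      unfolding X_def LA_def using ci(2) by (rule MA.eventually_in_ideal_submodule[OF gA _ T.is_ideal])
    have "ext I \<subseteq> X"
    proof (rule extension_minimal_submodule[OF I X])
      fix u assume u: "u \<in> I"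
      have uc: "u \<in> carrier BM" by (rule ideal.Icarr[OF I u])
      obtain K0 where K0: "\<forall>m\<in>supp B u. n m \<le> K0" using finite_nat_bound[OF MB.in_carrierD(3)[OF uc]] by blast
      have "LA K i (push u) \<in> MA.R.torsion (f g)" if "K \<ge> K0" for K
      proof -
        have bd: "n m \<le> K" if "m \<in> supp B u" for m using bspec[OF K0 that] \<open>K \<ge> K0\<close> by simp
        have "lincomb BM {..<d} (\<lambda>i. LB K i u) e \<in> carrier BM"
          using LBcl[OF _ uc] e' by (intro MB.RM.M.finsum_closed) (auto intro!: MB.smult_closed)
        moreover have "(g [^]\<^bsub>B\<^esub> K) \<odot>\<^bsub>BM\<^esub> u \<in> I"
          using g(1) by (intro MB.RM.submodule_smult[OF IN _ u]) simp
        \<comment> \<open>Both \<open>g ^ K\<close> times \<open>u\<close> and its difference from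
          the combination lie in \<open>I\<close>, so the combination does, and independence over
          \<open>B\<close> makes its coefficients torsion.\<close>
        ultimately have "lincomb BM {..<d} (\<lambda>i. LB K i u) e \<in> I"
          by (rule MB.RM.submodule_minus_cancel'[OF IN _ _ divB[OF uc bd]])
        then have "LB K i u \<in> MB.R.torsion g"
          using bspec[OF indep, of "\<lambda>i. LB K i u"] LBcl[OF _ uc] i by (auto simp: MB.R.torsion_def)
        then show ?thesis
          unfolding LApush[OF i uc] using g(1) by (rule torsion_push)
      qed
      then show "push u \<in> X"
        unfolding X_def mem_Collect_eq using push_closed[OF uc] by blast
    qed
    then obtain K0 where K0: "\<And>K. K \<ge> K0 \<Longrightarrow> LA K i (lincomb AM {..<d} a (\<lambda>i. push (e i))) \<in> MA.R.torsion (f g)"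
      using mem unfolding X_def by blast
    obtain K1 where K1: "\<forall>m\<in>(\<Union>j\<in>{..<d}. supp B (e j)). n m \<le> K1"
      using finite_nat_bound[of "\<Union>j\<in>{..<d}. supp B (e j)" n] MB.in_carrierD(3)[OF e'] by blast
    \<comment> \<open>Large enough both for the eventual statement about the given relation and for
      the division of every \<open>e j\<close>.\<close>
    define K where "K = max K0 K1"
    have bd: "n m \<le> K" if "m \<in> supp B (e j)" "j \<in> {..<d}" for m j
      using K1 that unfolding K_def by fastforce
    have gp: "g [^]\<^bsub>B\<^esub> K \<in> carrier B" using g(1) by simp
    define \<delta> where "\<delta> k j = (if k = j then g [^]\<^bsub>B\<^esub> K else \<zero>\<^bsub>B\<^esub>)" for k j :: nat
    have \<delta>: "\<delta> k j \<in> carrier B" for k j using gp by (simp add: \<delta>_def)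
    \<comment> \<open>Division expresses \<open>g ^ K\<close> times \<open>e j\<close> through the
      family \<open>e\<close>, but it is already a multiple of \<open>e j\<close>. Comparing the two
      expressions modulo \<open>I\<close> by independence gives the Kronecker symbol times
      \<open>g ^ K\<close>, up to torsion.\<close>
    have basis: "\<delta> i j \<ominus>\<^bsub>B\<^esub> LB K i (e j) \<in> MB.R.torsion g" if j: "j \<in> {..<d}" for j
    proof -
      note LBj = LBcl[OF _ e'[OF j], of _ K]
      define y where "y k = \<delta> k j \<ominus>\<^bsub>B\<^esub> LB K k (e j)" for k
      have y: "y k \<in> carrier B" if "k \<in> {..<d}" for k using LBj[OF that] \<delta> by (simp add: y_def)
      let ?s = "lincomb BM {..<d} (\<lambda>k. LB K k (e j)) e" and ?t = "lincomb BM {..<d} y e"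
      have s: "?s \<in> carrier BM" and t: "?t \<in> carrier BM"
        using LBj y e' by (auto intro!: MB.smult_closed MB.RM.M.finsum_closed)
      have "?t \<oplus>\<^bsub>BM\<^esub> ?s = (\<Oplus>\<^bsub>BM\<^esub>k\<in>{..<d}. y k \<odot>\<^bsub>BM\<^esub> e k \<oplus>\<^bsub>BM\<^esub> LB K k (e j) \<odot>\<^bsub>BM\<^esub> e k)"
        using LBj y e' by (intro MB.RM.M.finsum_addf[symmetric]) (auto intro!: MB.smult_closed)
      also have "\<dots> = (\<Oplus>\<^bsub>BM\<^esub>k\<in>{..<d}. if j = k then (g [^]\<^bsub>B\<^esub> K) \<odot>\<^bsub>BM\<^esub> e k else \<zero>\<^bsub>BM\<^esub>)"
      proof (rule MB.RM.M.finsum_cong'[OF refl])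
        show "(\<lambda>k. if j = k then (g [^]\<^bsub>B\<^esub> K) \<odot>\<^bsub>BM\<^esub> e k else \<zero>\<^bsub>BM\<^esub>) \<in> {..<d} \<rightarrow> carrier BM"
          using gp e' by (auto intro!: MB.smult_closed)
        fix k assume k: "k \<in> {..<d}"
        have "y k \<odot>\<^bsub>BM\<^esub> e k \<oplus>\<^bsub>BM\<^esub> LB K k (e j) \<odot>\<^bsub>BM\<^esub> e k = (y k \<oplus>\<^bsub>B\<^esub> LB K k (e j)) \<odot>\<^bsub>BM\<^esub> e k"
          using y[OF k] LBj[OF k] e'[OF k] by (simp add: MB.RM.smult_l_distr)
        also have "y k \<oplus>\<^bsub>B\<^esub> LB K k (e j) = \<delta> k j"
          unfolding y_def using LBj[OF k] \<delta>[of k j] by (simp add: MB.R.minus_eq MB.R.a_assoc MB.R.l_neg)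
        finally show "y k \<odot>\<^bsub>BM\<^esub> e k \<oplus>\<^bsub>BM\<^esub> LB K k (e j) \<odot>\<^bsub>BM\<^esub> e k = (if j = k then (g [^]\<^bsub>B\<^esub> K) \<odot>\<^bsub>BM\<^esub> e k else \<zero>\<^bsub>BM\<^esub>)"
          using e'[OF k] by (simp add: \<delta>_def)
      qed
      also have "\<dots> = (g [^]\<^bsub>B\<^esub> K) \<odot>\<^bsub>BM\<^esub> e j"
        using gp e'[OF j] j by (intro MB.RM.M.finsum_delta[where f = "\<lambda>k. (g [^]\<^bsub>B\<^esub> K) \<odot>\<^bsub>BM\<^esub> e k"]) (auto intro!: MB.smult_closed)
      finally have "(?t \<oplus>\<^bsub>BM\<^esub> ?s) \<ominus>\<^bsub>BM\<^esub> ?s \<in> I" using divB[OF e'[OF j] bd[OF _ j]] by simp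
      moreover have "(?t \<oplus>\<^bsub>BM\<^esub> ?s) \<ominus>\<^bsub>BM\<^esub> ?s = ?t"
        using s t by (simp add: MB.RM.M.minus_eq MB.RM.M.a_assoc MB.RM.M.r_neg)
      ultimately have "y i \<in> MB.R.torsion g"
        using bspec[OF indep, of y] y i by (auto simp: MB.R.torsion_def)
      then show ?thesis by (simp only: y_def)
    qed
    let ?v = "lincomb AM {..<d} a (\<lambda>i. push (e i))"
    have "LA K i ?v = finsum A (\<lambda>j. LA K i (a j \<odot>\<^bsub>AM\<^esub> push (e j))) {..<d}"
      unfolding LA_def
    proof (intro MA.scaled_pairing_finsum gA ci)
      show "(\<lambda>j. a j \<odot>\<^bsub>AM\<^esub> push (e j)) \<in> {..<d} \<rightarrow> carrier AM"
        using a' push_closed[OF e'] by (intro funcsetI MA.smult_closed)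
    qed
    also have "\<dots> = finsum A (\<lambda>j. a j \<otimes> f (LB K i (e j))) {..<d}"
    proof (rule MA.R.finsum_cong'[OF refl])
      fix j assume j: "j \<in> {..<d}"
      have "LA K i (a j \<odot>\<^bsub>AM\<^esub> push (e j)) = a j \<otimes> LA K i (push (e j))"
        unfolding LA_def using push_closed[OF e'[OF j]] a'[OF j] by (intro MA.scaled_pairing_smult gA ci)
      then show "LA K i (a j \<odot>\<^bsub>AM\<^esub> push (e j)) = a j \<otimes> f (LB K i (e j))"
        by (simp only: LApush[OF i e'[OF j]])
    qed (use a' LBcl[OF i e'] in auto)
    finally have LAv: "LA K i ?v = finsum A (\<lambda>j. a j \<otimes> f (LB K i (e j))) {..<d}" .
    have diff: "a j \<otimes> f (\<delta> i j \<ominus>\<^bsub>B\<^esub> LB K i (e j)) \<in> MA.R.torsion (f g)" if j: "j \<in> {..<d}" for j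
      by (rule T.I_l_closed[OF torsion_push[OF basis[OF j] g(1)] a'[OF j]])
    \<comment> \<open>Splits \<open>(f g) ^ K\<close> times \<open>a i\<close> into
      \<open>LA K i\<close> of the relation, which is torsion by the choice of \<open>K\<close>, and
      a sum of errors that are torsion by \<open>basis\<close>.\<close>
    have "(f g [^] K) \<otimes> a i = finsum A (\<lambda>j. if i = j then (f g [^] K) \<otimes> a j else \<zero>) {..<d}"
      using i a'[OF i] gA by (intro MA.R.finsum_delta[where f = "\<lambda>j. (f g [^] K) \<otimes> a j", symmetric]) auto
    also have "\<dots> = finsum A (\<lambda>j. a j \<otimes> f (\<delta> i j \<ominus>\<^bsub>B\<^esub> LB K i (e j)) \<oplus> a j \<otimes> f (LB K i (e j))) {..<d}"
    proof (rule MA.R.finsum_cong'[OF refl])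
      fix j assume j: "j \<in> {..<d}"
      have "a j \<otimes> f (\<delta> i j \<ominus>\<^bsub>B\<^esub> LB K i (e j)) \<oplus> a j \<otimes> f (LB K i (e j)) =
          a j \<otimes> f ((\<delta> i j \<ominus>\<^bsub>B\<^esub> LB K i (e j)) \<oplus>\<^bsub>B\<^esub> LB K i (e j))"
        using a'[OF j] LBcl[OF i e'[OF j]] \<delta>[of i j] by (simp add: MA.R.r_distr)
      also have "(\<delta> i j \<ominus>\<^bsub>B\<^esub> LB K i (e j)) \<oplus>\<^bsub>B\<^esub> LB K i (e j) = \<delta> i j"
        using LBcl[OF i e'[OF j]] \<delta>[of i j] by (simp add: MB.R.minus_eq MB.R.a_assoc MB.R.l_neg)
      finally show "(if i = j then (f g [^] K) \<otimes> a j else \<zero>) =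
          a j \<otimes> f (\<delta> i j \<ominus>\<^bsub>B\<^esub> LB K i (e j)) \<oplus> a j \<otimes> f (LB K i (e j))"
        using a'[OF j] gA g(1) by (simp add: \<delta>_def f_pow MA.R.m_comm)
    qed (use a' LBcl[OF i e'] \<delta> in auto)
    also have "\<dots> = finsum A (\<lambda>j. a j \<otimes> f (\<delta> i j \<ominus>\<^bsub>B\<^esub> LB K i (e j))) {..<d} \<oplus> LA K i ?v"
      unfolding LAv using a' LBcl[OF i e'] \<delta> by (intro MA.R.finsum_addf) auto
    also have "\<dots> \<in> MA.R.torsion (f g)"
      by (intro T.a_closed T.finsum_mem diff K0 finite_lessThan) (simp_all add: K_def)
    finally have "a i \<in> MA.R.torsion (f g)" by (rule MA.R.torsion_pow_cancel[OF _ gA a'[OF i]])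
    then show "\<exists>N::nat. (f g [^] N) \<otimes> a i = \<zero>" unfolding MA.R.torsion_def mem_Collect_eq by (rule conjunct2)
  qed
qed

lemma spanning_extension:
  assumes I: "ideal I BM"
    and E: "\<And>P'. primeideal P' A \<Longrightarrow> \<exists>s\<in>carrier B. f s \<notin> P' \<and> MB.spans_after \<Delta> I s"
    and v: "v \<in> carrier AM"
  shows "\<exists>w\<in>MA.supported \<Delta>. v \<ominus>\<^bsub>AM\<^esub> w \<in> ext I"
proof -
  define N where "N = {p \<in> carrier AM. \<exists>w\<in>MA.supported \<Delta>. p \<ominus>\<^bsub>AM\<^esub> w \<in> ext I}"
  have N: "submodule N A AM"
    unfolding N_def by (rule MA.submodule_supported_add[OF MA.RM.ideal_submodule[OF extension_ideal[OF I]]])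
  have mono: "monomial A m \<in> N" if m: "m \<in> carrier M" for m
  proof (rule ccontr)
    assume notin: "monomial A m \<notin> N"
    define \<aa> where "\<aa> = {a \<in> carrier A. a \<odot>\<^bsub>AM\<^esub> monomial A m \<in> N}"
    have "ideal \<aa> A"
    proof (rule idealI[OF MA.R.ring_axioms])
      show "subgroup \<aa> (add_monoid A)"
      proof (rule group.subgroupI[OF MA.R.a_group])
        have "\<zero> \<in> \<aa>" using m MA.RM.submodule_zero[OF N] by (simp add: \<aa>_def)
        then show "\<aa> \<noteq> {}" by blast
        fix a assume a: "a \<in> \<aa>"
        then have "(\<ominus> a) \<odot>\<^bsub>AM\<^esub> monomial A m \<in> N"
          using m MA.RM.submoduleE(3)[OF N] by (simp add: \<aa>_def MA.RM.smult_l_minus)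
        then show "inv\<^bsub>add_monoid A\<^esub> a \<in> \<aa>" using a by (simp add: \<aa>_def a_inv_def[symmetric])
        fix b assume "b \<in> \<aa>"
        then show "a \<otimes>\<^bsub>add_monoid A\<^esub> b \<in> \<aa>"
          using a m MA.RM.submodule_add[OF N] by (simp add: \<aa>_def MA.RM.smult_l_distr)
      qed (auto simp: \<aa>_def)
      fix a x assume a: "a \<in> \<aa>" and x: "x \<in> carrier A"
      show "x \<otimes> a \<in> \<aa>"
        using a x m MA.RM.submodule_smult[OF N x] by (simp add: \<aa>_def MA.RM.smult_assoc1)
      then show "a \<otimes> x \<in> \<aa>" using a x by (simp add: \<aa>_def MA.R.m_comm)
    qed
    moreover have "\<one> \<notin> \<aa>" using notin m by (simp add: \<aa>_def)
    ultimately obtain P' where P': "primeideal P' A" "\<aa> \<subseteq> P'"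
      using MA.R.exists_prime_above by blast
    obtain s where s: "s \<in> carrier B" "f s \<notin> P'" and
      sE: "MB.spans_after \<Delta> I s"
      using E[OF P'(1)] by blast
    \<comment> \<open>Pushed forward, this relation for \<open>m\<close> puts \<open>f s ^ k\<close>
      into \<open>\<aa>\<close>, hence into \<open>P'\<close>, against the choice of
      \<open>s\<close>.\<close>
    obtain k :: nat and w where w: "w \<in> MB.supported \<Delta>" and rel: "((s [^]\<^bsub>B\<^esub> k) \<odot>\<^bsub>BM\<^esub> monomial B m) \<ominus>\<^bsub>BM\<^esub> w \<in> I"
      using bspec[OF sE MB.monomial_closed[OF m]] by blast
    have wc: "w \<in> carrier BM" using w MB.supported_props(1) by blast
    have skc: "(s [^]\<^bsub>B\<^esub> k) \<odot>\<^bsub>BM\<^esub> monomial B m \<in> carrier BM" using s m by (intro MB.smult_closed) auto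
    have "push w \<in> MA.supported \<Delta>"
      using w push_closed[OF wc] by (auto simp: MA.supported_def MB.supported_def)
    moreover have "push (((s [^]\<^bsub>B\<^esub> k) \<odot>\<^bsub>BM\<^esub> monomial B m) \<ominus>\<^bsub>BM\<^esub> w) = ((f s [^] k) \<odot>\<^bsub>AM\<^esub> monomial A m) \<ominus>\<^bsub>AM\<^esub> push w"
    proof -
      have "push (((s [^]\<^bsub>B\<^esub> k) \<odot>\<^bsub>BM\<^esub> monomial B m) \<ominus>\<^bsub>BM\<^esub> w) = push ((s [^]\<^bsub>B\<^esub> k) \<odot>\<^bsub>BM\<^esub> monomial B m) \<oplus>\<^bsub>AM\<^esub> \<ominus>\<^bsub>AM\<^esub> push w"
        unfolding MB.RM.M.minus_eq
        using push.hom_add[OF skc MB.RM.M.a_inv_closed[OF wc]] push.hom_a_inv[OF wc] by (simp only:)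
      then show ?thesis
        using s m by (simp add: MA.RM.M.minus_eq push_smult f_pow push_monomial)
    qed
    moreover note extension_push[OF I rel]
    ultimately have "(f s [^] k) \<odot>\<^bsub>AM\<^esub> monomial A m \<in> N"
      unfolding N_def using s m by (auto intro!: MA.smult_closed)
    then have "f s [^] k \<in> P'" using P'(2) s(1) by (auto simp: \<aa>_def)
    then show False using primeideal.pow_mem[OF P'(1)] s by auto
  qed
  have "v \<in> N"
  proof (rule MA.supported_in_submodule[OF N])
    show "v \<in> MA.supported UNIV" using v by (simp add: MA.supported_def)
    show "monomial A m \<in> N" if "m \<in> carrier M" for m using that by (rule mono)
  qed
  then show ?thesis by (simp add: N_def)
qed

text \<open>The map to the fraction field is used only through numerators: \<open>LB K u\<close>
  stands for \<open>s ^ K\<close> times the coefficient of \<open>y\<close> in \<open>u\<close>, and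
  vanishing is membership in \<open>P\<close>, or in \<open>P'\<close> after base change. As the
  span fills everything over \<open>A\<close>, the coefficient of \<open>y\<close> in
  \<open>y\<close> itself would have to vanish, although it is 1.\<close>

lemma spanning_extension_imp:
  assumes I: "ideal I BM" and lf: "locally_free_quotient B BM I d" and P': "primeideal P' A"
    and span: "\<And>v. v \<in> carrier AM \<Longrightarrow> \<exists>w\<in>MA.supported \<Delta>. v \<ominus>\<^bsub>AM\<^esub> w \<in> ext I"
  shows "\<exists>s\<in>carrier B. f s \<notin> P' \<and> MB.spans_after \<Delta> I s"
proof -
  define P where "P = {b \<in> carrier B. f b \<in> P'}"
  interpret P: primeideal P B unfolding P_def by (rule primeideal_preimage[OF P'])
  interpret P': primeideal P' A by (rule P')
  note IN = MB.RM.ideal_submodule[OF I]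
  define N0 where "N0 = {p \<in> carrier BM. \<exists>w\<in>MB.supported \<Delta>. p \<ominus>\<^bsub>BM\<^esub> w \<in> I}"
  have N0: "submodule N0 B BM" unfolding N0_def by (rule MB.submodule_supported_add[OF IN])
  have I_N0: "I \<subseteq> N0"
  proof
    fix u assume u: "u \<in> I"
    then have uc: "u \<in> carrier BM" by (rule ideal.Icarr[OF I])
    show "u \<in> N0" unfolding N0_def
      using u uc MB.RM.M.minus_zero_right[OF uc] MB.supported_props(2) by (auto intro!: bexI[of _ "\<zero>\<^bsub>BM\<^esub>"])
  qed
  have S_N0: "MB.supported \<Delta> \<subseteq> N0"
  proof
    fix u assume u: "u \<in> MB.supported \<Delta>"
    then have uc: "u \<in> carrier BM" using MB.supported_props(1) by blast
    have d: "u \<ominus>\<^bsub>BM\<^esub> u \<in> I" using MB.RM.M.minus_eq_zero_iff[OF uc uc] MB.RM.submodule_zero[OF IN] by simp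
    then show "u \<in> N0" unfolding N0_def using u uc by blast
  qed
  obtain g e where g: "g \<in> carrier B - P" and e: "e \<in> {..<d} \<rightarrow> carrier BM"
    and gen: "generates_mod B BM I g d e"
    using lf[unfolded locally_free_quotient_def, rule_format, OF P.primeideal] by auto
  have gen': "generates_mod B BM N0 g d e"
    using gen I_N0 by blast
  have e': "\<forall>i<d. e i \<in> carrier BM" using e by auto
  from MB.RM.submodule_exchange[where d = d and e = e and s = g, OF N0 P.primeideal e' g gen']
  show ?thesis
  proof (rule disjE)
    assume "\<exists>s\<in>carrier B - P. \<forall>q\<in>carrier BM. \<exists>k::nat. (s [^]\<^bsub>B\<^esub> k) \<odot>\<^bsub>BM\<^esub> q \<in> N0"
    then obtain s where s: "s \<in> carrier B - P" and all: "\<forall>q\<in>carrier BM. \<exists>k::nat. (s [^]\<^bsub>B\<^esub> k) \<odot>\<^bsub>BM\<^esub> q \<in> N0"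
      by (elim bexE)
    show ?thesis
    proof (intro bexI[of _ s] conjI ballI)
      show sB: "s \<in> carrier B" using s by (rule DiffD1)
      show "f s \<notin> P'" using DiffD2[OF s] sB unfolding P_def mem_Collect_eq by blast
      fix q assume "q \<in> carrier BM"
      from bspec[OF all this] show "\<exists>k::nat. \<exists>w\<in>MB.supported \<Delta>. ((s [^]\<^bsub>B\<^esub> k) \<odot>\<^bsub>BM\<^esub> q) \<ominus>\<^bsub>BM\<^esub> w \<in> I"
        unfolding N0_def mem_Collect_eq by (elim exE conjE) (rule exI)
    qed
  next
    assume "\<exists>N. \<exists>s\<in>carrier B - P. \<exists>m\<in>carrier BM. submodule N B BM \<and> N0 \<subseteq> N \<and>
      (\<forall>q\<in>carrier BM. \<exists>k::nat. \<exists>b\<in>carrier B. ((s [^]\<^bsub>B\<^esub> k) \<odot>\<^bsub>BM\<^esub> q) \<ominus>\<^bsub>BM\<^esub> (b \<odot>\<^bsub>BM\<^esub> m) \<in> N) \<and>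
      (\<forall>b\<in>carrier B. b \<odot>\<^bsub>BM\<^esub> m \<in> N \<longrightarrow> b \<in> P)"
    then obtain N s y where s: "s \<in> carrier B" "s \<notin> P" and y: "y \<in> carrier BM" and N: "submodule N B BM" and N0N: "N0 \<subseteq> N"
      and gen: "\<forall>q\<in>carrier BM. \<exists>k::nat. \<exists>b\<in>carrier B. ((s [^]\<^bsub>B\<^esub> k) \<odot>\<^bsub>BM\<^esub> q) \<ominus>\<^bsub>BM\<^esub> (b \<odot>\<^bsub>BM\<^esub> y) \<in> N"
      and prime: "\<forall>b\<in>carrier B. b \<odot>\<^bsub>BM\<^esub> y \<in> N \<longrightarrow> b \<in> P" by (elim exE bexE conjE DiffE)
    have "\<forall>m\<in>carrier M. \<exists>k::nat. \<exists>b. b \<in> carrier B \<and> ((s [^]\<^bsub>B\<^esub> k) \<odot>\<^bsub>BM\<^esub> monomial B m) \<ominus>\<^bsub>BM\<^esub> (b \<odot>\<^bsub>BM\<^esub> y) \<in> N"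
      using gen MB.monomial_closed by blast
    from bchoice2[OF this] obtain n :: "'m \<Rightarrow> nat" and c where
      c: "\<And>m. m \<in> carrier M \<Longrightarrow> c m \<in> carrier B" and
      rel: "\<And>m. m \<in> carrier M \<Longrightarrow> ((s [^]\<^bsub>B\<^esub> n m) \<odot>\<^bsub>BM\<^esub> monomial B m) \<ominus>\<^bsub>BM\<^esub> (c m \<odot>\<^bsub>BM\<^esub> y) \<in> N"
      by blast
    have cA: "f (c m) \<in> carrier A" if "m \<in> carrier M" for m using c[OF that] by simp
    note sA = f.hom_closed[OF s(1)]
    define LB where "LB = MB.scaled_pairing s n c"
    define LA where "LA = MA.scaled_pairing (f s) n (\<lambda>m. f (c m))"
    have LBcl: "LB K u \<in> carrier B" if "u \<in> carrier BM" for K u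
      unfolding LB_def using that by (intro MB.scaled_pairing_closed s c)
    \<comment> \<open>A one-element index set turns the combination of the division lemma into a
      single multiple of \<open>y\<close>.\<close>
    have one: "lincomb BM {()} (\<lambda>i. b) (\<lambda>i. y) = b \<odot>\<^bsub>BM\<^esub> y" if "b \<in> carrier B" for b
      using that y by (subst MB.RM.M.finsum_insert) (auto intro!: MB.smult_closed)
    have divB: "((s [^]\<^bsub>B\<^esub> K) \<odot>\<^bsub>BM\<^esub> u) \<ominus>\<^bsub>BM\<^esub> (LB K u \<odot>\<^bsub>BM\<^esub> y) \<in> N"
      if u: "u \<in> carrier BM" "\<And>m. m \<in> supp B u \<Longrightarrow> n m \<le> K" for K u
    proof -
      have "((s [^]\<^bsub>B\<^esub> K) \<odot>\<^bsub>BM\<^esub> u) \<ominus>\<^bsub>BM\<^esub> lincomb BM {()} (\<lambda>i. LB K u) (\<lambda>i. y) \<in> N"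
        unfolding LB_def using c rel one
        by (intro MB.division_with_denominators[OF N s(1) _ y _ _ u, where c = "\<lambda>m i. c m"]) auto
      then show ?thesis by (simp only: one[OF LBcl[OF u(1)]])
    qed
    have LApush: "LA K (push u) = f (LB K u)" if "u \<in> carrier BM" for K u
      unfolding LA_def LB_def using that by (intro scaled_pairing_push s c)
    \<comment> \<open>The polynomials over \<open>A\<close> whose coefficient of \<open>y\<close>
      vanishes at \<open>P'\<close>. The set receives the images of \<open>N\<close>, and hence
      contains \<open>ext I\<close> and the span of \<Delta>.\<close>
    define X where "X = {v \<in> carrier AM. \<exists>K0. \<forall>K\<ge>K0. LA K v \<in> P'}"
    have X: "submodule X A AM"
      unfolding X_def LA_def using cA by (rule MA.eventually_in_ideal_submodule[OF sA _ P'.is_ideal])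
    have pushN: "push u \<in> X" if u: "u \<in> N" for u
    proof -
      have uc: "u \<in> carrier BM" by (rule MB.RM.submodule_carrier[OF N u])
      obtain K0 where K0: "\<forall>m\<in>supp B u. n m \<le> K0" using finite_nat_bound[OF MB.in_carrierD(3)[OF uc]] by blast
      have "LA K (push u) \<in> P'" if "K \<ge> K0" for K
      proof -
        have bd: "n m \<le> K" if "m \<in> supp B u" for m using bspec[OF K0 that] \<open>K \<ge> K0\<close> by simp
        have "(s [^]\<^bsub>B\<^esub> K) \<odot>\<^bsub>BM\<^esub> u \<in> N"
          using s(1) by (intro MB.RM.submodule_smult[OF N _ u]) simp
        moreover have "LB K u \<odot>\<^bsub>BM\<^esub> y \<in> carrier BM" using LBcl[OF uc] y by (intro MB.smult_closed)
        ultimately have "LB K u \<odot>\<^bsub>BM\<^esub> y \<in> N"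
          using MB.RM.submodule_minus_cancel'[OF N _ _ divB[OF uc bd]] by blast
        then have "LB K u \<in> P" using prime LBcl[OF uc] by blast
        then show ?thesis unfolding LApush[OF uc] P_def by blast
      qed
      then show ?thesis unfolding X_def mem_Collect_eq using push_closed[OF uc] by blast
    qed
    have extX: "ext I \<subseteq> X"
      using I_N0 N0N pushN by (intro extension_minimal_submodule[OF I X]) blast
    have supX: "w \<in> X" if w: "w \<in> MA.supported \<Delta>" for w
    proof (rule MA.supported_in_submodule[OF X _ w])
      fix m assume m: "m \<in> \<Delta>" "m \<in> carrier M"
      then have "monomial B m \<in> MB.supported \<Delta>"
        using MB.monomial_closed[OF m(2)] by (auto simp: MB.supported_def monomial_def)
      then have "push (monomial B m) \<in> X" using S_N0 N0N by (intro pushN) auto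
      then show "monomial A m \<in> X" by (simp only: push_monomial)
    qed
    obtain w where w: "w \<in> MA.supported \<Delta>" "push y \<ominus>\<^bsub>AM\<^esub> w \<in> ext I" using span[OF push_closed[OF y]] by blast
    have "push y \<in> X"
      using MA.RM.submodule_minus_cancel[OF X push_closed[OF y] supX[OF w(1)]] w(2) extX by blast
    then obtain K0 where K0: "\<And>K. K \<ge> K0 \<Longrightarrow> LA K (push y) \<in> P'" unfolding X_def by blast
    obtain K1 where K1: "\<forall>m\<in>supp B y. n m \<le> K1" using finite_nat_bound[OF MB.in_carrierD(3)[OF y]] by blast
    define K where "K = max K0 K1"
    have bd: "n m \<le> K" if "m \<in> supp B y" for m using bspec[OF K1 that] unfolding K_def by simp
    have "K0 \<le> K" by (simp add: K_def)
    from K0[OF this] have LP: "LB K y \<in> P" unfolding LApush[OF y] P_def using LBcl[OF y] by blast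
    have sK: "s [^]\<^bsub>B\<^esub> K \<in> carrier B" using s by simp
    \<comment> \<open>Dividing \<open>y\<close> by itself shows that \<open>LB K y\<close> agrees
      with \<open>s ^ K\<close> modulo \<open>P\<close>. As \<open>LB K y\<close> also lies in
      \<open>P\<close>, so does \<open>s\<close>, a contradiction.\<close>
    have "((s [^]\<^bsub>B\<^esub> K) \<ominus>\<^bsub>B\<^esub> LB K y) \<odot>\<^bsub>BM\<^esub> y = ((s [^]\<^bsub>B\<^esub> K) \<odot>\<^bsub>BM\<^esub> y) \<ominus>\<^bsub>BM\<^esub> (LB K y \<odot>\<^bsub>BM\<^esub> y)"
      using sK LBcl[OF y] y
      by (simp add: MB.R.minus_eq MB.RM.M.minus_eq MB.RM.smult_l_distr MB.RM.smult_l_minus)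
    then have "((s [^]\<^bsub>B\<^esub> K) \<ominus>\<^bsub>B\<^esub> LB K y) \<odot>\<^bsub>BM\<^esub> y \<in> N" using divB[OF y bd] by simp
    then have diff: "(s [^]\<^bsub>B\<^esub> K) \<ominus>\<^bsub>B\<^esub> LB K y \<in> P" using prime sK LBcl[OF y] by blast
    have "s [^]\<^bsub>B\<^esub> K = ((s [^]\<^bsub>B\<^esub> K) \<ominus>\<^bsub>B\<^esub> LB K y) \<oplus>\<^bsub>B\<^esub> LB K y"
      using sK LBcl[OF y, of K] by (simp add: MB.R.minus_eq MB.R.a_assoc MB.R.l_neg)
    also have "\<dots> \<in> P" by (rule P.a_closed[OF diff LP])
    finally have "s \<in> P" by (rule P.pow_mem[OF s(1)])
    then show ?thesis using s(2) by blast
  qed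
qed

end

section \<open>The Hilbert functors as functors of ideals\<close>

text \<open>Phrased through values on the carrier, since the identity morphisms of the category are
  restricted functions.\<close>

lemma extension_id:
  assumes A: "cring A" and M: "comm_monoid M" and I: "ideal I (monoid_algebra A M)"
    and f: "f \<in> ring_hom A A" and id: "\<And>a. a \<in> carrier A \<Longrightarrow> f a = a"
  shows "extension f A M I = I"
proof -
  interpret A: cring A by fact
  interpret M: comm_monoid M by fact
  interpret base_change A A M f by unfold_locales (rule f)
  have push: "push u = u" if "u \<in> I" for u
    using MB.in_carrierD(1)[OF ideal.Icarr[OF I that]] id by auto
  show ?thesis
  proof
    show "ext I \<subseteq> I" by (rule extension_minimal_ideal[OF I I]) (simp only: push)
    show "I \<subseteq> ext I"
    proof
      fix u assume u: "u \<in> I"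
      from extension_push[OF I u] show "u \<in> ext I" by (simp only: push[OF u])
    qed
  qed
qed

text \<open>Both inclusions come from minimality of the extended ideal. In the second one the
  elements pushed to \<open>C\<close> lie in an extended ideal themselves, which calls for a further
  induction on their construction.\<close>

lemma extension_comp:
  assumes f: "base_change B A M f" and g: "base_change A C M g" and h: "base_change B C M h"
    and comp: "\<And>b. b \<in> carrier B \<Longrightarrow> h b = g (f b)"
    and I: "ideal I (monoid_algebra B M)"
  shows "extension h C M I = extension g C M (extension f A M I)"
proof -
  interpret f: base_change B A M f by fact
  interpret g: base_change A C M g by fact
  interpret h: base_change B C M h by fact
  note If = f.extension_ideal[OF I]
  have push: "h.push u = g.push (f.push u)" if "u \<in> I" for u
    using f.MB.in_carrierD(1)[OF ideal.Icarr[OF I that]] comp by auto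
  show ?thesis
  proof
    show "h.ext I \<subseteq> g.ext (f.ext I)"
    proof (rule h.extension_minimal_ideal[OF I g.extension_ideal[OF If]])
      fix u assume u: "u \<in> I"
      show "h.push u \<in> g.ext (f.ext I)"
        unfolding push[OF u] by (rule g.extension_push[OF If f.extension_push[OF I u]])
    qed
    note J = h.extension_ideal[OF I]
    show "g.ext (f.ext I) \<subseteq> h.ext I"
    proof (rule g.extension_minimal_ideal[OF If J])
      fix v assume "v \<in> f.ext I"
      then show "g.push v \<in> h.ext I"
      proof (induction rule: extension.induct)
        case zero
        show ?case unfolding g.push.hom_zero by (rule extension.zero)
      next
        case (step p a u)
        have u: "u \<in> carrier f.BM" by (rule ideal.Icarr[OF I step.hyps(3)])
        have pu: "f.push u \<in> carrier f.AM" by (rule f.push_closed[OF u])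
        have "g.push (p \<oplus>\<^bsub>f.AM\<^esub> (a \<odot>\<^bsub>f.AM\<^esub> f.push u)) = g.push p \<oplus>\<^bsub>g.AM\<^esub> g.push (a \<odot>\<^bsub>f.AM\<^esub> f.push u)"
          using f.extension_carrier[OF I step.hyps(1)] f.MA.smult_closed[OF step.hyps(2) pu]
          by (rule g.push.hom_add)
        also have "g.push (a \<odot>\<^bsub>f.AM\<^esub> f.push u) = g a \<odot>\<^bsub>g.AM\<^esub> h.push u"
          unfolding g.push_smult[OF step.hyps(2) pu] push[OF step.hyps(3)] ..
        finally show ?case
          using extension.step[OF step.IH g.f.hom_closed[OF step.hyps(2)] step.hyps(3)] by simp
      qed
    qed
  qed
qed

lemma algebra_imp_cring: "algebra k B \<Longrightarrow> cring B"
  by (rule algebra.M_cring)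

lemma hom_set_ring_hom: "f \<in> hom_set k B A \<Longrightarrow> f \<in> ring_hom B A"
  by (simp add: hom_set_def alg_hom_def)

lemma base_change_hom_set:
  assumes "algebra k B" "algebra k A" "f \<in> hom_set k B A"
  shows "base_change B A (exponents n) f"
proof -
  interpret B: cring B using assms by (intro algebra_imp_cring)
  interpret A: cring A using assms by (intro algebra_imp_cring)
  interpret M: comm_monoid "exponents n" by (rule comm_monoid_exponents)
  show ?thesis by unfold_locales (rule hom_set_ring_hom[OF assms(3)])
qed

lemma hom_set_id: "algebra k B \<Longrightarrow> (\<lambda>b\<in>carrier B. b) \<in> hom_set k B B"
proof -
  assume "algebra k B"
  then interpret algebra k B .
  show ?thesis by (auto simp: hom_set_def alg_hom_def intro!: ring_hom_memI)
qed

lemma hom_set_compose: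
  assumes "algebra k B" "f \<in> hom_set k B A" "g \<in> hom_set k A C"
  shows "compose (carrier B) g f \<in> hom_set k B C"
proof -
  interpret algebra k B by fact
  have f: "f \<in> ring_hom B A" and g: "g \<in> ring_hom A C" using assms hom_set_ring_hom by blast+
  have fs: "f (r \<odot>\<^bsub>B\<^esub> b) = r \<odot>\<^bsub>A\<^esub> f b" if "r \<in> carrier k" "b \<in> carrier B" for r b
    using assms that by (auto simp: hom_set_def alg_hom_def)
  have gs: "g (r \<odot>\<^bsub>A\<^esub> b) = r \<odot>\<^bsub>C\<^esub> g b" if "r \<in> carrier k" "b \<in> carrier A" for r b
    using assms that by (auto simp: hom_set_def alg_hom_def)
  show ?thesis
    unfolding hom_set_def alg_hom_def
    by (auto intro!: ring_hom_memI simp: compose_eq ring_hom_closed[OF f] ring_hom_closed[OF g]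
        ring_hom_mult[OF f] ring_hom_mult[OF g] ring_hom_add[OF f] ring_hom_add[OF g]
        ring_hom_one[OF f] ring_hom_one[OF g] fs gs)
qed

lemma kernel_base_change_map:
  assumes f: "base_change B A (exponents n) f" and h: "hilb_surjection n d B Q \<phi>"
  shows "a_kernel (mpoly_ring n A) (tensor_ring f B A Q) (base_change_map f B A Q \<phi>) =
    extension f A (exponents n) (a_kernel (mpoly_ring n B) Q \<phi>)"
proof -
  interpret base_change B A "exponents n" f by (rule f)
  have s: "algebra_surjection B BM Q \<phi> (a_kernel BM Q \<phi>)"
    using hilb_surjection_imp_algebra_surjection[OF MB.R.cring_axioms h] by (simp only: mpoly_ring_def)
  have "base_change_map f B A Q \<phi> = monoid_base_change_map f B A Q \<phi>"
    by (intro ext) (simp only: base_change_map_def monoid_base_change_map_def)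
  then show ?thesis
    using tensor_map_kernel[OF s] by (simp only: mpoly_ring_def)
qed

text \<open>The definite description is legitimate because the kernel of the base-changed map
  depends on \<open>I\<close> alone, whichever \<open>Q\<close> and \<open>\<phi>\<close> represent
  the point; one representative exists because \<open>I\<close> is a point of the functor.\<close>

lemma hilb_map_eq_extension:
  fixes B A :: "('k, 'b) module"
  assumes f: "base_change B A (exponents n) f" and I: "I \<in> fobj (Hilb n d) B"
  shows "hilb_map n d B A f I = extension f A (exponents n) I"
  unfolding hilb_map_def
proof (rule the_equality)
  from I obtain Q :: "('b, ((nat \<Rightarrow> nat) \<Rightarrow> 'b) set) module" and \<phi>
    where h: "hilb_surjection n d B Q \<phi>" and I: "I = a_kernel (mpoly_ring n B) Q \<phi>"
    by (auto simp: Hilb_def)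
  show "\<exists>(Q :: ('b, ((nat \<Rightarrow> nat) \<Rightarrow> 'b) set) module) \<phi>. hilb_surjection n d B Q \<phi> \<and> a_kernel (mpoly_ring n B) Q \<phi> = I \<and>
    extension f A (exponents n) I = a_kernel (mpoly_ring n A) (tensor_ring f B A Q) (base_change_map f B A Q \<phi>)"
    by (intro exI conjI, rule h, rule I[symmetric]) (simp only: I kernel_base_change_map[OF f h])
next
  fix J assume "\<exists>(Q :: ('b, ((nat \<Rightarrow> nat) \<Rightarrow> 'b) set) module) \<phi>. hilb_surjection n d B Q \<phi> \<and> a_kernel (mpoly_ring n B) Q \<phi> = I \<and>
    J = a_kernel (mpoly_ring n A) (tensor_ring f B A Q) (base_change_map f B A Q \<phi>)"
  then obtain Q :: "('b, ((nat \<Rightarrow> nat) \<Rightarrow> 'b) set) module" and \<phi> where h: "hilb_surjection n d B Q \<phi>"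
    and "a_kernel (mpoly_ring n B) Q \<phi> = I"
    "J = a_kernel (mpoly_ring n A) (tensor_ring f B A Q) (base_change_map f B A Q \<phi>)"
    by (elim exE conjE)
  then show "J = extension f A (exponents n) I"
    using kernel_base_change_map[OF f h] by simp
qed

lemma Hilb_extension:
  fixes B A :: "('k, 'b) module"
  assumes f: "base_change B A (exponents n) f" and I: "I \<in> fobj (Hilb n d) B"
  shows "extension f A (exponents n) I \<in> fobj (Hilb n d) A"
proof -
  interpret base_change B A "exponents n" f by (rule f)
  have "ideal I BM" "locally_free_quotient B BM I d"
    using I unfolding Hilb_iff[OF MB.R.cring_axioms] by (simp_all only: mpoly_ring_def)
  then show ?thesis
    unfolding Hilb_iff[OF MA.R.cring_axioms] mpoly_ring_def
    using extension_ideal locally_free_extension by blast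
qed

lemma monomial_span_eq:
  assumes "monoid_algebra_over B (exponents n)"
  shows "monomial_span n \<Delta> B = monoid_algebra_over.supported B (exponents n) \<Delta>"
proof -
  interpret monoid_algebra_over B "exponents n" by fact
  show ?thesis by (simp add: monomial_span_def supported_def mpoly_ring_def)
qed

text \<open>Spanning over \<open>B\<close> is spanning after inverting 1, so the criterion over the
  primes of \<open>A\<close> is met with the same \<open>s\<close> everywhere.\<close>

lemma Hilb_Delta_extension:
  fixes B A :: "('k, 'b) module"
  assumes bc: "base_change B A (exponents n) f" and I: "I \<in> fobj (Hilb_Delta n d \<Delta>) B"
  shows "extension f A (exponents n) I \<in> fobj (Hilb_Delta n d \<Delta>) A"
proof -
  interpret base_change B A "exponents n" f by (rule bc)
  have IH: "I \<in> fobj (Hilb n d) B" and span: "\<forall>p\<in>carrier BM. \<exists>w\<in>MB.supported \<Delta>. p \<ominus>\<^bsub>BM\<^esub> w \<in> I"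
    using I unfolding Hilb_Delta_iff[OF MB.R.cring_axioms] monomial_span_eq[OF MB.monoid_algebra_over_axioms] mpoly_ring_def
    by blast+
  have I': "ideal I BM"
    using IH unfolding Hilb_iff[OF MB.R.cring_axioms] by (simp only: mpoly_ring_def)
  have "\<exists>w\<in>MA.supported \<Delta>. v \<ominus>\<^bsub>AM\<^esub> w \<in> ext I" if v: "v \<in> carrier AM" for v
  proof (rule spanning_extension[OF I' _ v])
    fix P' assume "primeideal P' A"
    then interpret P': primeideal P' A .
    show "\<exists>s\<in>carrier B. f s \<notin> P' \<and> MB.spans_after \<Delta> I s"
    proof (intro bexI[of _ "\<one>\<^bsub>B\<^esub>"] conjI ballI exI[of _ "0::nat"])
      show "f \<one>\<^bsub>B\<^esub> \<notin> P'" using P'.one_imp_carrier P'.I_notcarr by auto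
      fix q assume "q \<in> carrier BM"
      then show "\<exists>w\<in>MB.supported \<Delta>. ((\<one>\<^bsub>B\<^esub> [^]\<^bsub>B\<^esub> (0::nat)) \<odot>\<^bsub>BM\<^esub> q) \<ominus>\<^bsub>BM\<^esub> w \<in> I"
        using span by simp
    qed simp
  qed
  then show ?thesis
    using Hilb_extension[OF bc IH]
    unfolding Hilb_Delta_iff[OF MA.R.cring_axioms] monomial_span_eq[OF MA.monoid_algebra_over_axioms] mpoly_ring_def
    by blast
qed

lemma Hilb_Delta_subset:
  fixes B :: "('k, 'b) module"
  shows "cring B \<Longrightarrow> I \<in> fobj (Hilb_Delta n d \<Delta>) B \<Longrightarrow> I \<in> fobj (Hilb n d) B"
  by (simp add: Hilb_Delta_iff)

lemma hilb_map_id: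
  fixes B :: "('k, 'b) module"
  assumes B: "algebra k B" and I: "I \<in> fobj (Hilb n d) B"
  shows "hilb_map n d B B (\<lambda>b\<in>carrier B. b) I = I"
proof -
  have "ideal I (monoid_algebra B (exponents n))"
    using I unfolding Hilb_iff[OF algebra_imp_cring[OF B]] by (simp only: mpoly_ring_def)
  then show ?thesis
    unfolding hilb_map_eq_extension[OF base_change_hom_set[OF B B hom_set_id[OF B]] I]
    by (intro extension_id algebra_imp_cring[OF B] comm_monoid_exponents hom_set_ring_hom[OF hom_set_id[OF B]]) simp_all
qed

lemma hilb_map_compose:
  fixes B A C :: "('k, 'b) module"
  assumes alg: "algebra k B" "algebra k A" "algebra k C" and f: "f \<in> hom_set k B A" and g: "g \<in> hom_set k A C"
    and I: "I \<in> fobj (Hilb n d) B"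
  shows "hilb_map n d B C (compose (carrier B) g f) I = hilb_map n d A C g (hilb_map n d B A f I)"
proof -
  note bf = base_change_hom_set[OF alg(1,2) f] and bg = base_change_hom_set[OF alg(2,3) g]
    and bh = base_change_hom_set[OF alg(1,3) hom_set_compose[OF alg(1) f g]]
  have I': "ideal I (monoid_algebra B (exponents n))"
    using I unfolding Hilb_iff[OF algebra_imp_cring[OF alg(1)]] by (simp only: mpoly_ring_def)
  show ?thesis
    unfolding hilb_map_eq_extension[OF bh I] hilb_map_eq_extension[OF bf I]
      hilb_map_eq_extension[OF bg Hilb_extension[OF bf I]]
    by (rule extension_comp[OF bf bg bh _ I']) (simp add: compose_eq)
qed

lemma fmap_Hilb [simp]: "fmap (Hilb n d) = hilb_map n d" "fmap (Hilb_Delta n d \<Delta>) = hilb_map n d"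
  by (simp_all add: Hilb_def Hilb_Delta_def)

lemma is_functor_Hilb: "is_functor k (Hilb n d :: ('k, 'b, ((nat \<Rightarrow> nat) \<Rightarrow> 'b) set) alg_functor)"
  unfolding is_functor_def fmap_Hilb
proof (intro conjI allI impI funcsetI)
  fix B A :: "('k, 'b) module" and f I
  assume alg: "algebra k B" "algebra k A" "f \<in> hom_set k B A" and I: "I \<in> fobj (Hilb n d) B"
  note bf = base_change_hom_set[OF alg]
  show "hilb_map n d B A f I \<in> fobj (Hilb n d) A"
    unfolding hilb_map_eq_extension[OF bf I] by (rule Hilb_extension[OF bf I])
qed (rule hilb_map_id, assumption+, rule hilb_map_compose, assumption+)

lemma is_functor_Hilb_Delta: "is_functor k (Hilb_Delta n d \<Delta> :: ('k, 'b, ((nat \<Rightarrow> nat) \<Rightarrow> 'b) set) alg_functor)"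
  unfolding is_functor_def fmap_Hilb
proof (intro conjI allI impI funcsetI)
  fix B A :: "('k, 'b) module" and f I
  assume alg: "algebra k B" "algebra k A" "f \<in> hom_set k B A" and I: "I \<in> fobj (Hilb_Delta n d \<Delta>) B"
  note bf = base_change_hom_set[OF alg]
  show "hilb_map n d B A f I \<in> fobj (Hilb_Delta n d \<Delta>) A"
    unfolding hilb_map_eq_extension[OF bf Hilb_Delta_subset[OF algebra_imp_cring[OF alg(1)] I]]
    by (rule Hilb_Delta_extension[OF bf I])
qed (rule hilb_map_id, assumption, rule Hilb_Delta_subset[OF algebra_imp_cring], assumption+,
    rule hilb_map_compose, assumption+, rule Hilb_Delta_subset[OF algebra_imp_cring], assumption+)

lemma subfunctor_Hilb_Delta:
  "subfunctor k (Hilb_Delta n d \<Delta> :: ('k, 'b, ((nat \<Rightarrow> nat) \<Rightarrow> 'b) set) alg_functor) (Hilb n d)"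
  unfolding subfunctor_def nat_trans_def fmap_Hilb
  by (auto intro!: is_functor_Hilb is_functor_Hilb_Delta dest: Hilb_Delta_subset[OF algebra_imp_cring])


section \<open>The open embedding\<close>

text \<open>It collects the \<open>s\<close> for which the cokernel of the map from the span of
  \<Delta> vanishes after inverting \<open>s\<close>. The primes not containing this set form the
  union of the corresponding basic open sets.\<close>

definition spanning_locus ::
    "nat \<Rightarrow> (nat \<Rightarrow> nat) set \<Rightarrow> ('b, 'x) ring_scheme \<Rightarrow> ((nat \<Rightarrow> nat) \<Rightarrow> 'b) set \<Rightarrow> 'b set" where
  "spanning_locus n \<Delta> B I = {s \<in> carrier B. \<forall>q\<in>carrier (mpoly_ring n B). \<exists>k::nat.
     \<exists>w\<in>monomial_span n \<Delta> B. ((s [^]\<^bsub>B\<^esub> k) \<odot>\<^bsub>mpoly_ring n B\<^esub> q) \<ominus>\<^bsub>mpoly_ring n B\<^esub> w \<in> I}"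

text \<open>Applies the two local criteria at every prime \<open>P'\<close> of \<open>A\<close>: its
  preimage lies in the open set exactly when some \<open>s\<close> of the locus has
  \<open>f s\<close> outside \<open>P'\<close>.\<close>

lemma extension_in_Hilb_Delta_iff:
  fixes B A :: "('k, 'b) module"
  assumes bc: "base_change B A (exponents n) f" and I: "I \<in> fobj (Hilb n d) B"
  shows "extension f A (exponents n) I \<in> fobj (Hilb_Delta n d \<Delta>) A \<longleftrightarrow>
    spec_map B f ` spec A \<subseteq> {P \<in> spec B. \<not> spanning_locus n \<Delta> B I \<subseteq> P}"
proof -
  interpret base_change B A "exponents n" f by (rule bc)
  have I': "ideal I BM" "locally_free_quotient B BM I d"
    using I unfolding Hilb_iff[OF MB.R.cring_axioms] by (simp_all only: mpoly_ring_def)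
  have mem: "s \<in> spanning_locus n \<Delta> B I \<longleftrightarrow> s \<in> carrier B \<and> MB.spans_after \<Delta> I s" for s
    unfolding spanning_locus_def monomial_span_eq[OF MB.monoid_algebra_over_axioms] mpoly_ring_def mem_Collect_eq ..
  have iff: "extension f A (exponents n) I \<in> fobj (Hilb_Delta n d \<Delta>) A \<longleftrightarrow>
      (\<forall>v\<in>carrier AM. \<exists>w\<in>MA.supported \<Delta>. v \<ominus>\<^bsub>AM\<^esub> w \<in> ext I)"
    using Hilb_extension[OF bc I]
    unfolding Hilb_Delta_iff[OF MA.R.cring_axioms] monomial_span_eq[OF MA.monoid_algebra_over_axioms] mpoly_ring_def
    by blast
  show ?thesis
    unfolding iff
  proof
    assume span: "\<forall>v\<in>carrier AM. \<exists>w\<in>MA.supported \<Delta>. v \<ominus>\<^bsub>AM\<^esub> w \<in> ext I"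
    show "spec_map B f ` spec A \<subseteq> {P \<in> spec B. \<not> spanning_locus n \<Delta> B I \<subseteq> P}"
    proof (rule image_subsetI)
      fix P' assume "P' \<in> spec A"
      then have P': "primeideal P' A" by (simp add: spec_def)
      from spanning_extension_imp[OF I' P' bspec[OF span]]
      obtain s where "f s \<notin> P'" "s \<in> spanning_locus n \<Delta> B I" unfolding mem by blast
      then have "\<not> spanning_locus n \<Delta> B I \<subseteq> spec_map B f P'" by (auto simp: spec_map_def)
      moreover have "spec_map B f P' \<in> spec B"
        unfolding spec_def spec_map_def mem_Collect_eq by (rule primeideal_preimage[OF P'])
      ultimately show "spec_map B f P' \<in> {P \<in> spec B. \<not> spanning_locus n \<Delta> B I \<subseteq> P}" by simp
    qed
  next
    assume sub: "spec_map B f ` spec A \<subseteq> {P \<in> spec B. \<not> spanning_locus n \<Delta> B I \<subseteq> P}"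
    show "\<forall>v\<in>carrier AM. \<exists>w\<in>MA.supported \<Delta>. v \<ominus>\<^bsub>AM\<^esub> w \<in> ext I"
    proof
      fix v assume v: "v \<in> carrier AM"
      show "\<exists>w\<in>MA.supported \<Delta>. v \<ominus>\<^bsub>AM\<^esub> w \<in> ext I"
      proof (rule spanning_extension[OF I'(1) _ v])
        fix P' assume "primeideal P' A"
        then have "P' \<in> spec A" by (simp add: spec_def)
        then have "\<not> spanning_locus n \<Delta> B I \<subseteq> spec_map B f P'" using sub by blast
        then obtain s where s: "s \<in> spanning_locus n \<Delta> B I" "s \<notin> spec_map B f P'" by blast
        then have "s \<in> carrier B" "f s \<notin> P'" by (auto simp: mem spec_map_def)
        then show "\<exists>s\<in>carrier B. f s \<notin> P' \<and> MB.spans_after \<Delta> I s"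
          using s(1) unfolding mem by blast
      qed
    qed
  qed
qed

text \<open>The Yoneda argument: every \<open>f\<close> arises from the identity of \<open>B\<close>
  by composition with \<open>f\<close>, so naturality determines \<tau> from one ideal of
  B[x].\<close>

lemma nat_trans_h_spec_Hilb:
  fixes B A :: "('k, 'b) module"
  assumes B: "algebra k B" and A: "algebra k A" and \<tau>: "nat_trans k (h_spec k B) (Hilb n d) \<tau>"
    and f: "f \<in> hom_set k B A"
  shows "\<tau> B (\<lambda>b\<in>carrier B. b) \<in> fobj (Hilb n d) B"
    and "\<tau> A f = extension f A (exponents n) (\<tau> B (\<lambda>b\<in>carrier B. b))"
proof -
  let ?id = "\<lambda>b\<in>carrier B. b"
  have id: "?id \<in> fobj (h_spec k B) B" using hom_set_id[OF B] by (simp add: h_spec_def)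
  show 1: "\<tau> B ?id \<in> fobj (Hilb n d) B" using \<tau> B id by (auto simp: nat_trans_def)
  have "compose (carrier B) f ?id = f"
    using f by (auto simp: hom_set_def compose_def extensional_def fun_eq_iff)
  then have "fmap (h_spec k B) B A f ?id = f" by (simp add: h_spec_def)
  moreover have "\<tau> A (fmap (h_spec k B) B A f ?id) = hilb_map n d B A f (\<tau> B ?id)"
    using \<tau> A B f id unfolding nat_trans_def fmap_Hilb by blast
  ultimately show "\<tau> A f = extension f A (exponents n) (\<tau> B ?id)"
    using hilb_map_eq_extension[OF base_change_hom_set[OF B A f] 1] by simp
qed

theorem lemma1:
  fixes k :: "'k ring" and n d :: nat and \<Delta> :: "(nat \<Rightarrow> nat) set"
  assumes "cring k"
    and "d \<ge> 1"
    and "standard_set n \<Delta>"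
    and "card \<Delta> = d"
  shows "open_embedding k
    (Hilb_Delta n d \<Delta> :: ('k, 'b, ((nat \<Rightarrow> nat) \<Rightarrow> 'b) set) alg_functor) (Hilb n d)"
  unfolding open_embedding_def
proof (intro conjI allI impI subfunctor_Hilb_Delta)
  fix B :: "('k, 'b) module" and \<tau>
  assume B: "algebra k B" and \<tau>: "nat_trans k (h_spec k B) (Hilb n d) \<tau>"
  define I where "I = \<tau> B (\<lambda>b\<in>carrier B. b)"
  define U where "U = {P \<in> spec B. \<not> spanning_locus n \<Delta> B I \<subseteq> P}"
  let ?G = "Hilb_Delta n d \<Delta> :: ('k, 'b, ((nat \<Rightarrow> nat) \<Rightarrow> 'b) set) alg_functor"
  let ?F = "fibre_product ?G (\<lambda>A s. s) (h_spec k B) \<tau>"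
  have U: "spec_open B U"
    unfolding spec_open_def U_def by (intro exI[of _ "spanning_locus n \<Delta> B I"]) (auto simp: spanning_locus_def)
  have key: "\<tau> A f \<in> fobj ?G A \<longleftrightarrow> spec_map B f ` spec A \<subseteq> U" if A: "algebra k A" and f: "f \<in> hom_set k B A" for A f
  proof -
    note \<tau>f = nat_trans_h_spec_Hilb[OF B A \<tau> f, folded I_def]
    show ?thesis
      unfolding \<tau>f(2) U_def by (rule extension_in_Hilb_Delta_iff[OF base_change_hom_set[OF B A f] \<tau>f(1)])
  qed
  \<comment> \<open>The first component of a point of the fibre product is forced to be
    \<open>\<tau> A f\<close>, so the fibre product is the graph of \<tau> over the points of
    \<open>U\<close>, and the second projection is bijective.\<close>
  have fib: "fobj ?F A = (\<lambda>f. (\<tau> A f, f)) ` fobj (h_open k B U) A" if A: "algebra k A" for A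
    using key[OF A] by (auto simp: fibre_product_def h_spec_def h_open_def)
  have "nat_iso k ?F (h_open k B U) (\<lambda>A z. snd z)"
    unfolding nat_iso_def nat_trans_def
  proof (intro conjI allI impI)
    fix A :: "('k, 'b) module" assume A: "algebra k A"
    show "snd \<in> fobj ?F A \<rightarrow> fobj (h_open k B U) A" by (auto simp: fib[OF A])
    show "bij_betw snd (fobj ?F A) (fobj (h_open k B U) A)"
      unfolding fib[OF A] by (auto simp: bij_betw_def inj_on_def image_image)
  next
    fix A C :: "('k, 'b) module" and g s
    show "snd (fmap ?F A C g s) = fmap (h_open k B U) A C g (snd s)"
      by (simp add: fibre_product_def h_spec_def h_open_def split: prod.split)
  qed
  then show "\<exists>U. spec_open B U \<and> (\<exists>\<eta>. nat_iso k ?F (h_open k B U) \<eta> \<and>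
      (\<forall>A. algebra k A \<longrightarrow> (\<forall>z\<in>fobj ?F A. \<eta> A z = snd z)))"
    using U by (intro exI[of _ U] exI[of _ "\<lambda>A z. snd z"] conjI) auto
qed

end
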